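(* Let $d\ge 2$, let $\Gamma$ be a connected locally finite $\mathbb{Z}^d$-periodic graph, let $Q$ be a real-valued $\mathbb{Z}^d$-periodic potential on its vertex set $V$, and let $H=\Delta+Q$ be the Schrödinger operator on $\ell^2(V)$. With the notation fixed in the context: i) The total length of all spectral bands $\sigma_n(H)$, $n=1,\ldots,\nu$, of $H$ satisfies $$\sum_{n=1}^{\nu}|\sigma_n(H)|\le\sum_{n=\nu_D+1}^{\nu}\big(q_n^\bullet+2\varkappa_+-h_n\big)+\sum_{n=\nu+1}^{\nu_N}\lambda_n^N,$$ where $h_n=\rho_n(\varkappa_n-\varkappa_{nn}+q_n)$ and $\varkappa_{nn}$ is the number of loops in the vertex $v_n$ on the graph $\Gamma$; and $$\sum_{n=1}^{\nu}|\sigma_n(H)|\le\sum_{n=1}^{\nu-\nu_D}\big(\lambda^N_{\nu_N-(\nu-\nu_D)+n}-\lambda_n^N\big).$$ ii) The numbers $\nu_D=\#V_D$ and $\nu_N=\#V_N$ satisfy $$0\le\nu_D\le\nu-1,\qquad \nu+d\le\nu_N\le\nu+\frac{\beta}{2},$$ where $\beta=\#\mathcal{B}$ is the number of the bridges of $\Gamma$. Moreover, the boundaries of these inequalities are achieved.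
   Context: **Periodic graph.** $\Gamma=(V,\mathcal{E})$ is a connected graph with vertex set $V\subset\mathbb{R}^d$ and set $\mathcal{E}$ of unoriented edges; loops and multiple edges are allowed. An edge joining $u$ and $v$ is written $(u,v)_e$. The degree $\varkappa_v$ of $v\in V$ is the number of edges incident to $v$, a loop being counted twice. $\Gamma$ is locally finite and $\mathbb{Z}^d$-periodic: every bounded domain of $\mathbb{R}^d$ contains finitely many vertices, every degree is finite, and there is a basis $a_1,\ldots,a_d$ of $\mathbb{R}^d$ with $\Gamma+a_s=\Gamma$ for all $s=1,\ldots,d$. Points of $\mathbb{R}^d$ are expressed in coordinates with respect to $a_1,\ldots,a_d$ and a fixed origin $O$, so $\Gamma+m=\Gamma$ for all $m\in\mathbb{Z}^d$. Put $\varkappa_+=\sup_{v\in V}\varkappa_v<\infty$ and $V_F=[0,1)^d\cap V=\{v_1,\ldots,v_\nu\}$, $\nu=\#V_F<\infty$. Write $\varkappa_j=\varkappa_{v_j}$. **Operator.** On $\ell^2(V)$, $(\Delta f)(v)=\sum_{(v,u)_e\in\mathcal{E}}(f(v)-f(u))$ and $(Qf)(v)=Q(v)f(v)$, where $Q:V\to\mathbb{R}$ satisfies $Q(v+m)=Q(v)$ for all $v\in V$, $m\in\mathbb{Z}^d$; $H=\Delta+Q$. Put $q_j=Q(v_j)$, $j=1,\ldots,\nu$, and let $q_1^\bullet\le\ldots\le q_\nu^\bullet$ be the numbers $q_1,\ldots,q_\nu$ in nondecreasing order. **Spectral bands.** Each unoriented edge of $\Gamma$ gives two oriented edges $(u,v)$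 and $(v,u)$. For $\vartheta\in\mathbb{T}^d=\mathbb{R}^d/(2\pi\mathbb{Z})^d$ the Floquet matrix is the Hermitian $\nu\times\nu$ matrix $H(\vartheta)=\Delta(\vartheta)+\mathrm{diag}(q_1,\ldots,q_\nu)$ with $$\Delta_{jk}(\vartheta)=\varkappa_j\delta_{jk}-\sum e^{i\langle m,\vartheta\rangle},$$ the sum running over all oriented edges of $\Gamma$ starting at $v_j$ and ending at a vertex of the form $v_k+m$, $m\in\mathbb{Z}^d$ (an empty sum is $0$). $H$ is unitarily equivalent to the direct integral of the $H(\vartheta)$ over $\mathbb{T}^d$. Let $\lambda_1(\vartheta)\le\ldots\le\lambda_\nu(\vartheta)$ be the eigenvalues of $H(\vartheta)$ with multiplicity. The $n$-th spectral band is $\sigma_n(H)=\lambda_n(\mathbb{T}^d)=[\lambda_n^-,\lambda_n^+]$, with $\lambda_n^-=\min_\vartheta\lambda_n(\vartheta)$, $\lambda_n^+=\max_\vartheta\lambda_n(\vartheta)$, and $|\sigma_n(H)|=\lambda_n^+-\lambda_n^-$. **Finite graph $\Gamma_N$.** Let $\mathcal{E}_N^{in}$ be the set of edges of $\Gamma$ connecting vertices of $V_F$. A bridge is an edge of $\Gamma$ joining a vertex of $V_F$ with a vertex of $V\setminus V_F$; the set $\mathcal{B}$ of all bridges consists of pairs of bridges equivalent to each other under $\mathbb{Z}^d$-translation. Let $\mathcal{B}_N$ be the set obtained by taking one bridge from each pair. Then $\Gamma_N=(V_N,\mathcal{E}_N)$ with $\mathcal{E}_N=\mathcal{E}_N^{in}\cup\mathcal{B}_N$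 and $V_N=V_F\cup\{u\in V:(u,v)_e\in\mathcal{B}_N,\ v\in V_F\}$. For $v\in V_N$, $\varkappa_v^N$ denotes the degree of $v$ on $\Gamma_N$ and $\rho_v=\#\big((\{v\}+\mathbb{Z}^d)\cap V_N\big)$; write $\rho_n=\rho_{v_n}$. A vertex $v\in V_N$ is inner if $\varkappa_v^N=\varkappa_v$; $V_D$ is the set of all inner vertices. Put $\nu_N=\#V_N$, $\nu_D=\#V_D$. The vertices are numbered (without loss of generality, according to the source) so that $V_D=\{v_1,\ldots,v_{\nu_D}\}$. **Neumann operator.** The Neumann operator on $\ell^2(V_N)$ is $H_N=\Delta_N+Q$ with $$(\Delta_Nf)(v)=\rho_v\varkappa_v^Nf(v)-\sqrt{\rho_v}\sum_{(v,u)_e\in\mathcal{E}_N}\sqrt{\rho_u}\,f(u),\qquad v\in V_N.$$ Its eigenvalues, counted with multiplicity, are $\lambda_1^N\le\ldots\le\lambda_{\nu_N}^N$.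
   Formalization: Each loop is counted twice (once per orientation) in κ_nn and in the sum defining Δ_N; with κ_nn the plain number of loops the first inequality fails for Z^4 with one loop per vertex and Q=0 (16 > 15), and counting loops once in Δ_N breaks the second. *)

theory Defs
  imports
    "HOL-Analysis.Analysis"
    "HOL-Library.Uprod"
    "Jordan_Normal_Form.Char_Poly"
begin

text \<open>
  Points of \<open>\<real>\<^sup>d\<close> are given by their coordinates with respect to the periods
  \<open>a\<^sub>1, \<dots>, a\<^sub>d\<close>, so the period lattice is \<open>\<int>\<^sup>d\<close>.
  An unoriented edge is the unordered pair of its ends together with a label that tells parallel
  edges apart; a loop at \<open>v\<close> has ends \<open>Upair v v\<close>.
\<close>

no_notation Matrix.vec_index (infixl "$" 100)

type_synonym 'd edge = "(real^'d) uprod \<times> nat"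

definition int_lattice :: "(real^'d) set" where
  "int_lattice = {m. \<forall>s. m $ s \<in> \<int>}"

definition shift_edge :: "real^'d \<Rightarrow> 'd edge \<Rightarrow> 'd edge" where
  "shift_edge m e = (map_uprod (\<lambda>x. x + m) (fst e), snd e)"

definition incident :: "'d edge set \<Rightarrow> real^'d \<Rightarrow> 'd edge set" where
  "incident E v = {e \<in> E. v \<in> set_uprod (fst e)}"

definition loops_at :: "'d edge set \<Rightarrow> real^'d \<Rightarrow> 'd edge set" where
  "loops_at E v = {e \<in> E. fst e = Upair v v}"

definition degree :: "'d edge set \<Rightarrow> real^'d \<Rightarrow> nat" where
  "degree E v = card (incident E v) + card (loops_at E v)"

locale periodic_graph =
  fixes V :: "(real^'d) set" and E :: "'d edge set"
  assumes nonempty: "V \<noteq> {}"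
    and edge_ends: "\<And>e. e \<in> E \<Longrightarrow> set_uprod (fst e) \<subseteq> V"
    and connected: "\<And>u v. u \<in> V \<Longrightarrow> v \<in> V \<Longrightarrow>
      (u, v) \<in> {(x, y). \<exists>e\<in>E. fst e = Upair x y}\<^sup>*"
    and locally_finite: "\<And>S. bounded S \<Longrightarrow> finite (V \<inter> S)"
    and degree_finite: "\<And>v. v \<in> V \<Longrightarrow> finite (incident E v)"
    and periodic_verts: "\<And>m. m \<in> int_lattice \<Longrightarrow> (\<lambda>x. x + m) ` V = V"
    and periodic_edges: "\<And>m. m \<in> int_lattice \<Longrightarrow> shift_edge m ` E = E"

definition periodic_potential :: "(real^'d) set \<Rightarrow> (real^'d \<Rightarrow> real) \<Rightarrow> bool" where
  "periodic_potential V Q \<longleftrightarrow> (\<forall>v\<in>V. \<forall>m\<in>int_lattice. Q (v + m) = Q v)"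

definition max_degree :: "(real^'d) set \<Rightarrow> 'd edge set \<Rightarrow> nat" where
  "max_degree V E = (SUP v\<in>V. degree E v)"

definition fund_verts :: "(real^'d) set \<Rightarrow> (real^'d) set" where
  "fund_verts V = {x \<in> V. \<forall>s. 0 \<le> x $ s \<and> x $ s < 1}"

text \<open>
  An oriented edge \<open>(u, w, e, r)\<close> runs from \<open>u\<close> to \<open>w\<close> along \<open>e\<close>. If \<open>u \<noteq> w\<close>, then
  \<open>r = False\<close> and \<open>e\<close> yields \<open>(u, w, e, False)\<close> and \<open>(w, u, e, False)\<close>; a loop at \<open>v\<close> yields
  \<open>(v, v, e, False)\<close> and \<open>(v, v, e, True)\<close>. So every unoriented edge, loop or not, gives exactly
  two oriented edges, and \<open>degree E v\<close> is the number of oriented edges starting at \<open>v\<close>.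
\<close>

type_synonym 'd oriented_edge = "(real^'d) \<times> (real^'d) \<times> 'd edge \<times> bool"

definition oriented_edges :: "'d edge set \<Rightarrow> 'd oriented_edge set" where
  "oriented_edges E = {(u, w, e, r). e \<in> E \<and> fst e = Upair u w \<and> (r \<longrightarrow> u = w)}"

text \<open>
  The number of loops at \<open>v\<close>; as in the degree and in the Floquet matrix, a loop is
  counted with its two orientations: \<open>loop_number E v = 2 * card (loops_at E v)\<close>.
\<close>

definition loop_number :: "'d edge set \<Rightarrow> real^'d \<Rightarrow> nat" where
  "loop_number E v = card {(u, w, e, r) \<in> oriented_edges E. u = v \<and> w = v}"

text \<open>
  For a Hermitian matrix \<open>A\<close> all roots of the characteristic polynomial are real and their
  multiplicities are those of the eigenvalues; \<open>eigval A n\<close> is the \<open>n\<close>-th smallest eigenvalue,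
  starting with \<open>n = 1\<close>.
\<close>

definition eigval :: "complex mat \<Rightarrow> nat \<Rightarrow> real" where
  "eigval A n = sorted_list_of_multiset (image_mset Re (proots (char_poly A))) ! (n - 1)"

text \<open>
  From here on \<open>v :: nat \<Rightarrow> real^'d\<close> is a numbering of vertices starting with \<open>v 1\<close>, whereas
  matrix indices start with \<open>0\<close>. In entry \<open>(j, k)\<close> the oriented edges end at
  \<open>w = v (k + 1) + m\<close> with \<open>m \<in> int_lattice\<close>, so \<open>w - v (k + 1)\<close> is \<open>m\<close>.
\<close>

definition floquet_matrix ::
  "(real^'d) set \<Rightarrow> 'd edge set \<Rightarrow> (real^'d \<Rightarrow> real) \<Rightarrow> (nat \<Rightarrow> real^'d) \<Rightarrow> real^'d \<Rightarrow> complex mat"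
where
  "floquet_matrix V E Q v \<theta> =
    mat (card (fund_verts V)) (card (fund_verts V)) (\<lambda>(j, k).
      (if j = k then complex_of_real (real (degree E (v (j + 1))) + Q (v (j + 1))) else 0)
      - (\<Sum>(u, w, e, r) \<in> {(u, w, e, r) \<in> oriented_edges E.
            u = v (j + 1) \<and> w - v (k + 1) \<in> int_lattice}.
          exp (\<i> * complex_of_real ((w - v (k + 1)) \<bullet> \<theta>))))"

text \<open>
  Functions on the torus \<open>\<real>\<^sup>d/(2\<pi>\<int>)\<^sup>d\<close> are taken as functions on \<open>real^'d\<close>; since the eigenvalues
  depend continuously and periodically on \<open>\<theta>\<close>, supremum and infimum are attained.
\<close>

definition band ::
  "(real^'d) set \<Rightarrow> 'd edge set \<Rightarrow> (real^'d \<Rightarrow> real) \<Rightarrow> (nat \<Rightarrow> real^'d) \<Rightarrow> nat \<Rightarrow> real set"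
where
  "band V E Q v n = range (\<lambda>\<theta>. eigval (floquet_matrix V E Q v \<theta>) n)"

definition band_length ::
  "(real^'d) set \<Rightarrow> 'd edge set \<Rightarrow> (real^'d \<Rightarrow> real) \<Rightarrow> (nat \<Rightarrow> real^'d) \<Rightarrow> nat \<Rightarrow> real"
where
  "band_length V E Q v n = Sup (band V E Q v n) - Inf (band V E Q v n)"

definition inner_edges :: "(real^'d) set \<Rightarrow> 'd edge set \<Rightarrow> 'd edge set" where
  "inner_edges V E = {e \<in> E. set_uprod (fst e) \<subseteq> fund_verts V}"

definition bridges :: "(real^'d) set \<Rightarrow> 'd edge set \<Rightarrow> 'd edge set" where
  "bridges V E =
    {e \<in> E. \<exists>u w. fst e = Upair u w \<and> u \<in> fund_verts V \<and> w \<in> V - fund_verts V}"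

definition equivalent_edges :: "('d::finite) edge \<Rightarrow> 'd edge \<Rightarrow> bool" where
  "equivalent_edges e e' \<longleftrightarrow> (\<exists>m\<in>int_lattice. e' = shift_edge m e)"

text \<open>\<open>B\<close> contains exactly one bridge from each class of equivalent bridges.\<close>

definition bridge_choice :: "(real^'d) set \<Rightarrow> 'd edge set \<Rightarrow> 'd edge set \<Rightarrow> bool" where
  "bridge_choice V E B \<longleftrightarrow>
    B \<subseteq> bridges V E \<and> (\<forall>e\<in>bridges V E. \<exists>!e'. e' \<in> B \<and> equivalent_edges e e')"

definition edges_N :: "(real^'d) set \<Rightarrow> 'd edge set \<Rightarrow> 'd edge set \<Rightarrow> 'd edge set" where
  "edges_N V E B = inner_edges V E \<union> B"

definition verts_N :: "(real^'d) set \<Rightarrow> 'd edge set \<Rightarrow> (real^'d) set" where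
  "verts_N V B =
    fund_verts V \<union> {u \<in> V. \<exists>e\<in>B. \<exists>w\<in>fund_verts V. fst e = Upair u w}"

definition rho :: "(real^'d) set \<Rightarrow> 'd edge set \<Rightarrow> real^'d \<Rightarrow> nat" where
  "rho V B x = card ((\<lambda>m. x + m) ` int_lattice \<inter> verts_N V B)"

definition inner_verts :: "(real^'d) set \<Rightarrow> 'd edge set \<Rightarrow> 'd edge set \<Rightarrow> (real^'d) set" where
  "inner_verts V E B = {x \<in> verts_N V B. degree (edges_N V E B) x = degree E x}"

text \<open>
  The sum in \<open>\<Delta>\<^sub>N\<close> runs over the oriented edges of \<open>\<Gamma>\<^sub>N\<close> starting at \<open>x\<close>, so that a loop enters
  it twice, just as it enters the degree twice.
\<close>

definition neumann_op ::
  "(real^'d) set \<Rightarrow> 'd edge set \<Rightarrow> (real^'d \<Rightarrow> real) \<Rightarrow> 'd edge set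
    \<Rightarrow> (real^'d \<Rightarrow> complex) \<Rightarrow> real^'d \<Rightarrow> complex"
where
  "neumann_op V E Q B f x =
    of_real (real (rho V B x) * real (degree (edges_N V E B) x)) * f x
    - of_real (sqrt (real (rho V B x))) *
      (\<Sum>(u, w, e, r) \<in> {(u, w, e, r) \<in> oriented_edges (edges_N V E B). u = x}.
        of_real (sqrt (real (rho V B w))) * f w)
    + of_real (Q x) * f x"

text \<open>The matrix of \<open>H\<^sub>N\<close> in the standard basis of \<open>\<ell>\<^sup>2(V\<^sub>N)\<close>, numbered by \<open>v\<close>.\<close>

definition neumann_matrix ::
  "(real^'d) set \<Rightarrow> 'd edge set \<Rightarrow> (real^'d \<Rightarrow> real) \<Rightarrow> 'd edge set
    \<Rightarrow> (nat \<Rightarrow> real^'d) \<Rightarrow> complex mat"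
where
  "neumann_matrix V E Q B v =
    mat (card (verts_N V B)) (card (verts_N V B)) (\<lambda>(i, j).
      neumann_op V E Q B (indicator {v (j + 1)}) (v (i + 1)))"

definition vertex_numbering ::
  "(real^'d) set \<Rightarrow> 'd edge set \<Rightarrow> (nat \<Rightarrow> real^'d) \<Rightarrow> bool"
where
  "vertex_numbering V B v \<longleftrightarrow>
    bij_betw v {1..card (verts_N V B)} (verts_N V B) \<and>
    v ` {1..card (fund_verts V)} = fund_verts V"

text \<open>\<open>ordered_potential V Q v n\<close> is the \<open>n\<close>-th smallest of \<open>Q (v 1), \<dots>, Q (v \<nu>)\<close>.\<close>

definition ordered_potential ::
  "(real^'d) set \<Rightarrow> (real^'d \<Rightarrow> real) \<Rightarrow> (nat \<Rightarrow> real^'d) \<Rightarrow> nat \<Rightarrow> real"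
where
  "ordered_potential V Q v n = sort (map (\<lambda>j. Q (v j)) [1..<card (fund_verts V) + 1]) ! (n - 1)"

definition h_number ::
  "(real^'d) set \<Rightarrow> 'd edge set \<Rightarrow> (real^'d \<Rightarrow> real) \<Rightarrow> 'd edge set \<Rightarrow> real^'d \<Rightarrow> real"
where
  "h_number V E Q B x = real (rho V B x) * (real (degree E x) - real (loop_number E x) + Q x)"

end

theory Submission
  imports Defs
begin

text \<open>
  The edges of \<open>\<Gamma>\<^sub>N\<close> represent every translation class of edges of \<open>\<Gamma>\<close> exactly once. Hence, if a
  function on \<open>V\<^sub>F\<close> is continued quasi-periodically to \<open>V\<^sub>N\<close> and divided by \<open>\<surd>\<rho>\<close>, one gets an
  isometry that compresses \<open>H\<^sub>N\<close> to the Floquet matrix \<open>H(\<theta>)\<close>. At the inner vertices \<open>H(\<theta>)\<close>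
  depends on \<open>\<theta>\<close> only through a gauge transformation, so it compresses further to a Dirichlet
  matrix \<open>H\<^sub>D\<close> that is independent of \<open>\<theta>\<close>. Cauchy interlacing encloses every band between
  eigenvalues of \<open>H\<^sub>N\<close> and \<open>H\<^sub>D\<close>; summed over the bands, the eigenvalues of \<open>H\<^sub>D\<close> cancel, which is
  the second inequality. For the first one, the bands without a Dirichlet bound are bounded by
  \<open>H(\<theta>) \<le> diag q + 2\<kappa>\<^sub>+\<close>, and the eigenvalue sums are evaluated as traces.

  If every translation class had an inner vertex, then the inner vertices would be closed under
  adjacency, so \<open>V\<close> would be finite. If the integer parts of the vertices of \<open>V\<^sub>N - V\<^sub>F\<close> did not
  span \<open>\<real>\<^sup>d\<close>, then a linear functional of the integer part would be constant along all edges,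
  contradicting connectedness. The cubic lattice attains all four bounds.
\<close>

section \<open>Eigenvalues of Hermitian matrices\<close>

text \<open>The weights \<open>rho\<close> are made for this comparison: a class with
  \<open>rho\<close> copies in the finite graph carries a normalized continuation only after
  division by the square root of \<open>rho\<close>. The factors in \<open>neumann_op\<close> undo
  exactly this division, while the degrees of the copies add up to the degree in the periodic graph.

  An inner vertex uses up the whole degree of its class, so every other copy is isolated in the
  finite graph; this is why the phases at inner classes can be gauged away. Dirichlet bounds exist
  from above for the lowest \<open>\<nu>\<^sub>D\<close> bands and from below for the highest
  \<open>\<nu>\<^sub>D\<close> bands, so each Dirichlet eigenvalue is used once on either side.

  The trace evaluation is more delicate: for some choices of bridges an inner vertex lies outside
  \<open>V\<^sub>F\<close>. Its class then also contains an isolated copy in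
  \<open>V\<^sub>F\<close>, and \<open>rho\<close> is 2 instead of 1. A numbering that starts with
  \<open>V\<^sub>F\<close> and also with the inner vertices excludes this; the first inequality
  assumes such a numbering.\<close>

definition adj :: "complex mat \<Rightarrow> complex mat" where
  "adj A = mat (dim_col A) (dim_row A) (\<lambda>(i, j). cnj (A $$ (j, i)))"

lemma dim_adj [simp]: "dim_row (adj A) = dim_col A" "dim_col (adj A) = dim_row A"
  by (simp_all add: adj_def)

lemma adj_carrier [simp]: "A \<in> carrier_mat n m \<Longrightarrow> adj A \<in> carrier_mat m n"
  by (intro carrier_matI) auto

lemma index_adj [simp]: "i < dim_col A \<Longrightarrow> j < dim_row A \<Longrightarrow> adj A $$ (i, j) = cnj (A $$ (j, i))"
  by (simp add: adj_def)

lemma index_mult_mat_sum: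
  assumes "A \<in> carrier_mat n m" "B \<in> carrier_mat m k" "i < n" "j < k"
  shows "(A * B) $$ (i, j) = (\<Sum>l<m. A $$ (i, l) * B $$ (l, j))"
  using assms by (auto simp: scalar_prod_def lessThan_atLeast0)

lemma adj_mult:
  assumes A: "A \<in> carrier_mat n m" and B: "B \<in> carrier_mat m k"
  shows "adj (A * B) = adj B * adj A"
proof (rule eq_matI)
  fix i j assume ij: "i < dim_row (adj B * adj A)" "j < dim_col (adj B * adj A)"
  have [simp]: "i < k" "j < n" using ij A B by auto
  have "adj (A * B) $$ (i, j) = cnj ((A * B) $$ (j, i))"
    using A B ij by (subst index_adj) auto
  also have "\<dots> = (\<Sum>l<m. cnj (A $$ (j, l)) * cnj (B $$ (l, i)))"
    by (subst index_mult_mat_sum[OF A B]) (use ij A B in auto)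
  also have "\<dots> = (\<Sum>l<m. adj B $$ (i, l) * adj A $$ (l, j))"
    by (rule sum.cong) (use ij A B in auto)
  also have "\<dots> = (adj B * adj A) $$ (i, j)"
    by (rule index_mult_mat_sum[symmetric]) (use ij A B in auto)
  finally show "adj (A * B) $$ (i, j) = (adj B * adj A) $$ (i, j)" .
qed (use A B in auto)

lemma adj_adj [simp]: "adj (adj A) = A"
  by (rule eq_matI) auto

text \<open>Householder reflection along \<open>w = e_0 - v\<close>. A Hermitian \<open>W\<close>
  with first column \<open>v\<close> must have a real entry \<open>v 0\<close>; conversely, this
  reality makes the squared norm of \<open>w\<close> equal to \<open>2 * w 0\<close>, which turns
  the first column into \<open>v\<close>.\<close>

lemma unitary_reflection:
  fixes v :: "nat \<Rightarrow> complex"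
  assumes n: "n > 0" and v1: "(\<Sum>i<n. v i * cnj (v i)) = 1" and v0: "cnj (v 0) = v 0"
  shows "\<exists>W \<in> carrier_mat n n. adj W = W \<and> W * W = 1\<^sub>m n \<and> (\<forall>i<n. W $$ (i, 0) = v i)"
proof -
  define w where "w i = (if i = 0 then 1 else 0) - v i" for i
  define S where "S = (\<Sum>i<n. w i * cnj (w i))"
  \<comment> \<open>If \<open>v\<close> is the first basis vector, then \<open>S = 0\<close>,
    division by zero yields \<open>c = 0\<close>, and \<open>W\<close> is the identity, as it should
    be.\<close>
  define c where "c = 2 / S"
  define W where "W = mat n n (\<lambda>(i, j). (if i = j then 1 else 0) - c * w i * cnj (w j))"
  have S_real: "S = of_real (\<Sum>i<n. (cmod (w i))\<^sup>2)"
    unfolding S_def of_real_sum complex_norm_square ..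
  have S: "S = 2 * w 0"
  proof -
    have "S = (\<Sum>i<n. (if i = 0 then 1 - v 0 - cnj (v 0) else 0) + v i * cnj (v i))"
      unfolding S_def w_def by (intro sum.cong) (auto simp: algebra_simps)
    also have "\<dots> = (1 - v 0 - cnj (v 0)) + 1"
      using n by (simp add: sum.distrib v1 sum.delta)
    also have "\<dots> = 2 * w 0" using v0 by (simp add: w_def)
    finally show ?thesis .
  qed
  have cc: "c * c * S = 2 * c" and ccnj: "cnj c = c"
    unfolding c_def using S_real by auto
  have W: "W \<in> carrier_mat n n" by (simp add: W_def)
  have adjW: "adj W = W"
    by (rule eq_matI) (use W ccnj in \<open>auto simp: W_def adj_def mult_ac\<close>)
  have WW: "W * W = 1\<^sub>m n"
  proof (rule eq_matI)
    fix i j assume "i < dim_row (1\<^sub>m n :: complex mat)" "j < dim_col (1\<^sub>m n :: complex mat)"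
    then have ij: "i < n" "j < n" by auto
    have "(W * W) $$ (i, j) = (\<Sum>k<n. W $$ (i, k) * W $$ (k, j))"
      by (rule index_mult_mat_sum[OF W W ij])
    also have "\<dots> = (\<Sum>k<n. (if k = i then (if i = j then 1 else 0) - c * w i * cnj (w j) else 0)
        - (if k = j then c * w i * cnj (w j) else 0)
        + c * c * w i * cnj (w j) * (w k * cnj (w k)))"
      by (intro sum.cong) (use ij in \<open>auto simp: W_def algebra_simps\<close>)
    also have "\<dots> = (if i = j then 1 else 0) - c * w i * cnj (w j) - c * w i * cnj (w j)
        + c * c * w i * cnj (w j) * S"
      using ij by (simp add: sum.distrib sum_subtractf sum.delta sum_distrib_left S_def)
    also have "c * c * w i * cnj (w j) * S = 2 * c * w i * cnj (w j)"
      using cc by (metis (no_types, opaque_lifting) mult.assoc mult.commute)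
    finally show "(W * W) $$ (i, j) = 1\<^sub>m n $$ (i, j)"
      using ij by simp
  qed (use W in auto)
  have "W $$ (i, 0) = v i" if i: "i < n" for i
  proof -
    have "c * w i * cnj (w 0) = w i"
    proof (cases "S = 0")
      case True
      then have "(\<Sum>i<n. (cmod (w i))\<^sup>2) = 0" using S_real by (metis of_real_eq_0_iff)
      then have "w i = 0" using i by (subst (asm) sum_nonneg_eq_0_iff) auto
      then show ?thesis by simp
    next
      case False
      have "cnj (w 0) = w 0" using v0 by (simp add: w_def)
      then show ?thesis using False S by (auto simp: c_def)
    qed
    moreover have "W $$ (i, 0) = (if i = 0 then 1 else 0) - c * w i * cnj (w 0)"
      using i n by (simp add: W_def)
    ultimately have "W $$ (i, 0) = (if i = 0 then 1 else 0) - w i" by metis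
    then show ?thesis by (simp add: w_def)
  qed
  with W adjW WW show ?thesis by blast
qed

text \<open>Deflation: a reflection moves an eigenvector for the head of the list to the first basis
  vector, Hermitian symmetry clears the first row along with the first column, and the tail of the
  list consists of the roots of the remaining block. The diagonal follows the order of the given
  list, so a caller can prescribe it.\<close>

lemma hermitian_unitary_diagonalization:
  assumes "A \<in> carrier_mat n n" "adj A = A" "char_poly A = (\<Prod>e\<leftarrow>es. [:- e, 1:])"
  shows "\<exists>U \<in> carrier_mat n n. adj U * U = 1\<^sub>m n
    \<and> adj U * A * U = mat n n (\<lambda>(i, j). if i = j then es ! i else 0)"
  using assms
proof (induction es arbitrary: n A)
  case Nil
  then have "n = 0" using degree_monic_char_poly[of A n] by auto
  then show ?case using Nil
    by (intro bexI[of _ "1\<^sub>m 0"] conjI eq_matI) auto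
next
  case (Cons e es)
  note A = Cons.prems(1)
  have n: "n \<noteq> 0"
  proof
    assume "n = 0"
    then have "Polynomial.degree (char_poly A) = 0" using degree_monic_char_poly[OF A] by auto
    moreover have "Polynomial.degree (char_poly A) = Suc (Polynomial.degree (\<Prod>e\<leftarrow>es. [:- e, 1:]))"
      unfolding Cons.prems(3) list.map prod_list.Cons
      by (subst degree_mult_eq) (auto simp: prod_list_zero_iff)
    ultimately show False by simp
  qed
  then obtain m where m: "n = Suc m" by (cases n) auto
  have "eigenvalue A e" using Cons.prems(3) by (simp add: eigenvalue_root_char_poly[OF A])
  then obtain x where x: "x \<in> carrier_vec n" "x \<noteq> 0\<^sub>v n" "A *\<^sub>v x = e \<cdot>\<^sub>v x"
    unfolding eigenvalue_def eigenvector_def using A by auto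
  have Ax: "(\<Sum>j<n. A $$ (i, j) * vec_index x j) = e * vec_index x i" if "i < n" for i
  proof -
    have "(\<Sum>j<n. A $$ (i, j) * vec_index x j) = vec_index (A *\<^sub>v x) i"
      using A x(1) that by (auto simp: mult_mat_vec_def scalar_prod_def lessThan_atLeast0)
    then show ?thesis using x that by simp
  qed
  define R where "R = sqrt (\<Sum>i<n. (cmod (vec_index x i))\<^sup>2)"
  have "\<exists>i<n. vec_index x i \<noteq> 0"
    using x(1,2) by (metis carrier_vecD eq_vecI index_zero_vec(1) index_zero_vec(2))
  then have "(\<Sum>i<n. (cmod (vec_index x i))\<^sup>2) > 0"
    by (auto intro: sum_pos2)
  then have R: "R > 0" "R\<^sup>2 = (\<Sum>i<n. (cmod (vec_index x i))\<^sup>2)" by (simp_all add: R_def)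
  \<comment> \<open>the phase that makes the first entry real\<close>
  define p where "p = (if vec_index x 0 = 0 then 1 else cnj (vec_index x 0) / of_real (cmod (vec_index x 0)))"
  have p: "p * cnj p = 1"
  proof -
    have "cmod p = 1" by (auto simp: p_def norm_divide)
    then show ?thesis using complex_norm_square[of p] by simp
  qed
  define v where "v i = p * vec_index x i / of_real R" for i
  have v1: "(\<Sum>i<n. v i * cnj (v i)) = 1"
  proof -
    have "(\<Sum>i<n. v i * cnj (v i)) = (\<Sum>i<n. of_real ((cmod (vec_index x i))\<^sup>2) / of_real (R\<^sup>2))"
    proof (intro sum.cong refl)
      fix i
      have "v i * cnj (v i) = (p * cnj p) * (vec_index x i * cnj (vec_index x i)) / of_real (R\<^sup>2)"
        by (simp add: v_def power2_eq_square mult_ac)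
      then show "v i * cnj (v i) = of_real ((cmod (vec_index x i))\<^sup>2) / of_real (R\<^sup>2)"
        by (simp only: p mult_1_left complex_norm_square)
    qed
    also have "\<dots> = 1" unfolding sum_divide_distrib[symmetric] of_real_sum[symmetric] R(2)[symmetric]
      using R(1) by simp
    finally show ?thesis .
  qed
  have v0: "cnj (v 0) = v 0" by (auto simp: v_def p_def mult.commute)
  have Av: "(\<Sum>j<n. A $$ (i, j) * v j) = e * v i" if "i < n" for i
  proof -
    have "(\<Sum>j<n. A $$ (i, j) * v j) = (\<Sum>j<n. A $$ (i, j) * vec_index x j) * p / of_real R"
      unfolding v_def sum_distrib_right sum_divide_distrib by (intro sum.cong) (auto simp: mult_ac)
    then show ?thesis by (simp add: Ax[OF that] v_def)
  qed
  obtain W where W: "W \<in> carrier_mat n n" and adjW: "adj W = W" and WW: "W * W = 1\<^sub>m n"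
    and Wv: "\<And>i. i < n \<Longrightarrow> W $$ (i, 0) = v i"
    using unitary_reflection[OF _ v1 v0] n by auto
  define A' where "A' = W * A * W"
  have A': "A' \<in> carrier_mat n n" using A W by (simp add: A'_def)
  have adjA': "adj A' = A'"
    unfolding A'_def using A W Cons.prems(2) adjW
    by (simp add: adj_mult[of W n n "A * W" n] adj_mult[of A n n W n] assoc_mult_mat[of W n n A n W n])
  have col0: "A' $$ (i, 0) = (if i = 0 then e else 0)" if i: "i < n" for i
  proof -
    have "A' $$ (i, 0) = (W * (A * W)) $$ (i, 0)"
      using A W by (simp add: A'_def assoc_mult_mat[of W n n A n W n])
    also have "\<dots> = (\<Sum>k<n. W $$ (i, k) * (A * W) $$ (k, 0))"
      by (rule index_mult_mat_sum[of _ n n _ n]) (use A W i n in auto)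
    also have "\<dots> = (\<Sum>k<n. W $$ (i, k) * (e * W $$ (k, 0)))"
    proof (intro sum.cong refl)
      fix k assume "k \<in> {..<n}"
      then have k: "k < n" by simp
      have "(A * W) $$ (k, 0) = (\<Sum>j<n. A $$ (k, j) * v j)"
        using n by (subst index_mult_mat_sum[OF A W k]) (auto simp: Wv)
      then show "W $$ (i, k) * (A * W) $$ (k, 0) = W $$ (i, k) * (e * W $$ (k, 0))"
        using Av[OF k] Wv[OF k] by simp
    qed
    also have "\<dots> = e * (W * W) $$ (i, 0)"
      using n by (subst index_mult_mat_sum[OF W W i]) (auto simp: sum_distrib_left mult_ac)
    finally show ?thesis using i n by (simp add: WW)
  qed
  have row0: "A' $$ (0, j) = (if j = 0 then e else 0)" if j: "j < n" for j
  proof (cases "j = 0")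
    case True
    then show ?thesis using col0[of 0] n by simp
  next
    case False
    have "A' $$ (0, j) = cnj (A' $$ (j, 0))"
      using A' j n by (subst adjA'[symmetric]) (auto simp del: adj_adj)
    then show ?thesis using col0[OF j] False by simp
  qed
  define A3 where "A3 = mat m m (\<lambda>(i, j). A' $$ (Suc i, Suc j))"
  have A3: "A3 \<in> carrier_mat m m" by (simp add: A3_def)
  have adjA3: "adj A3 = A3"
  proof (rule eq_matI)
    fix i j assume "i < dim_row A3" "j < dim_col A3"
    then have ij: "i < m" "j < m" using A3 by auto
    have "A' $$ (Suc i, Suc j) = cnj (A' $$ (Suc j, Suc i))"
      using A' ij m by (subst adjA'[symmetric]) (auto simp del: adj_adj)
    then show "adj A3 $$ (i, j) = A3 $$ (i, j)" using ij by (simp add: A3_def)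
  qed (use A3 in auto)
  define E1 where "E1 = mat 1 1 (\<lambda>_. e)"
  have E1: "E1 \<in> carrier_mat 1 1" by (simp add: E1_def)
  have block: "A' = four_block_mat E1 (0\<^sub>m 1 m) (0\<^sub>m m 1) A3"
  proof (rule eq_matI)
    fix i j assume "i < dim_row (four_block_mat E1 (0\<^sub>m 1 m) (0\<^sub>m m 1) A3)"
      "j < dim_col (four_block_mat E1 (0\<^sub>m 1 m) (0\<^sub>m m 1) A3)"
    then have "i < n" "j < n" using E1 A3 m by auto
    then show "A' $$ (i, j) = four_block_mat E1 (0\<^sub>m 1 m) (0\<^sub>m m 1) A3 $$ (i, j)"
      using col0[of i] row0[of j] m by (cases i; cases j) (auto simp: E1_def A3_def)
  qed (use A' A3 E1 m in auto)
  have "similar_mat A' A"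
    unfolding similar_mat_def using similar_mat_witI[OF WW WW A'_def A' A W W] by blast
  then have "char_poly A' = char_poly A" by (rule char_poly_similar)
  moreover have "char_poly A' = char_poly E1 * char_poly A3"
    unfolding block by (rule char_poly_four_block_zeros_col[OF E1 _ A3]) simp
  moreover have "char_poly E1 = [:- e, 1:]"
    by (simp add: E1_def char_poly_defs det_def sign_def)
  ultimately have "[:- e, 1:] * char_poly A3 = [:- e, 1:] * (\<Prod>e\<leftarrow>es. [:- e, 1:])"
    using Cons.prems(3) by simp
  then have "char_poly A3 = (\<Prod>e\<leftarrow>es. [:- e, 1:])"
    by (metis mult_cancel_left pCons_eq_0_iff zero_neq_one)
  from Cons.IH[OF A3 adjA3 this] obtain U3 where U3: "U3 \<in> carrier_mat m m"
    and UU3: "adj U3 * U3 = 1\<^sub>m m"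
    and D3: "adj U3 * A3 * U3 = mat m m (\<lambda>(i, j). if i = j then es ! i else 0)" by blast
  define F where "F = four_block_mat (1\<^sub>m 1) (0\<^sub>m 1 m) (0\<^sub>m m 1) U3"
  have F: "F \<in> carrier_mat n n"
    using four_block_carrier_mat[of "1\<^sub>m 1" 1 1 U3 m m] U3 m by (simp add: F_def)
  have adjF: "adj F = four_block_mat (1\<^sub>m 1) (0\<^sub>m 1 m) (0\<^sub>m m 1) (adj U3)"
    by (rule eq_matI) (use U3 in \<open>auto simp: F_def\<close>)
  have FF: "adj F * F = 1\<^sub>m n"
    unfolding adjF unfolding F_def using U3 UU3 m
    by (subst mult_four_block_mat[of _ 1 1 _ m _ m _ _ 1 _ m]) (auto intro!: eq_matI)
  have FAF: "adj F * A' * F = mat n n (\<lambda>(i, j). if i = j then (e # es) ! i else 0)"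
  proof -
    have "adj F * A' = four_block_mat E1 (0\<^sub>m 1 m) (0\<^sub>m m 1) (adj U3 * A3)"
      unfolding adjF block using U3 A3 E1
      by (subst mult_four_block_mat[of _ 1 1 _ m _ m _ _ 1 _ m]) auto
    then have "adj F * A' * F = four_block_mat E1 (0\<^sub>m 1 m) (0\<^sub>m m 1) (adj U3 * A3 * U3)"
      unfolding F_def using U3 A3 E1
      by (simp, subst mult_four_block_mat[of _ 1 1 _ m _ m _ _ 1 _ m]) auto
    also have "\<dots> = mat n n (\<lambda>(i, j). if i = j then (e # es) ! i else 0)"
      unfolding D3 by (rule eq_matI) (auto simp: E1_def m nth_Cons split: nat.split)
    finally show ?thesis .
  qed
  have U: "W * F \<in> carrier_mat n n" using W F by simp
  have aU: "adj (W * F) = adj F * W" using adj_mult[OF W F] adjW by simp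
  have "adj (W * F) * (W * F) = adj F * (W * W) * F"
    unfolding aU using W F
    by (simp add: assoc_mult_mat[of "adj F" n n _ n _ n] assoc_mult_mat[of W n n _ n _ n])
  then have UU: "adj (W * F) * (W * F) = 1\<^sub>m n" using WW FF F by simp
  have "adj (W * F) * A * (W * F) = adj F * A' * F"
    unfolding aU A'_def using A W F
    by (simp add: assoc_mult_mat[of "adj F" n n _ n _ n] assoc_mult_mat[of W n n _ n _ n]
        assoc_mult_mat[of A n n _ n _ n] assoc_mult_mat[of "adj F * W" n n _ n _ n])
  with U UU FAF show ?case by metis
qed

section \<open>Eigenvalues in increasing order and orthonormal eigenbases\<close>

lemma proots_prod_linear:
  "proots (\<Prod>e\<leftarrow>as. [:- e, 1:]) = mset (as :: complex list)"
proof (induction as)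
  case (Cons a as)
  have "(\<Prod>e\<leftarrow>as. [:- e, 1:]) \<noteq> 0" by (auto simp: prod_list_zero_iff)
  then have "proots ([:- a, 1:] * (\<Prod>e\<leftarrow>as. [:- e, 1:])) = {#a#} + mset as"
    by (subst proots_mult) (auto simp: Cons)
  then show ?case by simp
qed simp

lemma eigval_list:
  assumes cp: "char_poly A = (\<Prod>e\<leftarrow>map complex_of_real xs. [:- e, 1:])" and sorted: "sorted xs"
  shows "eigval A n = xs ! (n - 1)"
proof -
  have "proots (char_poly A) = mset (map complex_of_real xs)"
    unfolding cp by (rule proots_prod_linear)
  then have "image_mset Re (proots (char_poly A)) = mset xs"
    by (simp add: multiset.map_comp comp_def)
  then show ?thesis
    unfolding eigval_def using sorted by (simp add: sort_key_id_if_sorted)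
qed

text \<open>The diagonalization is applied twice. With the roots in arbitrary order it serves to
  read off from a Hermitian diagonal that they are real; then they can be sorted, and the second
  application puts them on the diagonal in the order of \<open>eigval\<close>.\<close>

lemma hermitian_eigval_diagonalization:
  assumes A: "A \<in> carrier_mat n n" and herm: "adj A = A"
  shows "\<exists>U \<in> carrier_mat n n. adj U * U = 1\<^sub>m n
    \<and> adj U * A * U = mat n n (\<lambda>(i, j). if i = j then of_real (eigval A (Suc i)) else 0)
    \<and> (\<forall>i j. 0 < i \<longrightarrow> i \<le> j \<longrightarrow> j \<le> n \<longrightarrow> eigval A i \<le> eigval A j)"
proof -
  obtain as where as: "char_poly A = (\<Prod>e\<leftarrow>as. [:- e, 1:])" "length as = n"
    using char_poly_factorized[OF A] by auto
  obtain U where U: "U \<in> carrier_mat n n"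
    "adj U * A * U = mat n n (\<lambda>(i, j). if i = j then as ! i else 0)"
    using hermitian_unitary_diagonalization[OF A herm as(1)] by blast
  define D where "D = adj U * A * U"
  have "adj D = D"
    unfolding D_def using A U(1) herm
    by (simp add: assoc_mult_mat[of "adj U" n n A n U n] adj_mult[of "adj U" n n "A * U" n]
        adj_mult[of A n n U n])
  have real: "cnj (as ! i) = as ! i" if "i < n" for i
  proof -
    have "adj D $$ (i, i) = D $$ (i, i)" using \<open>adj D = D\<close> by simp
    then show ?thesis using that by (simp add: D_def U(2))
  qed
  have "as = map complex_of_real (map Re as)"
    by (rule nth_equalityI) (use real in \<open>auto simp: as(2) complex_eq_iff\<close>)
  define xs where "xs = sort (map Re as)"
  have "mset as = mset (map complex_of_real xs)"
    by (subst \<open>as = _\<close>) (simp add: xs_def multiset.map_comp)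
  then have "mset (map (\<lambda>e. [:- e, 1:]) as) = mset (map (\<lambda>e. [:- e, 1:]) (map complex_of_real xs))"
    by (metis mset_map)
  then have cp: "char_poly A = (\<Prod>e\<leftarrow>map complex_of_real xs. [:- e, 1:])"
    unfolding as(1) prod_mset_prod_list[symmetric] by simp
  have len: "length xs = n" by (simp add: xs_def as(2))
  have ev: "eigval A i = xs ! (i - 1)" for i
    by (rule eigval_list[OF cp]) (simp add: xs_def)
  obtain U where "U \<in> carrier_mat n n" "adj U * U = 1\<^sub>m n"
    "adj U * A * U = mat n n (\<lambda>(i, j). if i = j then map complex_of_real xs ! i else 0)"
    using hermitian_unitary_diagonalization[OF A herm cp] by blast
  moreover have "mat n n (\<lambda>(i, j). if i = j then map complex_of_real xs ! i else 0) =
    mat n n (\<lambda>(i, j). if i = j then of_real (eigval A (Suc i)) else 0)"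
    by (rule eq_matI) (auto simp: ev len)
  moreover have "eigval A i \<le> eigval A j" if "0 < i" "i \<le> j" "j \<le> n" for i j
    unfolding ev by (rule sorted_nth_mono) (use that len in \<open>auto simp: xs_def\<close>)
  ultimately show ?thesis by metis
qed

text \<open>\<open>T\<close> maps a vector to its coefficients in an orthonormal basis of eigenvectors.\<close>

lemma hermitian_coordinates:
  assumes A: "A \<in> carrier_mat n n" and herm: "adj A = A"
  shows "\<exists>T. (\<forall>y. (\<Sum>b<n. (cmod (\<Sum>i<n. T b i * y i))\<^sup>2) = (\<Sum>i<n. (cmod (y i))\<^sup>2))
    \<and> (\<forall>y. (\<Sum>b<n. eigval A (Suc b) * (cmod (\<Sum>i<n. T b i * y i))\<^sup>2)
      = Re (\<Sum>i<n. \<Sum>j<n. cnj (y i) * A $$ (i, j) * y j))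
    \<and> (\<Sum>b<n. eigval A (Suc b)) = Re (\<Sum>i<n. A $$ (i, i))"
proof -
  obtain U where U: "U \<in> carrier_mat n n" and UU: "adj U * U = 1\<^sub>m n"
    and D: "adj U * A * U = mat n n (\<lambda>(i, j). if i = j then of_real (eigval A (Suc i)) else 0)"
    using hermitian_eigval_diagonalization[OF A herm] by blast
  define T where "T b i = cnj (U $$ (i, b))" for b i
  have UU': "U * adj U = 1\<^sub>m n"
    using mat_mult_left_right_inverse[OF adj_carrier[OF U] U UU] .
  have AU: "A = U * (adj U * A * U) * adj U"
  proof -
    have "U * (adj U * A * U) * adj U = (U * adj U) * A * (U * adj U)"
      using U A by (simp add: assoc_mult_mat[of _ n n _ n _ n] mult_carrier_mat[of _ n n _ n])
    then show ?thesis using A UU' by simp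
  qed
  have T1: "(\<Sum>b<n. cnj (T b i) * T b j) = (if i = j then 1 else 0)" if "i < n" "j < n" for i j
  proof -
    have "(U * adj U) $$ (i, j) = (\<Sum>b<n. cnj (T b i) * T b j)"
      using that U by (subst index_mult_mat_sum[OF U adj_carrier[OF U]]) (auto simp: T_def)
    then show ?thesis using that by (simp add: UU')
  qed
  have T1': "(\<Sum>i<n. cnj (T b i) * T b i) = 1" if "b < n" for b
  proof -
    have "(adj U * U) $$ (b, b) = (\<Sum>i<n. T b i * cnj (T b i))"
      using that U by (subst index_mult_mat_sum[OF adj_carrier[OF U] U]) (auto simp: T_def)
    then show ?thesis using that by (simp add: UU mult.commute)
  qed
  have T2: "A $$ (i, j) = (\<Sum>b<n. of_real (eigval A (Suc b)) * (cnj (T b i) * T b j))"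
    if "i < n" "j < n" for i j
  proof -
    define E where "E = mat n n (\<lambda>(i, j). if i = j then complex_of_real (eigval A (Suc i)) else 0)"
    have E: "E \<in> carrier_mat n n" by (simp add: E_def)
    have UE: "(U * E) $$ (i, b) = U $$ (i, b) * of_real (eigval A (Suc b))" if "b < n" for b
    proof -
      have "(U * E) $$ (i, b) = (\<Sum>l<n. if l = b then U $$ (i, b) * of_real (eigval A (Suc b)) else 0)"
        unfolding index_mult_mat_sum[OF U E \<open>i < n\<close> that]
        using that by (intro sum.cong) (auto simp: E_def)
      then show ?thesis using that by simp
    qed
    have "A $$ (i, j) = (U * E * adj U) $$ (i, j)"
      using AU D by (simp add: E_def)
    also have "\<dots> = (\<Sum>b<n. (U * E) $$ (i, b) * adj U $$ (b, j))"
      by (rule index_mult_mat_sum[of _ n n _ n]) (use U E that in auto)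
    also have "\<dots> = (\<Sum>b<n. of_real (eigval A (Suc b)) * (cnj (T b i) * T b j))"
      using U that by (intro sum.cong) (auto simp: UE T_def)
    finally show ?thesis .
  qed
  \<comment> \<open>With weights 1 this is Parseval's identity; with the eigenvalues as weights it
    is the quadratic form of \<open>A\<close>.\<close>
  have weighted: "of_real (\<Sum>b<n. a b * (cmod (\<Sum>i<n. T b i * y i))\<^sup>2)
      = (\<Sum>i<n. \<Sum>j<n. cnj (y i) * (\<Sum>b<n. of_real (a b) * (cnj (T b i) * T b j)) * y j)"
    for a :: "nat \<Rightarrow> real" and y :: "nat \<Rightarrow> complex"
  proof -
    have "of_real (\<Sum>b<n. a b * (cmod (\<Sum>i<n. T b i * y i))\<^sup>2)
      = (\<Sum>b<n. of_real (a b) * (cnj (\<Sum>i<n. T b i * y i) * (\<Sum>j<n. T b j * y j)))"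
      unfolding of_real_sum of_real_mult complex_norm_square by (simp only: mult.commute)
    also have "\<dots> = (\<Sum>b<n. \<Sum>i<n. \<Sum>j<n. cnj (y i) * (of_real (a b) * (cnj (T b i) * T b j)) * y j)"
      unfolding cnj_sum sum_product unfolding sum_distrib_left
      by (intro sum.cong refl) (simp add: mult_ac)
    also have "\<dots> = (\<Sum>i<n. \<Sum>j<n. \<Sum>b<n. cnj (y i) * (of_real (a b) * (cnj (T b i) * T b j)) * y j)"
      by (subst sum.swap) (intro sum.cong refl sum.swap)
    finally show ?thesis by (simp add: sum_distrib_left sum_distrib_right)
  qed
  show ?thesis
  proof (intro exI[of _ T] conjI allI)
    fix y :: "nat \<Rightarrow> complex"
    have "complex_of_real (\<Sum>b<n. 1 * (cmod (\<Sum>i<n. T b i * y i))\<^sup>2) =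
      (\<Sum>i<n. \<Sum>j<n. cnj (y i) * (if i = j then 1 else 0) * y j)"
      unfolding weighted by (intro sum.cong refl) (simp add: T1)
    also have "\<dots> = (\<Sum>i<n. \<Sum>j<n. if j = i then cnj (y i) * y i else 0)"
      by (intro sum.cong refl) auto
    also have "\<dots> = of_real (\<Sum>i<n. (cmod (y i))\<^sup>2)"
      unfolding of_real_sum complex_norm_square by (intro sum.cong refl) (simp add: mult.commute)
    finally show "(\<Sum>b<n. (cmod (\<Sum>i<n. T b i * y i))\<^sup>2) = (\<Sum>i<n. (cmod (y i))\<^sup>2)"
      unfolding of_real_eq_iff by simp
    have "complex_of_real (\<Sum>b<n. eigval A (Suc b) * (cmod (\<Sum>i<n. T b i * y i))\<^sup>2) =
      (\<Sum>i<n. \<Sum>j<n. cnj (y i) * A $$ (i, j) * y j)"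
      unfolding weighted by (intro sum.cong refl) (simp add: T2)
    then show "(\<Sum>b<n. eigval A (Suc b) * (cmod (\<Sum>i<n. T b i * y i))\<^sup>2)
      = Re (\<Sum>i<n. \<Sum>j<n. cnj (y i) * A $$ (i, j) * y j)"
      by (metis Re_complex_of_real)
  next
    have "(\<Sum>i<n. A $$ (i, i)) = (\<Sum>i<n. \<Sum>b<n. of_real (eigval A (Suc b)) * (cnj (T b i) * T b i))"
      by (intro sum.cong refl) (simp add: T2)
    also have "\<dots> = (\<Sum>b<n. of_real (eigval A (Suc b)) * (\<Sum>i<n. cnj (T b i) * T b i))"
      by (subst sum.swap) (simp add: sum_distrib_left)
    also have "\<dots> = of_real (\<Sum>b<n. eigval A (Suc b))"
      by (simp add: T1')
    finally show "(\<Sum>b<n. eigval A (Suc b)) = Re (\<Sum>i<n. A $$ (i, i))" by simp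
  qed
qed

lemma sum_eigval:
  assumes "A \<in> carrier_mat n n" "adj A = A"
  shows "(\<Sum>k=1..n. eigval A k) = Re (\<Sum>i<n. A $$ (i, i))"
proof -
  have "(\<Sum>k=1..n. eigval A k) = (\<Sum>b<n. eigval A (Suc b))"
    by (rule sum.reindex_bij_witness[of _ Suc "\<lambda>k. k - 1"]) auto
  then show ?thesis by (metis hermitian_coordinates[OF assms])
qed

section \<open>Min-max estimates and Cauchy interlacing\<close>

lemma underdetermined_system:
  fixes r :: "nat \<Rightarrow> nat \<Rightarrow> complex"
  assumes n: "n > 0"
  obtains x where "\<exists>i<n. x i \<noteq> 0" "\<And>b. Suc b < n \<Longrightarrow> (\<Sum>i<n. r b i * x i) = 0"
proof -
  \<comment> \<open>The equations are padded with a zero row to a square matrix; its determinant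
    vanishes, so its kernel is nontrivial.\<close>
  define M where "M = mat n n (\<lambda>(b, i). if Suc b < n then r b i else 0)"
  have M: "M \<in> carrier_mat n n" by (simp add: M_def)
  have "M = mat\<^sub>r n n (\<lambda>b. if b = n - 1 then 0\<^sub>v n else row M b)"
    by (rule eq_matI) (auto simp: M_def)
  then have "Determinant.det M = 0"
    using n M det_row_0[of "n - 1" n "row M"] by auto
  then obtain v where v: "v \<in> carrier_vec n" "v \<noteq> 0\<^sub>v n" "M *\<^sub>v v = 0\<^sub>v n"
    using det_0_iff_vec_prod_zero_field[OF M] by auto
  show ?thesis
  proof (rule that[of "vec_index v"])
    show "\<exists>i<n. vec_index v i \<noteq> 0"
      using v(1,2) by (metis carrier_vecD eq_vecI index_zero_vec(1) index_zero_vec(2))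
    fix b assume b: "Suc b < n"
    have "(\<Sum>i<n. r b i * vec_index v i) = vec_index (M *\<^sub>v v) b"
      using b v(1) M by (auto simp: M_def mult_mat_vec_def scalar_prod_def lessThan_atLeast0)
    then show "(\<Sum>i<n. r b i * vec_index v i) = 0" using b by (simp add: v(3))
  qed
qed

text \<open>\<open>T b\<close> is the coordinate along the eigenvector of eigenvalue number
  \<open>Suc b\<close>, and in these coordinates the form is a weighted sum of squares; discarding
  the weights on one side of \<open>eigval A k\<close> leaves a one-sided bound. These halves of the
  min-max principle are phrased by linear conditions so that conditions for two matrices can be put
  into one linear system.\<close>

lemma eigval_test_functionals:
  assumes A: "A \<in> carrier_mat n n" and herm: "adj A = A" and k: "0 < k" "k \<le> n"
  shows "\<exists>T. (\<forall>y. (\<forall>b. k \<le> b \<longrightarrow> b < n \<longrightarrow> (\<Sum>i<n. T b i * y i) = 0) \<longrightarrow>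
        Re (\<Sum>i<n. \<Sum>j<n. cnj (y i) * A $$ (i, j) * y j) \<le> eigval A k * (\<Sum>i<n. (cmod (y i))\<^sup>2))
    \<and> (\<forall>y. (\<forall>b. Suc b < k \<longrightarrow> (\<Sum>i<n. T b i * y i) = 0) \<longrightarrow>
        eigval A k * (\<Sum>i<n. (cmod (y i))\<^sup>2) \<le> Re (\<Sum>i<n. \<Sum>j<n. cnj (y i) * A $$ (i, j) * y j))"
proof -
  have mono: "eigval A i \<le> eigval A j" if "0 < i" "i \<le> j" "j \<le> n" for i j
    using hermitian_eigval_diagonalization[OF A herm] that by blast
  obtain T where "\<forall>y. (\<Sum>b<n. (cmod (\<Sum>i<n. T b i * y i))\<^sup>2) = (\<Sum>i<n. (cmod (y i))\<^sup>2)"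
    "\<forall>y. (\<Sum>b<n. eigval A (Suc b) * (cmod (\<Sum>i<n. T b i * y i))\<^sup>2)
      = Re (\<Sum>i<n. \<Sum>j<n. cnj (y i) * A $$ (i, j) * y j)"
    using hermitian_coordinates[OF A herm] by blast
  note T = this[rule_format]
  show ?thesis
  proof (intro exI[of _ T] conjI allI impI)
    fix y assume *: "\<forall>b. k \<le> b \<longrightarrow> b < n \<longrightarrow> (\<Sum>i<n. T b i * y i) = 0"
    have "(\<Sum>b<n. eigval A (Suc b) * (cmod (\<Sum>i<n. T b i * y i))\<^sup>2) \<le> (\<Sum>b<n. eigval A k * (cmod (\<Sum>i<n. T b i * y i))\<^sup>2)"
    proof (rule sum_mono)
      fix b assume "b \<in> {..<n}"
      then show "eigval A (Suc b) * (cmod (\<Sum>i<n. T b i * y i))\<^sup>2 \<le> eigval A k * (cmod (\<Sum>i<n. T b i * y i))\<^sup>2"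
        using *[rule_format, of b] mono[of "Suc b" k] k by (cases "k \<le> b") (auto intro: mult_right_mono)
    qed
    then show "Re (\<Sum>i<n. \<Sum>j<n. cnj (y i) * A $$ (i, j) * y j) \<le> eigval A k * (\<Sum>i<n. (cmod (y i))\<^sup>2)"
      by (simp only: sum_distrib_left[symmetric] T)
  next
    fix y assume *: "\<forall>b. Suc b < k \<longrightarrow> (\<Sum>i<n. T b i * y i) = 0"
    have "(\<Sum>b<n. eigval A k * (cmod (\<Sum>i<n. T b i * y i))\<^sup>2) \<le> (\<Sum>b<n. eigval A (Suc b) * (cmod (\<Sum>i<n. T b i * y i))\<^sup>2)"
    proof (rule sum_mono)
      fix b assume "b \<in> {..<n}"
      then show "eigval A k * (cmod (\<Sum>i<n. T b i * y i))\<^sup>2 \<le> eigval A (Suc b) * (cmod (\<Sum>i<n. T b i * y i))\<^sup>2"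
        using *[rule_format, of b] mono[of k "Suc b"] k by (cases "Suc b < k") (auto intro: mult_right_mono)
    qed
    then show "eigval A k * (\<Sum>i<n. (cmod (y i))\<^sup>2) \<le> Re (\<Sum>i<n. \<Sum>j<n. cnj (y i) * A $$ (i, j) * y j)"
      by (simp only: sum_distrib_left[symmetric] T)
  qed
qed

text \<open>Both inequalities of the interlacing theorem come from \<open>n - 1\<close> linear equations in \<open>n\<close>
  unknowns: the coordinates of \<open>x\<close> and of \<open>J x\<close> on the wrong side of the two eigenvalues vanish.\<close>

lemma eigval_le_of_form_le:
  assumes A: "A \<in> carrier_mat N N" "adj A = A" and C: "C \<in> carrier_mat n n" "adj C = C"
    and iso: "\<And>x. (\<Sum>a<N. (cmod (\<Sum>i<n. J a i * x i))\<^sup>2) = (\<Sum>i<n. (cmod (x i))\<^sup>2)"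
    and form: "\<And>x. Re (\<Sum>a<N. \<Sum>b<N. cnj (\<Sum>i<n. J a i * x i) * A $$ (a, b) * (\<Sum>i<n. J b i * x i))
      \<le> Re (\<Sum>i<n. \<Sum>j<n. cnj (x i) * C $$ (i, j) * x j)"
    and k: "0 < k" "k \<le> n" and nN: "n \<le> N"
  shows "eigval A k \<le> eigval C k"
proof -
  obtain TA where TA: "\<forall>y. (\<forall>b. Suc b < k \<longrightarrow> (\<Sum>i<N. TA b i * y i) = 0) \<longrightarrow>
        eigval A k * (\<Sum>i<N. (cmod (y i))\<^sup>2) \<le> Re (\<Sum>i<N. \<Sum>j<N. cnj (y i) * A $$ (i, j) * y j)"
    using eigval_test_functionals[OF A k(1) order.trans[OF k(2) nN]] by blast
  obtain TC where TC: "\<forall>y. (\<forall>b. k \<le> b \<longrightarrow> b < n \<longrightarrow> (\<Sum>i<n. TC b i * y i) = 0) \<longrightarrow>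
        Re (\<Sum>i<n. \<Sum>j<n. cnj (y i) * C $$ (i, j) * y j) \<le> eigval C k * (\<Sum>i<n. (cmod (y i))\<^sup>2)"
    using eigval_test_functionals[OF C k] by blast
  \<comment> \<open>\<open>k - 1\<close> equations remove the coordinates of \<open>J x\<close>
    before number \<open>k\<close>; the shift \<open>Suc b\<close> lets the other
    \<open>n - k\<close> equations run over the coordinates of \<open>x\<close> after it. Together
    these are \<open>n - 1\<close>.\<close>
  define r where "r b i = (if Suc b < k then \<Sum>a<N. TA b a * J a i else TC (Suc b) i)" for b i
  obtain x where x0: "\<exists>i<n. x i \<noteq> 0" and x: "\<And>b. Suc b < n \<Longrightarrow> (\<Sum>i<n. r b i * x i) = 0"
    using underdetermined_system[of n r] k by auto
  define y where "y a = (\<Sum>i<n. J a i * x i)" for a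
  have y: "(\<Sum>a<N. TA b a * y a) = 0" if "Suc b < k" for b
  proof -
    have "(\<Sum>a<N. TA b a * y a) = (\<Sum>a<N. \<Sum>i<n. TA b a * J a i * x i)"
      by (simp add: y_def sum_distrib_left mult_ac)
    also have "\<dots> = (\<Sum>i<n. r b i * x i)"
      using that by (subst sum.swap) (simp add: r_def sum_distrib_right)
    finally show ?thesis using x[of b] that k by simp
  qed
  have "eigval A k * (\<Sum>i<n. (cmod (x i))\<^sup>2)
      \<le> Re (\<Sum>a<N. \<Sum>b<N. cnj (y a) * A $$ (a, b) * y b)"
    using TA[rule_format, OF y] iso[of x] by (simp add: y_def)
  also have "\<dots> \<le> Re (\<Sum>i<n. \<Sum>j<n. cnj (x i) * C $$ (i, j) * x j)"
    unfolding y_def by (rule form)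
  also have "\<dots> \<le> eigval C k * (\<Sum>i<n. (cmod (x i))\<^sup>2)"
  proof (rule TC[rule_format])
    fix b assume "k \<le> b" "b < n"
    then show "(\<Sum>i<n. TC b i * x i) = 0"
      using x[of "b - 1"] k by (simp add: r_def)
  qed
  finally have "eigval A k * (\<Sum>i<n. (cmod (x i))\<^sup>2) \<le> eigval C k * (\<Sum>i<n. (cmod (x i))\<^sup>2)" .
  moreover have "0 < (\<Sum>i<n. (cmod (x i))\<^sup>2)"
    using x0 by (auto intro: sum_pos2)
  ultimately show ?thesis by simp
qed

lemma eigval_le_shifted_of_form_le:
  assumes A: "A \<in> carrier_mat N N" "adj A = A" and C: "C \<in> carrier_mat n n" "adj C = C"
    and iso: "\<And>x. (\<Sum>a<N. (cmod (\<Sum>i<n. J a i * x i))\<^sup>2) = (\<Sum>i<n. (cmod (x i))\<^sup>2)"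
    and form: "\<And>x. Re (\<Sum>i<n. \<Sum>j<n. cnj (x i) * C $$ (i, j) * x j) \<le>
      Re (\<Sum>a<N. \<Sum>b<N. cnj (\<Sum>i<n. J a i * x i) * A $$ (a, b) * (\<Sum>i<n. J b i * x i))"
    and k: "0 < k" "k \<le> n" and nN: "n \<le> N"
  shows "eigval C k \<le> eigval A (k + N - n)"
proof -
  have kN: "0 < k + N - n" "k + N - n \<le> N" using k nN by auto
  obtain TA where TA: "\<forall>y. (\<forall>b. k + N - n \<le> b \<longrightarrow> b < N \<longrightarrow> (\<Sum>i<N. TA b i * y i) = 0) \<longrightarrow>
        Re (\<Sum>i<N. \<Sum>j<N. cnj (y i) * A $$ (i, j) * y j) \<le> eigval A (k + N - n) * (\<Sum>i<N. (cmod (y i))\<^sup>2)"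
    using eigval_test_functionals[OF A kN] by blast
  obtain TC where TC: "\<forall>y. (\<forall>b. Suc b < k \<longrightarrow> (\<Sum>i<n. TC b i * y i) = 0) \<longrightarrow>
        eigval C k * (\<Sum>i<n. (cmod (y i))\<^sup>2) \<le> Re (\<Sum>i<n. \<Sum>j<n. cnj (y i) * C $$ (i, j) * y j)"
    using eigval_test_functionals[OF C k] by blast
  \<comment> \<open>Now \<open>x\<close> loses its \<open>k - 1\<close> coordinates before number
    \<open>k\<close>, and \<open>Suc b + N - n\<close> runs through the \<open>n - k\<close>
    coordinates of \<open>J x\<close> after number \<open>k + N - n\<close>.\<close>
  define r where "r b i = (if Suc b < k then TC b i else \<Sum>a<N. TA (Suc b + N - n) a * J a i)" for b i
  obtain x where x0: "\<exists>i<n. x i \<noteq> 0" and x: "\<And>b. Suc b < n \<Longrightarrow> (\<Sum>i<n. r b i * x i) = 0"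
    using underdetermined_system[of n r] k by auto
  define y where "y a = (\<Sum>i<n. J a i * x i)" for a
  have y: "(\<Sum>a<N. TA b a * y a) = 0" if "k + N - n \<le> b" "b < N" for b
  proof -
    have "(\<Sum>a<N. TA b a * y a) = (\<Sum>a<N. \<Sum>i<n. TA b a * J a i * x i)"
      by (simp add: y_def sum_distrib_left mult_ac)
    also have "\<dots> = (\<Sum>i<n. (\<Sum>a<N. TA b a * J a i) * x i)"
      by (subst sum.swap) (simp add: sum_distrib_right)
    also have "\<dots> = (\<Sum>i<n. r (b + n - N - 1) i * x i)"
    proof -
      have "\<not> Suc (b + n - N - 1) < k" "Suc (b + n - N - 1) + N - n = b"
        using that k nN by auto
      then show ?thesis by (simp only: r_def if_False)
    qed
    finally show ?thesis using x[of "b + n - N - 1"] that k nN by simp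
  qed
  have "eigval C k * (\<Sum>i<n. (cmod (x i))\<^sup>2) \<le> Re (\<Sum>i<n. \<Sum>j<n. cnj (x i) * C $$ (i, j) * x j)"
  proof (rule TC[rule_format])
    fix b assume "Suc b < k"
    then show "(\<Sum>i<n. TC b i * x i) = 0"
      using x[of b] k by (simp add: r_def)
  qed
  also have "\<dots> \<le> Re (\<Sum>a<N. \<Sum>b<N. cnj (y a) * A $$ (a, b) * y b)"
    unfolding y_def by (rule form)
  also have "\<dots> \<le> eigval A (k + N - n) * (\<Sum>i<n. (cmod (x i))\<^sup>2)"
    using TA[rule_format, OF y] iso[of x] by (simp add: y_def)
  finally have "eigval C k * (\<Sum>i<n. (cmod (x i))\<^sup>2) \<le> eigval A (k + N - n) * (\<Sum>i<n. (cmod (x i))\<^sup>2)" .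
  moreover have "0 < (\<Sum>i<n. (cmod (x i))\<^sup>2)"
    using x0 by (auto intro: sum_pos2)
  ultimately show ?thesis by simp
qed

text \<open>A compression by an isometry preserves the norm and the form, so both one-sided
  comparisons apply. Matrix entries are the convenient data, since the Floquet and Dirichlet
  matrices are identified entry by entry.\<close>

lemma
  assumes A: "A \<in> carrier_mat N N" "adj A = A" and C: "C \<in> carrier_mat n n" "adj C = C"
    and iso: "\<And>i j. i < n \<Longrightarrow> j < n \<Longrightarrow> (\<Sum>a<N. cnj (J a i) * J a j) = (if i = j then 1 else 0)"
    and compr: "\<And>i j. i < n \<Longrightarrow> j < n \<Longrightarrow>
      C $$ (i, j) = (\<Sum>a<N. \<Sum>b<N. cnj (J a i) * A $$ (a, b) * J b j)"
    and k: "0 < k" "k \<le> n" and nN: "n \<le> N"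
  shows interlacing_lower: "eigval A k \<le> eigval C k"
    and interlacing_upper: "eigval C k \<le> eigval A (k + N - n)"
proof -
  have iso': "(\<Sum>a<N. (cmod (\<Sum>i<n. J a i * x i))\<^sup>2) = (\<Sum>i<n. (cmod (x i))\<^sup>2)" for x :: "nat \<Rightarrow> complex"
  proof -
    have "complex_of_real (\<Sum>a<N. (cmod (\<Sum>i<n. J a i * x i))\<^sup>2)
      = (\<Sum>a<N. (\<Sum>i<n. J a i * x i) * cnj (\<Sum>i<n. J a i * x i))"
      unfolding of_real_sum complex_norm_square ..
    also have "\<dots> = (\<Sum>a<N. \<Sum>j<n. \<Sum>i<n. cnj (x i) * x j * (cnj (J a i) * J a j))"
      unfolding cnj_sum sum_product by (simp add: mult_ac)
    also have "\<dots> = (\<Sum>j<n. \<Sum>i<n. \<Sum>a<N. cnj (x i) * x j * (cnj (J a i) * J a j))"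
      by (subst sum.swap) (intro sum.cong refl sum.swap)
    also have "\<dots> = (\<Sum>j<n. \<Sum>i<n. if i = j then x j * cnj (x j) else 0)"
      by (intro sum.cong refl) (auto simp: iso sum_distrib_left[symmetric])
    also have "\<dots> = complex_of_real (\<Sum>i<n. (cmod (x i))\<^sup>2)"
      unfolding of_real_sum complex_norm_square by simp
    finally show ?thesis by (simp only: of_real_eq_iff)
  qed
  have form: "(\<Sum>i<n. \<Sum>j<n. cnj (x i) * C $$ (i, j) * x j) =
      (\<Sum>a<N. \<Sum>b<N. cnj (\<Sum>i<n. J a i * x i) * A $$ (a, b) * (\<Sum>i<n. J b i * x i))" (is "?l = ?r")
    for x :: "nat \<Rightarrow> complex"
  proof -
    have "?r = (\<Sum>a<N. \<Sum>b<N. \<Sum>i<n. \<Sum>j<n. cnj (x i) * (cnj (J a i) * A $$ (a, b) * J b j) * x j)"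
    proof (intro sum.cong[OF refl])
      fix a b
      have "cnj (\<Sum>i<n. J a i * x i) * A $$ (a, b) * (\<Sum>i<n. J b i * x i) =
        A $$ (a, b) * ((\<Sum>i<n. cnj (J a i * x i)) * (\<Sum>j<n. J b j * x j))"
        by (simp add: cnj_sum mult_ac)
      also have "\<dots> = (\<Sum>i<n. \<Sum>j<n. cnj (x i) * (cnj (J a i) * A $$ (a, b) * J b j) * x j)"
        unfolding sum_product unfolding sum_distrib_left
        by (intro sum.cong refl) (simp add: mult_ac)
      finally show "cnj (\<Sum>i<n. J a i * x i) * A $$ (a, b) * (\<Sum>i<n. J b i * x i) =
        (\<Sum>i<n. \<Sum>j<n. cnj (x i) * (cnj (J a i) * A $$ (a, b) * J b j) * x j)" .
    qed
    also have "\<dots> = (\<Sum>a<N. \<Sum>i<n. \<Sum>b<N. \<Sum>j<n. cnj (x i) * (cnj (J a i) * A $$ (a, b) * J b j) * x j)"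
      by (intro sum.cong refl sum.swap)
    also have "\<dots> = (\<Sum>i<n. \<Sum>a<N. \<Sum>j<n. \<Sum>b<N. cnj (x i) * (cnj (J a i) * A $$ (a, b) * J b j) * x j)"
      by (subst sum.swap) (intro sum.cong refl sum.swap)
    also have "\<dots> = (\<Sum>i<n. \<Sum>j<n. \<Sum>a<N. \<Sum>b<N. cnj (x i) * (cnj (J a i) * A $$ (a, b) * J b j) * x j)"
      by (intro sum.cong refl sum.swap)
    also have "\<dots> = ?l"
      by (intro sum.cong refl) (simp add: compr sum_distrib_left sum_distrib_right)
    finally show ?thesis by simp
  qed
  show "eigval A k \<le> eigval C k"
    by (rule eigval_le_of_form_le[OF A C iso' _ k nN]) (simp add: form)
  show "eigval C k \<le> eigval A (k + N - n)"
    by (rule eigval_le_shifted_of_form_le[OF A C iso' _ k nN]) (simp add: form)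
qed

text \<open>Monotonicity of eigenvalues in the form: interlacing with the identity as isometry,
  where the index shift vanishes.\<close>

lemma eigval_le_of_form_le_same_dim:
  assumes A: "A \<in> carrier_mat n n" "adj A = A" and C: "C \<in> carrier_mat n n" "adj C = C"
    and form: "\<And>x. Re (\<Sum>i<n. \<Sum>j<n. cnj (x i) * C $$ (i, j) * x j) \<le>
      Re (\<Sum>i<n. \<Sum>j<n. cnj (x i) * A $$ (i, j) * x j)"
    and k: "0 < k" "k \<le> n"
  shows "eigval C k \<le> eigval A k"
proof -
  have J: "(\<Sum>i<n. (if a = i then 1 else 0) * x i) = x a" if "a < n" for a and x :: "nat \<Rightarrow> complex"
    using that by (simp add: if_distrib[of "\<lambda>z. z * _"] cong: if_cong)
  have "eigval C k \<le> eigval A (k + n - n)"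
    by (rule eigval_le_shifted_of_form_le[OF A C _ _ k, where J = "\<lambda>a i. if a = i then 1 else 0"])
      (use form in \<open>simp_all add: J cong: sum.cong_simp\<close>)
  then show ?thesis by simp
qed

lemma eigval_diagonal:
  fixes d :: "nat \<Rightarrow> real"
  assumes "0 < k" "k \<le> n"
  shows "eigval (mat n n (\<lambda>(i, j). if i = j then complex_of_real (d i) else 0)) k
    = sort (map d [0..<n]) ! (k - 1)"
proof -
  define A where "A = mat n n (\<lambda>(i, j). if i = j then complex_of_real (d i) else 0)"
  have A: "A \<in> carrier_mat n n" by (simp add: A_def)
  have diag: "diag_mat A = map complex_of_real (map d [0..<n])"
    by (simp add: diag_mat_def A_def)
  have "char_poly A = (\<Prod>a\<leftarrow>diag_mat A. [:- a, 1:])"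
    by (rule char_poly_upper_triangular[OF A]) (auto simp: A_def)
  also have "\<dots> = (\<Prod>a\<leftarrow>map complex_of_real (sort (map d [0..<n])). [:- a, 1:])"
    unfolding diag prod_mset_prod_list[symmetric] by (simp only: mset_map mset_sort)
  finally show ?thesis
    unfolding A_def[symmetric] by (rule eigval_list) simp
qed

section \<open>Periodic graphs and their fundamental cells\<close>

text \<open>The index of the lattice cell that contains \<open>x\<close>. It is equivariant under
  lattice translations and vanishes exactly on the fundamental cell, so questions about bridges,
  inner edges and phases become computations with cell indices.\<close>

definition floor_vec :: "real^'d \<Rightarrow> real^'d" where
  "floor_vec x = (\<chi> s. of_int \<lfloor>x $ s\<rfloor>)"

definition cell_rep :: "real^'d \<Rightarrow> real^'d" where
  "cell_rep x = x - floor_vec x"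

lemma int_lattice_0 [simp]: "0 \<in> int_lattice"
  by (simp add: int_lattice_def)

lemma int_lattice_add: "m \<in> int_lattice \<Longrightarrow> n \<in> int_lattice \<Longrightarrow> m + n \<in> int_lattice"
  by (simp add: int_lattice_def)

lemma int_lattice_diff: "m \<in> int_lattice \<Longrightarrow> n \<in> int_lattice \<Longrightarrow> m - n \<in> int_lattice"
  by (simp add: int_lattice_def)

lemma int_lattice_minus [simp]: "- m \<in> int_lattice \<longleftrightarrow> m \<in> int_lattice"
  by (simp add: int_lattice_def)

lemma floor_vec_in_int_lattice [simp]: "floor_vec x \<in> int_lattice"
  by (simp add: int_lattice_def floor_vec_def)

lemma floor_vec_add:
  assumes "m \<in> int_lattice"
  shows "floor_vec (x + m) = floor_vec x + m"
proof (rule iffD2[OF Finite_Cartesian_Product.vec_eq_iff], intro allI)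
  fix s
  obtain k where "m $ s = of_int k" using assms by (auto simp: int_lattice_def elim: Ints_cases)
  then show "floor_vec (x + m) $ s = (floor_vec x + m) $ s" by (simp add: floor_vec_def)
qed

lemma cell_rep_add: "m \<in> int_lattice \<Longrightarrow> cell_rep (x + m) = cell_rep x"
  by (simp add: cell_rep_def floor_vec_add)

lemma cell_rep_eq_iff: "cell_rep x = cell_rep y \<longleftrightarrow> x - y \<in> int_lattice"
proof
  assume "cell_rep x = cell_rep y"
  then have "x - y = floor_vec x - floor_vec y" by (simp add: cell_rep_def algebra_simps)
  then show "x - y \<in> int_lattice" by (simp add: int_lattice_diff)
next
  assume "x - y \<in> int_lattice"
  then show "cell_rep x = cell_rep y" using cell_rep_add[of "x - y" y] by simp
qed

lemma floor_vec_eq_0_iff: "floor_vec x = 0 \<longleftrightarrow> (\<forall>s. 0 \<le> x $ s \<and> x $ s < 1)"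
  by (auto simp: floor_vec_def Finite_Cartesian_Product.vec_eq_iff floor_eq_iff)

lemma floor_vec_cell_rep [simp]: "floor_vec (cell_rep x) = 0"
  using floor_vec_add[of "- floor_vec x" x] by (simp add: cell_rep_def)

lemma floor_vec_lattice: "m \<in> int_lattice \<Longrightarrow> floor_vec m = m"
  using floor_vec_add[of m 0] by (simp add: floor_vec_eq_0_iff[THEN iffD2])

lemma cell_rep_id: "floor_vec x = 0 \<Longrightarrow> cell_rep x = x"
  by (simp add: cell_rep_def)

lemma shift_edge_Pair [simp]: "shift_edge m (Upair x y, l) = (Upair (x + m) (y + m), l)"
  by (simp add: shift_edge_def)

lemma edge_cases: obtains x y l where "e = (Upair x y, l)"
  by (metis surj_pair uprod_exhaust)

lemma shift_edge_0 [simp]: "shift_edge 0 e = e"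
  by (cases e rule: edge_cases) simp

lemma shift_edge_shift_edge [simp]: "shift_edge m (shift_edge n e) = shift_edge (n + m) e"
  by (cases e rule: edge_cases) (simp add: add.assoc)

text \<open>As edges are unordered, a translation might also fix an edge by exchanging its ends;
  then \<open>2 m = 0\<close>.\<close>

lemma shift_edge_eq_self:
  assumes "shift_edge m e = e"
  shows "m = 0"
proof (cases e rule: edge_cases)
  case (1 x y l)
  then have "x + m = x \<or> (x + m = y \<and> y + m = x)" using assms by auto
  then show ?thesis
  proof
    assume "x + m = y \<and> y + m = x"
    then have "x + m + m = x" by metis
    then have "(2::real) *\<^sub>R m = 0" by (simp add: scaleR_2 add.assoc)
    then show ?thesis by simp
  qed simp
qed

definition out_edges :: "'d edge set \<Rightarrow> real^'d \<Rightarrow> 'd oriented_edge set" where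
  "out_edges E v = {(u, w, e, r) \<in> oriented_edges E. u = v}"

lemma mem_oriented_edges:
  "(u, w, e, r) \<in> oriented_edges E \<longleftrightarrow> e \<in> E \<and> fst e = Upair u w \<and> (r \<longrightarrow> u = w)"
  by (simp add: oriented_edges_def)

lemma finite_out_edges:
  assumes "finite (incident E v)"
  shows "finite (out_edges E v)"
proof (rule finite_subset)
  show "out_edges E v \<subseteq> {v} \<times> (\<Union>e\<in>incident E v. set_uprod (fst e)) \<times> incident E v \<times> UNIV"
    by (auto simp: out_edges_def mem_oriented_edges incident_def)
  show "finite ({v} \<times> (\<Union>e\<in>incident E v. set_uprod (fst e)) \<times> incident E v \<times> (UNIV :: bool set))"
    using assms by auto
qed

text \<open>The Boolean flag splits the oriented edges at \<open>v\<close>: the unflagged ones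
  correspond to the incident edges, the flagged ones to the loops, which supply the second count of
  each loop.\<close>

lemma degree_eq_card_out_edges:
  assumes fin: "finite (incident E v)"
  shows "Defs.degree E v = card (out_edges E v)"
proof -
  define X where "X = {(u, w, e, r) \<in> out_edges E v. \<not> r}"
  define Y where "Y = {(u, w, e, r) \<in> out_edges E v. r}"
  have "bij_betw (\<lambda>(u, w, e, r). e) X (incident E v)"
  proof (rule bij_betwI')
    fix o1 o2 assume "o1 \<in> X" "o2 \<in> X"
    then show "((\<lambda>(u, w, e, r). e) o1 = (\<lambda>(u, w, e, r). e) o2) = (o1 = o2)"
      by (auto simp: X_def out_edges_def mem_oriented_edges)
  next
    fix o1 assume "o1 \<in> X"
    then show "(\<lambda>(u, w, e, r). e) o1 \<in> incident E v"
      by (auto simp: X_def out_edges_def mem_oriented_edges incident_def)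
  next
    fix e assume e: "e \<in> incident E v"
    obtain x y l where xy: "e = (Upair x y, l)" by (cases e rule: edge_cases)
    then have "v = x \<or> v = y" using e by (auto simp: incident_def)
    then obtain w where "fst e = Upair v w" using xy by auto
    then have "(v, w, e, False) \<in> X"
      using e by (auto simp: X_def out_edges_def mem_oriented_edges incident_def)
    then show "\<exists>o1\<in>X. e = (\<lambda>(u, w, e, r). e) o1" by force
  qed
  then have X: "card X = card (incident E v)" by (rule bij_betw_same_card)
  have "bij_betw (\<lambda>(u, w, e, r). e) Y (loops_at E v)"
    by (rule bij_betw_byWitness[where f' = "\<lambda>e. (v, v, e, True)"])
      (auto simp: Y_def out_edges_def mem_oriented_edges loops_at_def)
  then have Y: "card Y = card (loops_at E v)" by (rule bij_betw_same_card)
  have XY: "out_edges E v = X \<union> Y" "X \<inter> Y = {}" by (auto simp: X_def Y_def)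
  have "finite X" "finite Y" using finite_out_edges[OF fin] XY by auto
  then show ?thesis unfolding Defs.degree_def XY(1) using X Y XY(2) by (simp add: card_Un_disjoint)
qed

definition shift_oriented :: "real^'d \<Rightarrow> 'd oriented_edge \<Rightarrow> 'd oriented_edge" where
  "shift_oriented m = (\<lambda>(u, w, e, r). (u + m, w + m, shift_edge m e, r))"

lemma fst_shift_edge_eq: "fst e = Upair u w \<Longrightarrow> fst (shift_edge m e) = Upair (u + m) (w + m)"
  by (cases e) simp

section \<open>Consequences of periodicity and connectedness\<close>

context periodic_graph
begin

lemma vert_add [simp]:
  assumes "m \<in> int_lattice"
  shows "x + m \<in> V \<longleftrightarrow> x \<in> V"
proof
  assume "x + m \<in> V"
  then have "x + m \<in> (\<lambda>x. x + m) ` V" using periodic_verts[OF assms] by simp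
  then show "x \<in> V" by auto
next
  assume "x \<in> V"
  then show "x + m \<in> V" using periodic_verts[OF assms] by blast
qed

lemma edge_shift [simp]:
  assumes m: "m \<in> int_lattice"
  shows "shift_edge m e \<in> E \<longleftrightarrow> e \<in> E"
proof
  assume "e \<in> E"
  then show "shift_edge m e \<in> E" using periodic_edges[OF m] by blast
next
  assume "shift_edge m e \<in> E"
  then have "shift_edge (- m) (shift_edge m e) \<in> shift_edge (- m) ` E" by blast
  then show "e \<in> E" using periodic_edges[of "- m"] m by simp
qed

lemma fund_verts_iff: "x \<in> fund_verts V \<longleftrightarrow> x \<in> V \<and> floor_vec x = 0"
  by (simp add: fund_verts_def floor_vec_eq_0_iff)

lemma cell_rep_in_V [simp]: "cell_rep x \<in> V \<longleftrightarrow> x \<in> V"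
  using vert_add[of "- floor_vec x" x] by (simp add: cell_rep_def)

lemma cell_rep_in_fund: "x \<in> V \<Longrightarrow> cell_rep x \<in> fund_verts V"
  by (simp add: fund_verts_iff)

lemma cell_rep_fund: "x \<in> fund_verts V \<Longrightarrow> cell_rep x = x"
  by (simp add: fund_verts_iff cell_rep_id)

lemma finite_fund_verts: "finite (fund_verts V)"
proof -
  have "fund_verts V = V \<inter> fund_verts V" by (auto simp: fund_verts_def)
  moreover have "bounded (fund_verts V)"
    by (rule bounded_subset[OF bounded_cbox[of 0 1]]) (auto simp: fund_verts_def mem_box_cart less_imp_le)
  ultimately show ?thesis using locally_finite by metis
qed

lemma fund_verts_nonempty: "fund_verts V \<noteq> {}"
  using nonempty cell_rep_in_fund by auto

lemma edge_verts:
  assumes "e \<in> E" "fst e = Upair x y"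
  shows "x \<in> V" "y \<in> V"
  using edge_ends[OF assms(1)] assms(2) by auto

lemma infinite_verts: "infinite V"
proof
  assume fin: "finite V"
  obtain x where x: "x \<in> V" using nonempty by auto
  define s :: 'd where "s = undefined"
  have "range (\<lambda>k::nat. x + real k *\<^sub>R axis s 1) \<subseteq> V"
    using x by (auto simp: int_lattice_def axis_def)
  then have "finite (range (\<lambda>k::nat. x + real k *\<^sub>R axis s 1))" using fin by (rule finite_subset)
  moreover have "inj (\<lambda>k::nat. x + real k *\<^sub>R axis s 1)"
  proof (rule injI)
    fix k l assume "x + real k *\<^sub>R axis s 1 = x + real l *\<^sub>R axis s 1"
    then have "(real k *\<^sub>R axis s 1 :: real^'d) $ s = (real l *\<^sub>R axis s 1 :: real^'d) $ s" by simp
    then show "k = l" by simp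
  qed
  ultimately show False using finite_imageD infinite_UNIV_nat by blast
qed

text \<open>Connectedness always enters in this form: to refute a configuration, one shows that a
  property, such as being inner or having a cell index orthogonal to a fixed vector, spreads along
  edges to all of \<open>V\<close>.\<close>

lemma closed_under_adjacency:
  assumes "x \<in> S" "x \<in> V"
    and "\<And>e x y. e \<in> E \<Longrightarrow> fst e = Upair x y \<Longrightarrow> x \<in> S \<Longrightarrow> y \<in> S"
  shows "V \<subseteq> S"
proof
  fix y assume "y \<in> V"
  then have "(x, y) \<in> {(x, y). \<exists>e\<in>E. fst e = Upair x y}\<^sup>*" using connected[OF assms(2)] by simp
  then show "y \<in> S" by (induction rule: rtrancl_induct) (use assms in auto)
qed

lemma incident_nonempty:
  assumes "v \<in> V"
  shows "incident E v \<noteq> {}"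
proof
  assume "incident E v = {}"
  then have "V \<subseteq> {v}"
    by (intro closed_under_adjacency[of v]) (use assms in \<open>auto simp: incident_def\<close>)
  then show False using infinite_verts finite_subset by blast
qed

lemma bridge_iff:
  assumes "fst e = Upair x y"
  shows "e \<in> bridges V E \<longleftrightarrow> e \<in> E \<and> (floor_vec x = 0) \<noteq> (floor_vec y = 0)"
proof
  assume "e \<in> bridges V E"
  then obtain u w where "e \<in> E" "fst e = Upair u w" "u \<in> fund_verts V" "w \<in> V - fund_verts V"
    by (auto simp: bridges_def)
  then show "e \<in> E \<and> (floor_vec x = 0) \<noteq> (floor_vec y = 0)"
    using assms by (auto simp: fund_verts_iff)
next
  assume e: "e \<in> E \<and> (floor_vec x = 0) \<noteq> (floor_vec y = 0)"
  then have "x \<in> V" "y \<in> V" using edge_verts[OF _ assms] by auto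
  then have "x \<in> fund_verts V \<and> y \<in> V - fund_verts V \<or> y \<in> fund_verts V \<and> x \<in> V - fund_verts V"
    using e by (auto simp: fund_verts_iff)
  moreover have "fst e = Upair y x" using assms by auto
  ultimately show "e \<in> bridges V E"
    using e assms unfolding bridges_def by blast
qed

lemma inner_edge_iff:
  assumes "fst e = Upair x y"
  shows "e \<in> inner_edges V E \<longleftrightarrow> e \<in> E \<and> floor_vec x = 0 \<and> floor_vec y = 0"
  using assms edge_verts[of e x y] by (auto simp: inner_edges_def fund_verts_iff)

lemma finite_bridges: "finite (bridges V E)"
proof (rule finite_subset)
  show "bridges V E \<subseteq> (\<Union>v\<in>fund_verts V. incident E v)"
    by (auto simp: bridges_def incident_def)
  show "finite (\<Union>v\<in>fund_verts V. incident E v)"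
    using finite_fund_verts degree_finite by (auto simp: fund_verts_def)
qed

lemma finite_inner_edges: "finite (inner_edges V E)"
proof (rule finite_subset)
  show "inner_edges V E \<subseteq> (\<Union>v\<in>fund_verts V. incident E v)"
  proof
    fix e assume "e \<in> inner_edges V E"
    then show "e \<in> (\<Union>v\<in>fund_verts V. incident E v)"
      by (cases e rule: edge_cases) (auto simp: inner_edges_def incident_def)
  qed
  show "finite (\<Union>v\<in>fund_verts V. incident E v)"
    using finite_fund_verts degree_finite by (auto simp: fund_verts_def)
qed

end

section \<open>The finite graph as a system of representatives of the edge classes\<close>

locale cut_graph = periodic_graph V E for V :: "(real^'d) set" and E :: "'d edge set" +
  fixes B :: "'d edge set"
  assumes choice: "bridge_choice V E B"
begin

abbreviation EN where "EN \<equiv> edges_N V E B"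
abbreviation VN where "VN \<equiv> verts_N V B"

lemma B_bridges: "B \<subseteq> bridges V E"
  using choice by (simp add: bridge_choice_def)

lemma EN_subset: "EN \<subseteq> E"
  using B_bridges by (auto simp: edges_N_def inner_edges_def bridges_def)

lemma finite_EN: "finite EN"
  using finite_inner_edges finite_bridges B_bridges by (auto simp: edges_N_def intro: finite_subset)

lemma finite_incident_EN: "finite (incident EN x)"
  using finite_EN by (auto simp: incident_def)

text \<open>Translating one end into the fundamental cell makes the edge inner or a bridge; a bridge
  is then replaced by its chosen equivalent.\<close>

lemma EN_exists:
  assumes e: "e \<in> E"
  obtains m where "m \<in> int_lattice" "shift_edge m e \<in> EN"
proof -
  obtain x y l where xy: "e = (Upair x y, l)" by (cases e rule: edge_cases)
  define e' where "e' = shift_edge (- floor_vec x) e"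
  have e': "e' \<in> E" "fst e' = Upair (cell_rep x) (y - floor_vec x)"
    using e by (simp add: e'_def) (simp add: e'_def xy cell_rep_def)
  show ?thesis
  proof (cases "floor_vec (y - floor_vec x) = 0")
    case True
    then have "e' \<in> EN" using e' by (simp add: edges_N_def inner_edge_iff[OF e'(2)])
    then show ?thesis using that[of "- floor_vec x"] by (simp add: e'_def)
  next
    case False
    then have "e' \<in> bridges V E" using e' by (simp add: bridge_iff[OF e'(2)])
    then obtain e'' where "e'' \<in> B" "equivalent_edges e' e''"
      using choice by (auto simp: bridge_choice_def)
    then obtain m where "m \<in> int_lattice" "shift_edge m e' \<in> B" by (auto simp: equivalent_edges_def)
    then show ?thesis
      using that[of "- floor_vec x + m"] by (simp add: e'_def edges_N_def int_lattice_diff)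
  qed
qed

text \<open>A translation by \<open>m \<noteq> 0\<close> moves both ends of an inner edge into the
  cell \<open>m\<close>, so the result is neither inner nor a bridge. What remains is to compare two
  chosen bridges, and these coincide by the choice.\<close>

lemma EN_unique:
  assumes e: "e \<in> EN" and m: "m \<in> int_lattice" and me: "shift_edge m e \<in> EN"
  shows "m = 0"
proof -
  obtain x y l where xy: "e = (Upair x y, l)" by (cases e rule: edge_cases)
  have e1: "fst e = Upair x y" and e2: "fst (shift_edge m e) = Upair (x + m) (y + m)"
    by (simp_all add: xy)
  have fl: "floor_vec (x + m) = floor_vec x + m" "floor_vec (y + m) = floor_vec y + m"
    using floor_vec_add[OF m] by auto
  consider "e \<in> B" "shift_edge m e \<in> B" | "e \<in> inner_edges V E" "shift_edge m e \<in> inner_edges V E"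
    | "e \<in> inner_edges V E" "shift_edge m e \<in> bridges V E"
    | "e \<in> bridges V E" "shift_edge m e \<in> inner_edges V E"
    using e me B_bridges by (auto simp: edges_N_def)
  then show ?thesis
  proof cases
    case 1
    have "equivalent_edges e e" unfolding equivalent_edges_def by (rule bexI[of _ 0]) auto
    moreover have "equivalent_edges e (shift_edge m e)" using m by (auto simp: equivalent_edges_def)
    moreover have "\<exists>!e'. e' \<in> B \<and> equivalent_edges e e'"
      using 1 choice B_bridges by (auto simp: bridge_choice_def)
    ultimately have "shift_edge m e = e" using 1 by blast
    then show ?thesis by (rule shift_edge_eq_self)
  qed (auto simp: inner_edge_iff[OF e1] inner_edge_iff[OF e2] bridge_iff[OF e1] bridge_iff[OF e2] fl)
qed

lemma finite_VN: "finite VN"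
proof (rule finite_subset)
  show "VN \<subseteq> fund_verts V \<union> (\<Union>e\<in>EN. set_uprod (fst e))"
    by (force simp: verts_N_def edges_N_def)
  show "finite (fund_verts V \<union> (\<Union>e\<in>EN. set_uprod (fst e)))"
    using finite_EN finite_fund_verts by auto
qed

lemma fund_subset_VN: "fund_verts V \<subseteq> VN"
  by (auto simp: verts_N_def)

lemma VN_subset: "VN \<subseteq> V"
  by (auto simp: verts_N_def fund_verts_def)

lemma EN_ends:
  assumes "e \<in> EN" "fst e = Upair x y"
  shows "x \<in> VN"
proof (cases "e \<in> inner_edges V E")
  case True
  then show ?thesis using assms fund_subset_VN by (auto simp: inner_edges_def)
next
  case False
  then have "e \<in> B" using assms by (auto simp: edges_N_def)
  then have "e \<in> bridges V E" using B_bridges by auto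
  then have "x \<in> V" "y \<in> V" "floor_vec x = 0 \<or> floor_vec y = 0"
    using bridge_iff[OF assms(2)] edge_verts[of e x y] assms(2) by auto
  then show ?thesis using \<open>e \<in> B\<close> assms(2) by (auto simp: verts_N_def fund_verts_iff)
qed

lemma VN_outside:
  assumes "x \<in> VN" "x \<notin> fund_verts V"
  shows "incident EN x \<noteq> {}"
  using assms by (auto simp: verts_N_def incident_def edges_N_def)

lemma rho_eq: "rho V B x = card {y \<in> VN. cell_rep y = cell_rep x}"
proof -
  have "(\<lambda>m. x + m) ` int_lattice \<inter> VN = {y \<in> VN. cell_rep y = cell_rep x}"
  proof (rule Set.set_eqI, rule iffI)
    fix y assume "y \<in> {y \<in> VN. cell_rep y = cell_rep x}"
    then have "y \<in> VN" "y - x \<in> int_lattice" by (auto simp: cell_rep_eq_iff)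
    then show "y \<in> (\<lambda>m. x + m) ` int_lattice \<inter> VN"
      by (auto intro!: image_eqI[of _ _ "y - x"])
  next
    fix y assume "y \<in> (\<lambda>m. x + m) ` int_lattice \<inter> VN"
    then show "y \<in> {y \<in> VN. cell_rep y = cell_rep x}" by (auto simp: cell_rep_add)
  qed
  then show ?thesis by (simp add: rho_def)
qed

lemma rho_cong: "cell_rep x = cell_rep y \<Longrightarrow> rho V B x = rho V B y"
  by (simp add: rho_eq)

lemma rho_pos:
  assumes "x \<in> VN"
  shows "rho V B x > 0"
  using assms finite_VN by (auto simp: rho_eq card_gt_0_iff)

definition class_edges :: "real^'d \<Rightarrow> 'd oriented_edge set" where
  "class_edges v = {(u, w, e, r) \<in> oriented_edges EN. cell_rep u = cell_rep v}"

text \<open>The transfer principle between the two graphs: \<open>EN_exists\<close> makes the map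
  onto, \<open>EN_unique\<close> makes it injective. Every oriented edge of the periodic graph at
  \<open>v\<close> is found exactly once at some copy of \<open>v\<close>, so a sum over the edges
  at \<open>v\<close> becomes a sum over its class in the finite graph.\<close>

lemma bij_betw_class_edges:
  assumes v: "v \<in> V"
  shows "bij_betw (\<lambda>(u, w, e, r). shift_oriented (v - u) (u, w, e, r)) (class_edges v) (out_edges E v)"
proof (rule bij_betw_imageI)
  show "inj_on (\<lambda>(u, w, e, r). shift_oriented (v - u) (u, w, e, r)) (class_edges v)"
  proof (rule inj_onI)
    fix p p' assume p: "p \<in> class_edges v" and p': "p' \<in> class_edges v"
      and eq: "(\<lambda>(u, w, e, r). shift_oriented (v - u) (u, w, e, r)) p =
        (\<lambda>(u, w, e, r). shift_oriented (v - u) (u, w, e, r)) p'"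
    obtain u w e r where 1: "p = (u, w, e, r)" by (cases p)
    obtain u' w' e' r' where 2: "p' = (u', w', e', r')" by (cases p')
    have eqs: "shift_edge (v - u) e = shift_edge (v - u') e'" "w + (v - u) = w' + (v - u')" "r = r'"
      using eq by (simp_all add: 1 2 shift_oriented_def)
    have "shift_edge (u' - v) (shift_edge (v - u) e) = e'" by (simp add: eqs(1))
    then have e': "shift_edge (u' - u) e = e'" by simp
    have "cell_rep u' = cell_rep u" using p p' by (simp add: 1 2 class_edges_def)
    then have "u' - u \<in> int_lattice" by (simp add: cell_rep_eq_iff)
    then have "u' - u = 0"
      using EN_unique[of e "u' - u"] e' p p' by (simp add: 1 2 class_edges_def mem_oriented_edges)
    then show "p = p'" using e' eqs by (simp add: 1 2)
  qed
  show "(\<lambda>(u, w, e, r). shift_oriented (v - u) (u, w, e, r)) ` class_edges v = out_edges E v"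
  proof (intro Set.set_eqI iffI)
    fix p assume "p \<in> (\<lambda>(u, w, e, r). shift_oriented (v - u) (u, w, e, r)) ` class_edges v"
    then obtain u w e r where p: "p = shift_oriented (v - u) (u, w, e, r)"
      and m: "(u, w, e, r) \<in> class_edges v" by auto
    then have "v - u \<in> int_lattice" "e \<in> E" "fst e = Upair u w" "r \<longrightarrow> u = w"
      using EN_subset by (auto simp: class_edges_def mem_oriented_edges cell_rep_eq_iff[symmetric])
    then show "p \<in> out_edges E v"
      unfolding p using fst_shift_edge_eq[of e u w "v - u"]
      by (auto simp: shift_oriented_def out_edges_def mem_oriented_edges)
  next
    fix p assume "p \<in> out_edges E v"
    then obtain w e r where p: "p = (v, w, e, r)" "e \<in> E" "fst e = Upair v w" "r \<longrightarrow> v = w"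
      by (auto simp: out_edges_def mem_oriented_edges)
    obtain m where m: "m \<in> int_lattice" "shift_edge m e \<in> EN" using EN_exists[OF p(2)] .
    have "(v + m, w + m, shift_edge m e, r) \<in> class_edges v"
      using m p fst_shift_edge_eq[OF p(3)] by (auto simp: class_edges_def mem_oriented_edges cell_rep_add)
    moreover have "p = shift_oriented (v - (v + m)) (v + m, w + m, shift_edge m e, r)"
      by (simp add: p shift_oriented_def)
    ultimately show "p \<in> (\<lambda>(u, w, e, r). shift_oriented (v - u) (u, w, e, r)) ` class_edges v"
      by (auto intro!: rev_image_eqI)
  qed
qed

lemma oriented_EN_ends:
  assumes "(u, w, e, r) \<in> oriented_edges EN"
  shows "u \<in> VN" "w \<in> VN"
proof -
  have e: "e \<in> EN" "fst e = Upair u w" "fst e = Upair w u"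
    using assms by (auto simp: mem_oriented_edges)
  show "u \<in> VN" "w \<in> VN" using EN_ends[OF e(1,2)] EN_ends[OF e(1,3)] by auto
qed

lemma finite_oriented_EN: "finite (oriented_edges EN)"
proof (rule finite_subset)
  show "oriented_edges EN \<subseteq> VN \<times> VN \<times> EN \<times> UNIV"
  proof
    fix p assume "p \<in> oriented_edges EN"
    then obtain u w e r where p: "p = (u, w, e, r)" "e \<in> EN" "fst e = Upair u w"
      by (cases p) (auto simp: mem_oriented_edges)
    then show "p \<in> VN \<times> VN \<times> EN \<times> UNIV"
      using \<open>p \<in> oriented_edges EN\<close> oriented_EN_ends[of u w e r] by auto
  qed
  show "finite (VN \<times> VN \<times> EN \<times> (UNIV :: bool set))" using finite_VN finite_EN by auto
qed

lemma sum_degree_class: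
  assumes v: "v \<in> V"
  shows "(\<Sum>x\<in>{y \<in> VN. cell_rep y = cell_rep v}. Defs.degree EN x) = Defs.degree E v"
proof -
  have "(\<Sum>x\<in>{y \<in> VN. cell_rep y = cell_rep v}. Defs.degree EN x)
    = (\<Sum>x\<in>{y \<in> VN. cell_rep y = cell_rep v}. card (out_edges EN x))"
    using finite_incident_EN by (simp add: degree_eq_card_out_edges)
  also have "\<dots> = card (\<Union>x\<in>{y \<in> VN. cell_rep y = cell_rep v}. out_edges EN x)"
    using finite_VN finite_incident_EN
    by (intro card_UN_disjoint[symmetric]) (auto simp: finite_out_edges, auto simp: out_edges_def)
  also have "(\<Union>x\<in>{y \<in> VN. cell_rep y = cell_rep v}. out_edges EN x) = class_edges v"
    using oriented_EN_ends by (auto simp: out_edges_def class_edges_def)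
  also have "card (class_edges v) = card (out_edges E v)"
    by (rule bij_betw_same_card[OF bij_betw_class_edges[OF v]])
  also have "\<dots> = Defs.degree E v"
    using degree_finite[OF v] by (simp add: degree_eq_card_out_edges)
  finally show ?thesis .
qed

lemma degree_cong:
  assumes "x \<in> V" "cell_rep x = cell_rep y"
  shows "Defs.degree E x = Defs.degree E y"
proof -
  have "y \<in> V" using assms cell_rep_in_V by metis
  then show ?thesis using sum_degree_class[of x] sum_degree_class[of y] assms by simp
qed

text \<open>By periodicity only the finitely many degrees from the fundamental cell occur, so the
  supremum in \<open>max_degree\<close> is a maximum.\<close>

lemma degree_le_max:
  assumes "x \<in> V"
  shows "Defs.degree E x \<le> max_degree V E"
proof -
  have "Defs.degree E ` V \<subseteq> Defs.degree E ` fund_verts V"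
  proof (intro image_subsetI)
    fix y assume y: "y \<in> V"
    then have "Defs.degree E y = Defs.degree E (cell_rep y)"
      by (intro degree_cong) (simp_all add: cell_rep_fund cell_rep_in_fund)
    then show "Defs.degree E y \<in> Defs.degree E ` fund_verts V" using cell_rep_in_fund[OF y] by simp
  qed
  then have "finite (Defs.degree E ` V)" using finite_fund_verts finite_surj by metis
  then show ?thesis unfolding max_degree_def using assms by (intro cSUP_upper) auto
qed

text \<open>The degree is a sum of two cardinalities, each of which can only shrink on passing to
  \<open>EN\<close>; equal degrees force both to agree.\<close>

lemma inner_vert_incident:
  assumes x: "x \<in> inner_verts V E B"
  shows "incident EN x = incident E x"
proof -
  have xV: "x \<in> V" and deg: "Defs.degree EN x = Defs.degree E x"
    using x VN_subset by (auto simp: inner_verts_def)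
  have fin: "finite (incident E x)" by (rule degree_finite[OF xV])
  have sub: "incident EN x \<subseteq> incident E x" "loops_at EN x \<subseteq> loops_at E x" "loops_at E x \<subseteq> incident E x"
    using EN_subset by (auto simp: incident_def loops_at_def)
  then have "card (incident EN x) \<le> card (incident E x)" "card (loops_at EN x) \<le> card (loops_at E x)"
    using fin by (auto intro: card_mono finite_subset)
  then have "card (incident EN x) = card (incident E x)"
    using deg by (simp add: Defs.degree_def)
  then show ?thesis using fin sub(1) card_subset_eq by blast
qed

text \<open>The degrees in the finite graph add up over a class to the degree in the periodic graph.
  An inner vertex attains this sum alone, so any other copy is left with degree 0.\<close>

lemma inner_vert_unique:
  assumes x: "x \<in> inner_verts V E B" and y: "cell_rep y = cell_rep x" and inc: "incident EN y \<noteq> {}"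
  shows "y = x"
proof (rule ccontr)
  assume "y \<noteq> x"
  have "\<exists>e\<in>EN. \<exists>z. fst e = Upair y z"
  proof -
    obtain e where e: "e \<in> EN" "y \<in> set_uprod (fst e)" using inc by (auto simp: incident_def)
    then have "\<exists>z. fst e = Upair y z"
      by (cases e rule: edge_cases) (auto intro: exI[of _ z for z])
    then show ?thesis using e by blast
  qed
  then have yV: "y \<in> VN" using EN_ends by blast
  have xV: "x \<in> VN" "Defs.degree EN x = Defs.degree E x" using x by (auto simp: inner_verts_def)
  have "(\<Sum>z\<in>{x, y}. Defs.degree EN z) \<le> (\<Sum>z\<in>{z \<in> VN. cell_rep z = cell_rep x}. Defs.degree EN z)"
    using xV yV y finite_VN by (intro sum_mono2) auto
  also have "\<dots> = Defs.degree EN x" using xV VN_subset by (auto simp: sum_degree_class)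
  finally have "Defs.degree EN y = 0" using \<open>y \<noteq> x\<close> by simp
  then show False using inc finite_incident_EN[of y] by (simp add: Defs.degree_def)
qed

lemma inner_verts_subset: "inner_verts V E B \<subseteq> VN"
  by (auto simp: inner_verts_def)

lemma inner_vert_inc_nonempty:
  "x \<in> inner_verts V E B \<Longrightarrow> incident EN x \<noteq> {}"
  using inner_vert_incident incident_nonempty inner_verts_subset VN_subset by blast

lemma inj_on_cell_rep_inner: "inj_on cell_rep (inner_verts V E B)"
  by (rule inj_onI) (metis inner_vert_unique inner_vert_inc_nonempty)

text \<open>All edges at an inner vertex belong to the finite graph, so their other ends are not
  isolated in it; and a class with an inner vertex has no second copy that is not isolated.\<close>

lemma inner_edge_end:
  assumes x: "x \<in> inner_verts V E B" and e: "e \<in> E" "fst e = Upair x y"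
    and z: "z \<in> inner_verts V E B" "cell_rep z = cell_rep y"
  shows "e \<in> EN" "y = z"
proof -
  have "e \<in> incident E x" using e by (simp add: incident_def)
  then show "e \<in> EN" using inner_vert_incident[OF x] by (auto simp: incident_def)
  then have "e \<in> incident EN y" using e by (simp add: incident_def)
  then have "incident EN y \<noteq> {}" by blast
  then show "y = z" using inner_vert_unique[OF z(1)] z(2) by auto
qed

lemma cell_rep_image_inner: "cell_rep ` inner_verts V E B \<subset> fund_verts V"
proof -
  have sub: "cell_rep ` inner_verts V E B \<subseteq> fund_verts V"
    using inner_verts_subset VN_subset cell_rep_in_fund by blast
  moreover have "cell_rep ` inner_verts V E B \<noteq> fund_verts V"
  proof
    assume eq: "cell_rep ` inner_verts V E B = fund_verts V"
    then obtain x where x: "x \<in> inner_verts V E B" using fund_verts_nonempty by blast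
    have "V \<subseteq> inner_verts V E B"
    proof (rule closed_under_adjacency[OF x])
      show "x \<in> V" using x inner_verts_subset VN_subset by blast
      fix e x y assume e: "e \<in> E" "fst e = Upair x y" "x \<in> inner_verts V E B"
      then have "cell_rep y \<in> cell_rep ` inner_verts V E B"
        unfolding eq using edge_verts cell_rep_in_fund by blast
      then obtain z where "z \<in> inner_verts V E B" "cell_rep z = cell_rep y" by force
      then show "y \<in> inner_verts V E B" using inner_edge_end(2)[OF e(3,1,2)] by blast
    qed
    then show False
      using infinite_verts finite_VN inner_verts_subset by (meson finite_subset)
  qed
  ultimately show ?thesis by blast
qed

lemma card_inner_verts_less: "card (inner_verts V E B) < card (fund_verts V)"
proof -
  have "card (inner_verts V E B) = card (cell_rep ` inner_verts V E B)"
    by (rule card_image[OF inj_on_cell_rep_inner, symmetric])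
  also have "\<dots> < card (fund_verts V)"
    by (rule psubset_card_mono[OF finite_fund_verts cell_rep_image_inner])
  finally show ?thesis .
qed

text \<open>Copies outside the fundamental cell are ends of chosen bridges and hence not isolated,
  so none can accompany an inner vertex of the cell. This gives \<open>rho = 1\<close>, which enters
  the trace of the Dirichlet matrix.\<close>

lemma class_of_inner_fund_vert:
  assumes x: "x \<in> inner_verts V E B" "x \<in> fund_verts V"
  shows "{y \<in> VN. cell_rep y = cell_rep x} = {x}"
proof -
  have "y = x" if "y \<in> VN" "cell_rep y = cell_rep x" for y
  proof (cases "y \<in> fund_verts V")
    case True
    then show ?thesis using that x cell_rep_fund by metis
  next
    case False
    then show ?thesis using VN_outside[OF that(1)] inner_vert_unique[OF x(1) that(2)] by blast
  qed
  then show ?thesis using x inner_verts_subset by auto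
qed

section \<open>Counting vertices and bridges\<close>

lemma card_VN_lower: "card (fund_verts V) + CARD('d) \<le> card VN"
proof -
  define M where "M = floor_vec ` (VN - fund_verts V)"
  have fin: "finite (VN - fund_verts V)" using finite_VN by simp
  have "span M = UNIV"
  proof (rule ccontr)
    assume "span M \<noteq> UNIV"
    then obtain \<phi> where \<phi>: "\<phi> \<noteq> 0" "\<And>m. m \<in> span M \<Longrightarrow> \<phi> \<bullet> m = 0"
      using span_not_UNIV_orthogonal[of M] by (metis inner_commute)
    obtain x0 where x0: "x0 \<in> fund_verts V" using fund_verts_nonempty by auto
    have VN0: "\<phi> \<bullet> floor_vec x = 0" if "x \<in> VN" for x
    proof (cases "x \<in> fund_verts V")
      case True
      then show ?thesis by (simp add: fund_verts_iff)
    next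
      case False
      then have "floor_vec x \<in> M" using that by (auto simp: M_def)
      then show ?thesis using \<phi>(2) by (auto intro: span_base)
    qed
    have "V \<subseteq> {x. \<phi> \<bullet> floor_vec x = 0}"
    proof (rule closed_under_adjacency[of x0])
      fix e x y assume e: "e \<in> E" "fst e = Upair x y" and x: "x \<in> {x. \<phi> \<bullet> floor_vec x = 0}"
      \<comment> \<open>Both ends of the representative lie on the level 0 of \<open>\<phi>\<close>,
        so \<open>x\<close> and \<open>y\<close> lie on a common level, whatever \<open>m\<close>
        is.\<close>
      obtain m where m: "m \<in> int_lattice" "shift_edge m e \<in> EN" using EN_exists[OF e(1)] .
      have "fst (shift_edge m e) = Upair (x + m) (y + m)" by (rule fst_shift_edge_eq[OF e(2)])
      then have "x + m \<in> VN" "y + m \<in> VN"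
        using EN_ends[OF m(2)] by (auto simp: eq_commute)
      then have "\<phi> \<bullet> floor_vec (x + m) = 0" "\<phi> \<bullet> floor_vec (y + m) = 0" using VN0 by auto
      then show "y \<in> {x. \<phi> \<bullet> floor_vec x = 0}"
        using x by (simp add: floor_vec_add[OF m(1)] inner_add_right)
    qed (use x0 in \<open>auto simp: fund_verts_iff\<close>)
    \<comment> \<open>The unit translates of \<open>x0\<close> test every coordinate of
      \<open>\<phi>\<close>.\<close>
    moreover have "x0 + axis s 1 \<in> V" for s
      using x0 by (subst vert_add) (auto simp: int_lattice_def axis_def fund_verts_iff)
    ultimately have "\<phi> \<bullet> floor_vec (x0 + axis s 1) = 0" for s by blast
    moreover have "floor_vec (x0 + axis s 1) = axis s 1" for s
      using x0 by (subst floor_vec_add) (auto simp: int_lattice_def axis_def fund_verts_iff)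
    ultimately have "\<phi> $ s = 0" for s by (metis inner_axis inner_real_def mult.right_neutral)
    then show False using \<phi>(1) by (simp add: Finite_Cartesian_Product.vec_eq_iff)
  qed
  then have "CARD('d) \<le> card M"
    using span_card_ge_dim[of M UNIV] fin by (simp add: M_def)
  also have "\<dots> \<le> card (VN - fund_verts V)" unfolding M_def by (rule card_image_le[OF fin])
  also have "\<dots> = card VN - card (fund_verts V)"
    using fund_subset_VN finite_fund_verts by (simp add: card_Diff_subset)
  finally show ?thesis
    using card_mono[OF finite_VN fund_subset_VN] by simp
qed

text \<open>A chosen bridge has exactly one end outside the fundamental cell, and these ends exhaust
  the additional vertices.\<close>

lemma card_VN_upper: "card VN \<le> card (fund_verts V) + card B"
proof -
  define f where "f e = (SOME u. u \<in> set_uprod (fst e) \<and> floor_vec u \<noteq> 0)" for e :: "'d edge"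
  have finB: "finite B" using finite_bridges B_bridges by (rule rev_finite_subset)
  have "VN - fund_verts V \<subseteq> f ` B"
  proof
    fix u assume u: "u \<in> VN - fund_verts V"
    then obtain e w where e: "e \<in> B" "w \<in> fund_verts V" "fst e = Upair u w" "u \<in> V"
      by (auto simp: verts_N_def)
    have "u' = u" if "u' \<in> set_uprod (fst e) \<and> floor_vec u' \<noteq> 0" for u'
      using that e by (auto simp: fund_verts_iff)
    moreover have "u \<in> set_uprod (fst e) \<and> floor_vec u \<noteq> 0"
      using u e by (auto simp: fund_verts_iff)
    ultimately have "f e = u" unfolding f_def by (rule some_equality[rotated])
    then show "u \<in> f ` B" using e by auto
  qed
  then have "card (VN - fund_verts V) \<le> card B" using finB surj_card_le by blast
  then show ?thesis
    using fund_subset_VN finite_fund_verts by (simp add: card_Diff_subset)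
qed

text \<open>The partner of a chosen bridge arises by translating its outer end into the fundamental
  cell, which moves the other end out. Partners are distinct and never chosen themselves, because
  the finite graph has only one edge of each class.\<close>

lemma card_bridges: "2 * card B \<le> card (bridges V E)"
proof -
  define t where "t e = shift_edge (- floor_vec (SOME u. u \<in> set_uprod (fst e) \<and> floor_vec u \<noteq> 0)) e"
    for e :: "'d edge"
  have t: "t e \<in> bridges V E \<and> (\<exists>m\<in>int_lattice. m \<noteq> 0 \<and> t e = shift_edge m e)" if "e \<in> B" for e
  proof -
    have "e \<in> bridges V E" using that B_bridges by auto
    then obtain u w where uw: "e \<in> E" "fst e = Upair u w" "floor_vec u = 0" "floor_vec w \<noteq> 0"
      by (auto simp: bridges_def fund_verts_iff)
    have "(SOME u. u \<in> set_uprod (fst e) \<and> floor_vec u \<noteq> 0) = w"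
      by (rule some_equality) (use uw in auto)
    then have te: "t e = shift_edge (- floor_vec w) e" by (simp add: t_def)
    then have "fst (t e) = Upair (u + - floor_vec w) (w + - floor_vec w)"
      using fst_shift_edge_eq[OF uw(2)] by simp
    moreover have "t e \<in> E" using te uw by simp
    ultimately have "t e \<in> bridges V E"
      using uw floor_vec_add[of "- floor_vec w" u] floor_vec_add[of "- floor_vec w" w]
      by (subst bridge_iff) auto
    then show ?thesis using te uw by (auto intro!: bexI[of _ "- floor_vec w"])
  qed
  have BN: "B \<subseteq> EN" by (auto simp: edges_N_def)
  have inj: "inj_on t B"
  proof (rule inj_onI)
    fix e e' assume e: "e \<in> B" "e' \<in> B" "t e = t e'"
    obtain m m' where m: "m \<in> int_lattice" "m' \<in> int_lattice" "t e = shift_edge m e" "t e' = shift_edge m' e'"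
      using t e by metis
    have "shift_edge (m - m') e = shift_edge (- m') (shift_edge m e)" by simp
    also have "\<dots> = shift_edge (- m') (shift_edge m' e')" using m(3,4) e(3) by metis
    finally have e': "shift_edge (m - m') e = e'" by simp
    then have "m - m' = 0" using e m BN by (intro EN_unique[of e]) (auto simp: int_lattice_diff)
    then show "e = e'" using e' by simp
  qed
  have disj: "B \<inter> t ` B = {}"
    using t EN_unique BN by (auto, metis subsetD)
  have "card B + card B = card (B \<union> t ` B)"
    using inj disj finite_bridges B_bridges
    by (subst card_Un_disjoint) (auto simp: card_image intro: finite_subset)
  also have "\<dots> \<le> card (bridges V E)"
    using t B_bridges by (intro card_mono finite_bridges) auto
  finally show ?thesis by simp
qed

end

section \<open>Floquet, Neumann and Dirichlet matrices\<close>

context cut_graph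
begin

definition cls :: "real^'d \<Rightarrow> (real^'d) set" where
  "cls x = {p \<in> VN. cell_rep p = cell_rep x}"

text \<open>The adjacency matrix of the finite graph. A loop is counted with both orientations, so
  that the row sums are degrees.\<close>

definition mult_EN :: "real^'d \<Rightarrow> real^'d \<Rightarrow> nat" where
  "mult_EN p q = card {(u, w, e, r) \<in> oriented_edges EN. u = p \<and> w = q}"

lemma finite_cls: "finite (cls x)"
  using finite_VN by (simp add: cls_def)

lemma mult_EN_commute: "mult_EN p q = mult_EN q p"
  unfolding mult_EN_def
  by (rule bij_betw_same_card[of "\<lambda>(u, w, e, r). (w, u, e, r)"],
      rule bij_betw_byWitness[where f' = "\<lambda>(u, w, e, r). (w, u, e, r)"])
    (auto simp: mem_oriented_edges)

lemma mult_EN_eq_0: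
  assumes "incident EN p = {}"
  shows "mult_EN p q = 0"
proof -
  have "{(u, w, e, r) \<in> oriented_edges EN. u = p \<and> w = q} = {}"
    using assms by (auto simp: mem_oriented_edges incident_def)
  then show ?thesis unfolding mult_EN_def by (simp only: card.empty)
qed

lemma sum_class_edges:
  fixes f :: "real^'d \<Rightarrow> real^'d \<Rightarrow> 'b::comm_semiring_1"
  shows "(\<Sum>(u, w, e, r)\<in>class_edges x. f u w) = (\<Sum>p\<in>cls x. \<Sum>q\<in>VN. of_nat (mult_EN p q) * f p q)"
proof -
  let ?g = "\<lambda>(u, w, e, r). (u, w) :: (real^'d) \<times> (real^'d)"
  have fin: "finite (class_edges x)"
    by (rule finite_subset[OF _ finite_oriented_EN]) (auto simp: class_edges_def)
  have sub: "?g ` class_edges x \<subseteq> cls x \<times> VN"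
    using oriented_EN_ends by (auto simp: class_edges_def cls_def)
  have "(\<Sum>(u, w, e, r)\<in>class_edges x. f u w) =
    (\<Sum>y\<in>cls x \<times> VN. \<Sum>o1\<in>{o1 \<in> class_edges x. ?g o1 = y}. case o1 of (u, w, e, r) \<Rightarrow> f u w)"
    by (rule sum.group[symmetric, OF fin _ sub]) (use finite_cls finite_VN in auto)
  also have "\<dots> = (\<Sum>(p, q)\<in>cls x \<times> VN. of_nat (mult_EN p q) * f p q)"
  proof (rule sum.cong[OF refl])
    fix y assume y: "y \<in> cls x \<times> VN"
    obtain p q where pq: "y = (p, q)" by (cases y)
    have p: "p \<in> cls x" "q \<in> VN" using y pq by auto
    have eq: "{o1 \<in> class_edges x. ?g o1 = (p, q)} = {(u, w, e, r) \<in> oriented_edges EN. u = p \<and> w = q}"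
      using p by (auto simp: class_edges_def cls_def)
    have "(\<Sum>o1\<in>{o1 \<in> class_edges x. ?g o1 = (p, q)}. case o1 of (u, w, e, r) \<Rightarrow> f u w)
      = (\<Sum>o1\<in>{o1 \<in> class_edges x. ?g o1 = (p, q)}. f p q)"
      by (rule sum.cong) auto
    also have "\<dots> = of_nat (mult_EN p q) * f p q"
      unfolding eq mult_EN_def by (rule sum_constant)
    finally show "(\<Sum>o1\<in>{o1 \<in> class_edges x. ?g o1 = y}. case o1 of (u, w, e, r) \<Rightarrow> f u w)
      = (case y of (p, q) \<Rightarrow> of_nat (mult_EN p q) * f p q)"
      by (simp add: pq)
  qed
  also have "\<dots> = (\<Sum>p\<in>cls x. \<Sum>q\<in>VN. of_nat (mult_EN p q) * f p q)"
    by (rule sum.cartesian_product[symmetric])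
  finally show ?thesis .
qed

text \<open>An edge from \<open>p\<close> to \<open>q\<close> of the finite graph is translated so
  as to start at \<open>x\<close>, that is, by minus the cell index of \<open>p\<close>. With a
  constant, an indicator or a phase as \<open>f\<close> this yields degrees, loop numbers or Floquet
  entries.\<close>

lemma sum_out_edges:
  fixes f :: "real^'d \<Rightarrow> 'b::comm_semiring_1"
  assumes x: "x \<in> fund_verts V"
  shows "(\<Sum>(u, w, e, r)\<in>out_edges E x. f w) =
    (\<Sum>p\<in>cls x. \<Sum>q\<in>VN. of_nat (mult_EN p q) * f (q - floor_vec p))"
proof -
  have xV: "x \<in> V" and x0: "cell_rep x = x" using x by (auto simp: fund_verts_iff cell_rep_id)
  have "(\<Sum>(u, w, e, r)\<in>out_edges E x. f w) = (\<Sum>o1\<in>class_edges x.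
      (\<lambda>(u, w, e, r). f w) ((\<lambda>(u, w, e, r). shift_oriented (x - u) (u, w, e, r)) o1))"
    by (rule sum.reindex_bij_betw[symmetric, OF bij_betw_class_edges[OF xV]])
  also have "\<dots> = (\<Sum>(u, w, e, r)\<in>class_edges x. f (w - floor_vec u))"
  proof (rule sum.cong[OF refl])
    fix o1 assume o1: "o1 \<in> class_edges x"
    obtain u w e r where uw: "o1 = (u, w, e, r)" by (cases o1)
    then have "u - floor_vec u = x" using o1 x0 by (simp add: class_edges_def cell_rep_def)
    then have "w + (x - u) = w - floor_vec u" by (auto simp: algebra_simps)
    then show "(\<lambda>(u, w, e, r). f w) ((\<lambda>(u, w, e, r). shift_oriented (x - u) (u, w, e, r)) o1)
        = (case o1 of (u, w, e, r) \<Rightarrow> f (w - floor_vec u))"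
      by (simp add: shift_oriented_def uw)
  qed
  also have "\<dots> = (\<Sum>p\<in>cls x. \<Sum>q\<in>VN. of_nat (mult_EN p q) * f (q - floor_vec p))"
    by (rule sum_class_edges)
  finally show ?thesis .
qed

lemma sum_mult_EN:
  assumes "x \<in> fund_verts V"
  shows "(\<Sum>p\<in>cls x. \<Sum>q\<in>VN. mult_EN p q) = Defs.degree E x"
proof -
  have "Defs.degree E x = (\<Sum>(u, w, e, r)\<in>out_edges E x. 1)"
    using assms degree_finite by (simp add: degree_eq_card_out_edges fund_verts_iff case_prod_unfold)
  then show ?thesis using sum_out_edges[OF assms, of "\<lambda>_. 1 :: nat"] by simp
qed

lemma sum_mult_EN_loops:
  assumes x: "x \<in> fund_verts V"
  shows "(\<Sum>p\<in>cls x. mult_EN p p) = loop_number E x"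
proof -
  have fin: "finite (out_edges E x)"
    using x degree_finite by (auto intro: finite_out_edges simp: fund_verts_iff)
  have "{(u, w, e, r) \<in> oriented_edges E. u = x \<and> w = x} = {o1 \<in> out_edges E x. case o1 of (u, w, e, r) \<Rightarrow> w = x}"
    by (auto simp: out_edges_def)
  then have "loop_number E x = (\<Sum>o1\<in>{o1 \<in> out_edges E x. case o1 of (u, w, e, r) \<Rightarrow> w = x}. 1)"
    by (simp add: loop_number_def)
  also have "\<dots> = (\<Sum>(u, w, e, r)\<in>out_edges E x. if w = x then 1 else 0)"
    unfolding sum.inter_filter[OF fin] by (rule sum.cong) auto
  also have "\<dots> = (\<Sum>p\<in>cls x. \<Sum>q\<in>VN. mult_EN p q * (if q - floor_vec p = x then 1 else 0))"
    by (subst sum_out_edges[OF x]) simp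
  also have "\<dots> = (\<Sum>p\<in>cls x. \<Sum>q\<in>VN. if q = p then mult_EN p p else 0)"
  proof (intro sum.cong refl)
    \<comment> \<open>The translated edge closes up at \<open>x\<close> only if the original one is
      a loop.\<close>
    fix p q assume "p \<in> cls x"
    then have "p = x + floor_vec p" using x by (simp add: cls_def cell_rep_fund) (simp add: cell_rep_def algebra_simps)
    then have "q - floor_vec p = x \<longleftrightarrow> q = p" by (metis add_diff_cancel_right' diff_add_cancel)
    then show "mult_EN p q * (if q - floor_vec p = x then 1 else 0) = (if q = p then mult_EN p p else 0)" by auto
  qed
  also have "\<dots> = (\<Sum>p\<in>cls x. mult_EN p p)"
    using finite_VN by (intro sum.cong refl) (auto simp: cls_def)
  finally show ?thesis by simp
qed

lemma sum_VN_classes: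
  fixes f :: "real^'d \<Rightarrow> 'b::comm_monoid_add"
  shows "(\<Sum>p\<in>VN. f p) = (\<Sum>x\<in>fund_verts V. \<Sum>p\<in>cls x. f p)"
proof -
  have "(\<Sum>p\<in>VN. f p) = (\<Sum>x\<in>fund_verts V. \<Sum>p\<in>{p \<in> VN. cell_rep p = x}. f p)"
    by (rule sum.group[symmetric]) (use finite_VN finite_fund_verts VN_subset cell_rep_in_fund in auto)
  also have "\<dots> = (\<Sum>x\<in>fund_verts V. \<Sum>p\<in>cls x. f p)"
    by (rule sum.cong) (auto simp: cls_def cell_rep_fund)
  finally show ?thesis .
qed

lemma sum_VN_class_restrict:
  fixes f :: "real^'d \<Rightarrow> 'b::comm_monoid_add"
  assumes "x \<in> fund_verts V"
  shows "(\<Sum>p\<in>VN. if cell_rep p = x then f p else 0) = (\<Sum>p\<in>cls x. f p)"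
  using assms by (simp add: sum.inter_filter[OF finite_VN, symmetric] cls_def cell_rep_fund)

end

section \<open>The Floquet matrices as compressions of the Neumann matrix\<close>

locale numbered_graph = cut_graph V E B for V :: "(real^'d) set" and E B :: "'d edge set" +
  fixes Q :: "real^'d \<Rightarrow> real" and v :: "nat \<Rightarrow> real^'d"
  assumes potential: "periodic_potential V Q"
    and numbering: "vertex_numbering V B v"
begin

abbreviation nu where "nu \<equiv> card (fund_verts V)"
abbreviation nuN where "nuN \<equiv> card VN"
abbreviation nuD where "nuD \<equiv> card (inner_verts V E B)"
abbreviation HN where "HN \<equiv> neumann_matrix V E Q B v"
abbreviation HF where "HF \<theta> \<equiv> floquet_matrix V E Q v \<theta>"

lemma nu_le_nuN: "nu \<le> nuN"
  by (rule card_mono[OF finite_VN fund_subset_VN])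

lemma bij_VN: "bij_betw (\<lambda>a. v (a + 1)) {..<nuN} VN"
proof -
  have "bij_betw (\<lambda>a. a + 1) {..<nuN} {1..nuN}"
    by (rule bij_betw_byWitness[where f' = "\<lambda>a. a - 1"]) auto
  moreover have "bij_betw v {1..nuN} VN" using numbering by (simp add: vertex_numbering_def)
  ultimately have "bij_betw (v \<circ> (\<lambda>a. a + 1)) {..<nuN} VN" by (rule bij_betw_trans)
  then show ?thesis by (simp add: comp_def)
qed

lemma bij_fund: "bij_betw (\<lambda>a. v (a + 1)) {..<nu} (fund_verts V)"
proof (rule bij_betw_imageI)
  show "inj_on (\<lambda>a. v (a + 1)) {..<nu}"
    by (rule inj_on_subset[OF bij_betw_imp_inj_on[OF bij_VN]]) (use nu_le_nuN in auto)
  have "(\<lambda>a. v (a + 1)) ` {..<nu} = v ` Suc ` {..<nu}" by (simp add: image_image)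
  also have "Suc ` {..<nu} = {1..nu}" by (simp add: image_Suc_lessThan)
  finally show "(\<lambda>a. v (a + 1)) ` {..<nu} = fund_verts V"
    using numbering by (simp add: vertex_numbering_def)
qed

lemma v_in_fund: "a < nu \<Longrightarrow> v (Suc a) \<in> fund_verts V"
  using bij_fund by (auto dest: bij_betwE)

lemma v_eq_iff: "a < nuN \<Longrightarrow> b < nuN \<Longrightarrow> v (Suc a) = v (Suc b) \<longleftrightarrow> a = b"
  using bij_betw_imp_inj_on[OF bij_VN] by (auto simp: inj_on_def)

lemma sum_VN: "(\<Sum>a<nuN. f (v (Suc a))) = (\<Sum>p\<in>VN. f p)"
  using sum.reindex_bij_betw[OF bij_VN, of f] by simp

lemma sum_fund: "(\<Sum>a<nu. f (v (Suc a))) = (\<Sum>p\<in>fund_verts V. f p)"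
  using sum.reindex_bij_betw[OF bij_fund, of f] by simp

lemma Q_cong:
  assumes "x \<in> V" "cell_rep x = cell_rep y"
  shows "Q x = Q y"
proof -
  have yV: "y \<in> V" using assms cell_rep_in_V by metis
  have "Q (y + (x - y)) = Q y"
    using potential yV assms(2) unfolding periodic_potential_def cell_rep_eq_iff by blast
  then show ?thesis by simp
qed

lemma carrier_HN: "HN \<in> carrier_mat nuN nuN"
  by (simp add: neumann_matrix_def)

lemma carrier_HF: "HF \<theta> \<in> carrier_mat nu nu"
  by (simp add: floquet_matrix_def)

definition HN_entry :: "real^'d \<Rightarrow> real^'d \<Rightarrow> complex" where
  "HN_entry p q = (if p = q then of_real (real (rho V B p) * real (Defs.degree EN p) + Q p) else 0)
    - of_real (sqrt (real (rho V B p)) * sqrt (real (rho V B q))) * of_nat (mult_EN p q)"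

lemma index_HN:
  assumes a: "a < nuN" and b: "b < nuN"
  shows "HN $$ (a, b) = HN_entry (v (Suc a)) (v (Suc b))"
proof -
  define p q where "p = v (Suc a)" and "q = v (Suc b)"
  have fin: "finite {(u, w, e, r) \<in> oriented_edges EN. u = p}"
    by (rule finite_subset[OF _ finite_oriented_EN]) auto
  have "(\<Sum>(u, w, e, r) \<in> {(u, w, e, r) \<in> oriented_edges EN. u = p}.
        complex_of_real (sqrt (real (rho V B w))) * indicator {q} w)
    = (\<Sum>o1 \<in> {(u, w, e, r) \<in> oriented_edges EN. u = p}.
        if (case o1 of (u, w, e, r) \<Rightarrow> w = q) then complex_of_real (sqrt (real (rho V B q))) else 0)"
    by (rule sum.cong) (auto simp: indicator_def)
  also have "\<dots> = (\<Sum>o1 \<in> {o1 \<in> {(u, w, e, r) \<in> oriented_edges EN. u = p}. case o1 of (u, w, e, r) \<Rightarrow> w = q}.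
       complex_of_real (sqrt (real (rho V B q))))"
    by (rule sum.inter_filter[OF fin, symmetric])
  also have "{o1 \<in> {(u, w, e, r) \<in> oriented_edges EN. u = p}. case o1 of (u, w, e, r) \<Rightarrow> w = q}
      = {(u, w, e, r) \<in> oriented_edges EN. u = p \<and> w = q}" by auto
  finally have sum: "(\<Sum>(u, w, e, r) \<in> {(u, w, e, r) \<in> oriented_edges EN. u = p}.
        complex_of_real (sqrt (real (rho V B w))) * indicator {q} w)
      = of_nat (mult_EN p q) * complex_of_real (sqrt (real (rho V B q)))"
    by (simp only: mult_EN_def sum_constant)
  have "HN $$ (a, b) = neumann_op V E Q B (indicator {q}) p"
    using a b by (simp add: neumann_matrix_def p_def q_def)
  also have "\<dots> = HN_entry p q"
    unfolding neumann_op_def sum HN_entry_def by (simp add: indicator_def algebra_simps)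
  finally show ?thesis by (simp add: p_def q_def)
qed

lemma HN_entry_adj: "cnj (HN_entry q p) = HN_entry p q"
  by (simp add: HN_entry_def mult_EN_commute[of q p])

lemma adj_HN: "adj HN = HN"
  by (rule eq_matI) (use carrier_HN in \<open>auto simp: index_HN HN_entry_adj\<close>)

text \<open>The Bloch factor: a quasi-periodic function takes at \<open>p\<close> this multiple of
  its value at the representative in the fundamental cell.\<close>

definition phase :: "real^'d \<Rightarrow> real^'d \<Rightarrow> complex" where
  "phase \<theta> p = exp (\<i> * complex_of_real (floor_vec p \<bullet> \<theta>))"

lemma phase_unit [simp]: "cmod (phase \<theta> p) = 1" "cnj (phase \<theta> p) * phase \<theta> p = 1"
    "phase \<theta> p * cnj (phase \<theta> p) = 1"
  by (simp_all add: phase_def complex_norm_square[symmetric] exp_cnj exp_add[symmetric])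

text \<open>The Floquet matrix read off the finite graph. The exponent of an edge is the difference
  of the cell indices of its ends, so it factorizes into one phase per end; this makes a compression
  by vertex weights possible.\<close>

definition HF_entry :: "real^'d \<Rightarrow> real^'d \<Rightarrow> real^'d \<Rightarrow> complex" where
  "HF_entry \<theta> x y = (if x = y then of_real (real (Defs.degree E x) + Q x) else 0)
    - (\<Sum>p\<in>cls x. \<Sum>q\<in>cls y. of_nat (mult_EN p q) * (cnj (phase \<theta> p) * phase \<theta> q))"

lemma index_HF:
  assumes j: "j < nu" and k: "k < nu"
  shows "HF \<theta> $$ (j, k) = HF_entry \<theta> (v (Suc j)) (v (Suc k))"
proof -
  define x y where "x = v (Suc j)" and "y = v (Suc k)"
  have x: "x \<in> fund_verts V" and y: "y \<in> fund_verts V"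
    using j k v_in_fund by (auto simp: x_def y_def)
  have xy: "j = k \<longleftrightarrow> x = y" using v_eq_iff j k nu_le_nuN by (simp add: x_def y_def)
  have fin: "finite (out_edges E x)"
    using x degree_finite by (auto intro: finite_out_edges simp: fund_verts_iff)
  let ?f = "\<lambda>w. if cell_rep w = y then phase \<theta> w else 0"
  have "(\<Sum>(u, w, e, r) \<in> {(u, w, e, r) \<in> oriented_edges E. u = x \<and> w - y \<in> int_lattice}.
      exp (\<i> * complex_of_real ((w - y) \<bullet> \<theta>)))
    = (\<Sum>o1 \<in> {o1 \<in> out_edges E x. case o1 of (u, w, e, r) \<Rightarrow> cell_rep w = y}.
        case o1 of (u, w, e, r) \<Rightarrow> phase \<theta> w)"
  proof (rule sum.cong)
    show "{(u, w, e, r) \<in> oriented_edges E. u = x \<and> w - y \<in> int_lattice}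
      = {o1 \<in> out_edges E x. case o1 of (u, w, e, r) \<Rightarrow> cell_rep w = y}"
      using y by (auto simp: out_edges_def cell_rep_eq_iff[symmetric] cell_rep_fund)
  qed (auto simp: phase_def cell_rep_def)
  also have "\<dots> = (\<Sum>(u, w, e, r)\<in>out_edges E x. ?f w)"
    unfolding sum.inter_filter[OF fin] by (rule sum.cong) auto
  also have "\<dots> = (\<Sum>p\<in>cls x. \<Sum>q\<in>VN. of_nat (mult_EN p q) * ?f (q - floor_vec p))"
    by (rule sum_out_edges[OF x])
  also have "\<dots> = (\<Sum>p\<in>cls x. \<Sum>q\<in>VN. if cell_rep q = y then
      of_nat (mult_EN p q) * (cnj (phase \<theta> p) * phase \<theta> q) else 0)"
  proof (intro sum.cong refl)
    fix p q :: "real^'d"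
    have "cell_rep (q - floor_vec p) = cell_rep q"
      using cell_rep_add[of "- floor_vec p" q] by simp
    moreover have "phase \<theta> (q - floor_vec p) = cnj (phase \<theta> p) * phase \<theta> q"
    proof -
      have fl: "floor_vec (q - floor_vec p) = floor_vec q - floor_vec p"
        using floor_vec_add[of "- floor_vec p" q] by simp
      show ?thesis unfolding phase_def fl
        by (simp add: exp_cnj exp_add[symmetric] inner_diff_left algebra_simps)
    qed
    ultimately show "of_nat (mult_EN p q) * ?f (q - floor_vec p) = (if cell_rep q = y then
      of_nat (mult_EN p q) * (cnj (phase \<theta> p) * phase \<theta> q) else 0)" by simp
  qed
  also have "\<dots> = (\<Sum>p\<in>cls x. \<Sum>q\<in>cls y. of_nat (mult_EN p q) * (cnj (phase \<theta> p) * phase \<theta> q))"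
    by (simp add: sum_VN_class_restrict[OF y])
  finally show ?thesis
    using j k xy by (simp add: floquet_matrix_def HF_entry_def flip: x_def y_def)
qed

lemma HF_entry_adj: "cnj (HF_entry \<theta> y x) = HF_entry \<theta> x y"
  unfolding HF_entry_def
  by (subst (2) sum.swap) (simp add: cnj_sum mult_EN_commute mult_ac)

lemma adj_HF: "adj (HF \<theta>) = HF \<theta>"
  by (rule eq_matI) (use carrier_HF[of \<theta>] in \<open>auto simp: index_HF HF_entry_adj\<close>)

text \<open>The matrix of the quasi-periodic continuation to \<open>VN\<close>; the class of
  \<open>p\<close> has \<open>rho V B p\<close> members of equal modulus, which explains the
  normalization.\<close>

definition JN :: "real^'d \<Rightarrow> real^'d \<Rightarrow> real^'d \<Rightarrow> complex" where
  "JN \<theta> p x = (if cell_rep p = x then phase \<theta> p / of_real (sqrt (real (rho V B p))) else 0)"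

lemma card_cls: "card (cls x) = rho V B x"
  by (simp add: cls_def rho_eq)

lemma JN_isometry:
  assumes x: "x \<in> fund_verts V" and y: "y \<in> fund_verts V"
  shows "(\<Sum>p\<in>VN. cnj (JN \<theta> p x) * JN \<theta> p y) = (if x = y then 1 else 0)"
proof (cases "x = y")
  case True
  have "(\<Sum>p\<in>VN. cnj (JN \<theta> p x) * JN \<theta> p y) =
    (\<Sum>p\<in>VN. if cell_rep p = x then 1 / complex_of_real (real (rho V B p)) else 0)"
  proof (intro sum.cong refl)
    fix p
    have "complex_of_real (sqrt (real (rho V B p))) * complex_of_real (sqrt (real (rho V B p))) = of_real (real (rho V B p))"
      by (simp flip: of_real_mult)
    then show "cnj (JN \<theta> p x) * JN \<theta> p y = (if cell_rep p = x then 1 / complex_of_real (real (rho V B p)) else 0)"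
      using True by (simp add: JN_def)
  qed
  also have "\<dots> = (\<Sum>p\<in>cls x. 1 / complex_of_real (real (rho V B p)))"
    by (rule sum_VN_class_restrict[OF x])
  also have "\<dots> = (\<Sum>p\<in>cls x. 1 / complex_of_real (real (rho V B x)))"
    by (rule sum.cong) (auto simp: cls_def dest: rho_cong)
  also have "\<dots> = 1"
    using rho_pos[of x] x fund_subset_VN by (auto simp: card_cls)
  finally show ?thesis using True by simp
next
  case False
  then have "(\<Sum>p\<in>VN. cnj (JN \<theta> p x) * JN \<theta> p y) = (\<Sum>p\<in>VN. 0)"
    by (intro sum.cong) (auto simp: JN_def)
  then show ?thesis using False by simp
qed

text \<open>The weights cancel against the normalization, except that the potential is left divided
  by \<open>rho\<close>; the sum over the \<open>rho\<close> copies restores it. The degrees of the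
  copies add up to the degree in the periodic graph, and the adjacency terms keep exactly the phases
  of \<open>HF_entry\<close>.\<close>

lemma JN_compression:
  assumes x: "x \<in> fund_verts V" and y: "y \<in> fund_verts V"
  shows "(\<Sum>p\<in>VN. \<Sum>q\<in>VN. cnj (JN \<theta> p x) * HN_entry p q * JN \<theta> q y) = HF_entry \<theta> x y"
proof -
  have xV: "x \<in> V" using x by (simp add: fund_verts_iff)
  have rx: "rho V B x > 0" using x fund_subset_VN rho_pos by auto
  have ry: "rho V B y > 0" using y fund_subset_VN rho_pos by auto
  have rp: "rho V B p = rho V B x" if "p \<in> cls x" for p x using that by (auto simp: cls_def intro: rho_cong)
  have "(\<Sum>p\<in>VN. \<Sum>q\<in>VN. cnj (JN \<theta> p x) * HN_entry p q * JN \<theta> q y) =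
    (\<Sum>p\<in>VN. if cell_rep p = x then (\<Sum>q\<in>VN. if cell_rep q = y then
      cnj (phase \<theta> p) / of_real (sqrt (real (rho V B p))) * HN_entry p q * (phase \<theta> q / of_real (sqrt (real (rho V B q)))) else 0) else 0)"
    by (intro sum.cong refl) (auto simp: JN_def intro!: sum.cong)
  also have "\<dots> = (\<Sum>p\<in>cls x. \<Sum>q\<in>cls y. cnj (phase \<theta> p) / of_real (sqrt (real (rho V B p))) * HN_entry p q
      * (phase \<theta> q / of_real (sqrt (real (rho V B q)))))"
    unfolding sum_VN_class_restrict[OF x] sum_VN_class_restrict[OF y] ..
  also have "\<dots> = (\<Sum>p\<in>cls x. \<Sum>q\<in>cls y. (if p = q then of_real (real (Defs.degree EN p) + Q x / real (rho V B x)) else 0)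
      - of_nat (mult_EN p q) * (cnj (phase \<theta> p) * phase \<theta> q))"
  proof (intro sum.cong refl)
    fix p q assume p: "p \<in> cls x" and q: "q \<in> cls y"
    have pq: "rho V B p = rho V B x" "rho V B q = rho V B y" using rp p q by auto
    have "Q p = Q x" using p VN_subset by (intro Q_cong) (auto simp: cls_def)
    define s t where "s = complex_of_real (sqrt (real (rho V B x)))" and "t = complex_of_real (sqrt (real (rho V B y)))"
    have st: "s \<noteq> 0" "t \<noteq> 0" "s * s = of_nat (rho V B x)" using rx ry
      by (auto simp: s_def t_def simp flip: of_real_mult)
    show "cnj (phase \<theta> p) / of_real (sqrt (real (rho V B p))) * HN_entry p q * (phase \<theta> q / of_real (sqrt (real (rho V B q))))
      = (if p = q then of_real (real (Defs.degree EN p) + Q x / real (rho V B x)) else 0)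
      - of_nat (mult_EN p q) * (cnj (phase \<theta> p) * phase \<theta> q)"
    proof (cases "p = q")
      case True
      then have ts: "t = s" using pq by (simp add: s_def t_def)
      have HN: "HN_entry p q = of_nat (rho V B x) * of_nat (Defs.degree EN p) + of_real (Q x) - of_nat (rho V B x) * of_nat (mult_EN p q)"
        using True pq \<open>Q p = Q x\<close> ts by (simp add: HN_entry_def s_def t_def)
      have "cnj (phase \<theta> p) / s * HN_entry p q * (phase \<theta> q / t) = (cnj (phase \<theta> p) * phase \<theta> q) * HN_entry p q / (s * s)"
        using st by (simp add: ts)
      also have "\<dots> = (cnj (phase \<theta> p) * phase \<theta> q) * (of_nat (Defs.degree EN p) + of_real (Q x) / of_nat (rho V B x) - of_nat (mult_EN p q))"
        unfolding HN st(3) using rx by (simp add: field_simps)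
      finally show ?thesis using True pq
        by (simp add: s_def t_def)
    next
      case False
      then show ?thesis using pq st by (simp add: HN_entry_def flip: s_def t_def)
    qed
  qed
  also have "\<dots> = (\<Sum>p\<in>cls x. \<Sum>q\<in>cls y. if p = q then of_real (real (Defs.degree EN p) + Q x / real (rho V B x)) else 0)
     - (\<Sum>p\<in>cls x. \<Sum>q\<in>cls y. of_nat (mult_EN p q) * (cnj (phase \<theta> p) * phase \<theta> q))"
    by (simp add: sum_subtractf)
  also have "(\<Sum>p\<in>cls x. \<Sum>q\<in>cls y. if p = q then complex_of_real (real (Defs.degree EN p) + Q x / real (rho V B x)) else 0)
    = (if x = y then of_real (real (Defs.degree E x) + Q x) else 0)"
  proof (cases "x = y")
    case True
    have "(\<Sum>p\<in>cls x. \<Sum>q\<in>cls y. if p = q then complex_of_real (real (Defs.degree EN p) + Q x / real (rho V B x)) else 0)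
      = of_real (\<Sum>p\<in>cls x. real (Defs.degree EN p) + Q x / real (rho V B x))"
      unfolding True of_real_sum using finite_cls by (intro sum.cong refl) simp
    also have "(\<Sum>p\<in>cls x. real (Defs.degree EN p) + Q x / real (rho V B x)) = real (Defs.degree E x) + Q x"
      using sum_degree_class[OF xV] rx by (simp add: sum.distrib card_cls cls_def[symmetric] flip: of_nat_sum)
    finally show ?thesis using True by simp
  next
    case False
    then have "p \<noteq> q" if "p \<in> cls x" "q \<in> cls y" for p q
      using that x y cell_rep_fund by (auto simp: cls_def)
    then have "(\<Sum>p\<in>cls x. \<Sum>q\<in>cls y. if p = q then complex_of_real (real (Defs.degree EN p) + Q x / real (rho V B x)) else 0)
      = (\<Sum>p\<in>cls x. \<Sum>q\<in>cls y. 0)" by (intro sum.cong refl) auto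
    then show ?thesis using False by simp
  qed
  finally show ?thesis by (simp add: HF_entry_def)
qed

lemma
  assumes n: "0 < n" "n \<le> nu"
  shows neumann_le_floquet: "eigval HN n \<le> eigval (HF \<theta>) n"
    and floquet_le_neumann: "eigval (HF \<theta>) n \<le> eigval HN (n + nuN - nu)"
proof -
  let ?J = "\<lambda>a i. JN \<theta> (v (Suc a)) (v (Suc i))"
  have iso: "(\<Sum>a<nuN. cnj (?J a i) * ?J a j) = (if i = j then 1 else 0)" if "i < nu" "j < nu" for i j
    using that nu_le_nuN
    by (subst sum_VN[of "\<lambda>p. cnj (JN \<theta> p (v (Suc i))) * JN \<theta> p (v (Suc j))"])
      (simp add: JN_isometry v_in_fund v_eq_iff)
  have compr: "HF \<theta> $$ (i, j) = (\<Sum>a<nuN. \<Sum>b<nuN. cnj (?J a i) * HN $$ (a, b) * ?J b j)"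
    if ij: "i < nu" "j < nu" for i j
  proof -
    let ?x = "v (Suc i)" and ?y = "v (Suc j)"
    have "(\<Sum>a<nuN. \<Sum>b<nuN. cnj (?J a i) * HN $$ (a, b) * ?J b j)
      = (\<Sum>a<nuN. \<Sum>b<nuN. cnj (JN \<theta> (v (Suc a)) ?x) * HN_entry (v (Suc a)) (v (Suc b)) * JN \<theta> (v (Suc b)) ?y)"
      by (intro sum.cong refl) (simp add: index_HN)
    also have "\<dots> = (\<Sum>a<nuN. \<Sum>q\<in>VN. cnj (JN \<theta> (v (Suc a)) ?x) * HN_entry (v (Suc a)) q * JN \<theta> q ?y)"
      by (intro sum.cong refl) (rule sum_VN)
    also have "\<dots> = (\<Sum>p\<in>VN. \<Sum>q\<in>VN. cnj (JN \<theta> p ?x) * HN_entry p q * JN \<theta> q ?y)"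
      by (rule sum_VN)
    also have "\<dots> = HF_entry \<theta> ?x ?y" using ij by (intro JN_compression v_in_fund)
    finally show ?thesis using ij by (simp add: index_HF)
  qed
  show "eigval HN n \<le> eigval (HF \<theta>) n"
    by (rule interlacing_lower[OF carrier_HN adj_HN carrier_HF adj_HF iso compr n nu_le_nuN])
  show "eigval (HF \<theta>) n \<le> eigval HN (n + nuN - nu)"
    by (rule interlacing_upper[OF carrier_HN adj_HN carrier_HF adj_HF iso compr n nu_le_nuN])
qed

text \<open>The trace grouped by classes: on the class of \<open>x\<close> the weight is constant,
  degrees and loops add up to those of the periodic graph, and the potential occurs
  \<open>rho\<close> times. This is the origin of the numbers \<open>h_n\<close>.\<close>

lemma sum_eigval_HN: "(\<Sum>n=1..nuN. eigval HN n) = (\<Sum>x\<in>fund_verts V. h_number V E Q B x)"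
proof -
  have "(\<Sum>n=1..nuN. eigval HN n) = Re (\<Sum>a<nuN. HN $$ (a, a))"
    by (rule sum_eigval[OF carrier_HN adj_HN])
  also have "(\<Sum>a<nuN. HN $$ (a, a)) = (\<Sum>a<nuN. HN_entry (v (Suc a)) (v (Suc a)))"
    by (intro sum.cong refl) (simp add: index_HN)
  also have "\<dots> = (\<Sum>p\<in>VN. HN_entry p p)" by (rule sum_VN)
  also have "\<dots> = (\<Sum>p\<in>VN. of_real (real (rho V B p) * (real (Defs.degree EN p) - real (mult_EN p p)) + Q p))"
    by (intro sum.cong refl) (simp add: HN_entry_def algebra_simps)
  also have "Re \<dots> = (\<Sum>p\<in>VN. real (rho V B p) * (real (Defs.degree EN p) - real (mult_EN p p)) + Q p)"
    by simp
  also have "\<dots> = (\<Sum>x\<in>fund_verts V. \<Sum>p\<in>cls x. real (rho V B p) * (real (Defs.degree EN p) - real (mult_EN p p)) + Q p)"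
    by (rule sum_VN_classes)
  also have "\<dots> = (\<Sum>x\<in>fund_verts V. h_number V E Q B x)"
  proof (rule sum.cong[OF refl])
    fix x assume x: "x \<in> fund_verts V"
    then have xV: "x \<in> V" by (simp add: fund_verts_iff)
    have "(\<Sum>p\<in>cls x. real (rho V B p) * (real (Defs.degree EN p) - real (mult_EN p p)) + Q p)
      = (\<Sum>p\<in>cls x. real (rho V B x) * (real (Defs.degree EN p) - real (mult_EN p p)) + Q x)"
    proof (intro sum.cong refl)
      fix p assume "p \<in> cls x"
      then have "rho V B p = rho V B x" "Q p = Q x"
        using VN_subset by (auto simp: cls_def intro: rho_cong Q_cong)
      then show "real (rho V B p) * (real (Defs.degree EN p) - real (mult_EN p p)) + Q p
        = real (rho V B x) * (real (Defs.degree EN p) - real (mult_EN p p)) + Q x" by simp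
    qed
    also have "\<dots> = real (rho V B x) * (real (\<Sum>p\<in>cls x. Defs.degree EN p) - real (\<Sum>p\<in>cls x. mult_EN p p))
        + real (rho V B x) * Q x"
      by (simp add: sum.distrib sum_distrib_left[symmetric] sum_subtractf card_cls)
    also have "\<dots> = h_number V E Q B x"
      unfolding sum_mult_EN_loops[OF x] using sum_degree_class[OF xV]
      by (simp add: h_number_def cls_def algebra_simps)
    finally show "(\<Sum>p\<in>cls x. real (rho V B p) * (real (Defs.degree EN p) - real (mult_EN p p)) + Q p)
      = h_number V E Q B x" .
  qed
  finally show ?thesis .
qed

text \<open>The adjacency part is dominated entrywise by edge numbers, and
  \<open>2 |z_i| |z_j| \<le> |z_i|^2 + |z_j|^2\<close> turns their row sums, which are degrees, into
  a diagonal form. One degree comes from the diagonal of the Laplacian and one from this estimate: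
  hence the 2 in front of \<open>max_degree\<close>.\<close>

lemma floquet_le_potential:
  assumes n: "0 < n" "n \<le> nu"
  shows "eigval (HF \<theta>) n \<le> ordered_potential V Q v n + 2 * real (max_degree V E)"
proof -
  let ?K = "real (max_degree V E)"
  define A where "A = mat nu nu (\<lambda>(i, j). if i = j then complex_of_real (Q (v (Suc i)) + 2 * ?K) else 0)"
  have A: "A \<in> carrier_mat nu nu" by (simp add: A_def)
  have adjA: "adj A = A" by (rule eq_matI) (auto simp: A_def)
  have form: "Re (\<Sum>i<nu. \<Sum>j<nu. cnj (z i) * HF \<theta> $$ (i, j) * z j) \<le>
      Re (\<Sum>i<nu. \<Sum>j<nu. cnj (z i) * A $$ (i, j) * z j)" for z :: "nat \<Rightarrow> complex"
  proof -
    \<comment> \<open>The adjacency part at \<open>\<theta> = 0\<close>, where all phases are 1: a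
      symmetric integer matrix that bounds the moduli at every other
      \<open>\<theta>\<close>.\<close>
    define N where "N i j = (\<Sum>p\<in>cls (v (Suc i)). \<Sum>q\<in>cls (v (Suc j)). mult_EN p q)" for i j
    have N_commute: "N i j = N j i" for i j
      unfolding N_def by (subst sum.swap) (simp add: mult_EN_commute)
    have N_sum: "(\<Sum>j<nu. N i j) = Defs.degree E (v (Suc i))" if "i < nu" for i
    proof -
      have "(\<Sum>j<nu. N i j) = (\<Sum>y\<in>fund_verts V. \<Sum>p\<in>cls (v (Suc i)). \<Sum>q\<in>cls y. mult_EN p q)"
        unfolding N_def by (rule sum_fund)
      also have "\<dots> = (\<Sum>p\<in>cls (v (Suc i)). \<Sum>q\<in>VN. mult_EN p q)"
        by (subst sum.swap) (simp add: sum_VN_classes)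
      finally show ?thesis using sum_mult_EN[OF v_in_fund[OF that]] by simp
    qed
    have entry: "Re (cnj (z i) * HF \<theta> $$ (i, j) * z j) \<le>
        (if i = j then (real (Defs.degree E (v (Suc i))) + Q (v (Suc i))) * (cmod (z i))\<^sup>2 else 0)
        + real (N i j) * (((cmod (z i))\<^sup>2 + (cmod (z j))\<^sup>2) / 2)" if ij: "i < nu" "j < nu" for i j
    proof -
      define S where "S = (\<Sum>p\<in>cls (v (Suc i)). \<Sum>q\<in>cls (v (Suc j)).
          of_nat (mult_EN p q) * (cnj (phase \<theta> p) * phase \<theta> q))"
      have "cmod S \<le> real (N i j)"
        unfolding S_def N_def of_nat_sum
        by (intro order.trans[OF norm_sum] sum_mono) (simp add: norm_mult)
      have "Re (cnj (z i) * (- S) * z j) \<le> cmod (cnj (z i) * (- S) * z j)" by (rule complex_Re_le_cmod)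
      also have "\<dots> = cmod S * (cmod (z i) * cmod (z j))" by (simp add: norm_mult)
      also have "\<dots> \<le> real (N i j) * (cmod (z i) * cmod (z j))"
        using \<open>cmod S \<le> real (N i j)\<close> by (intro mult_right_mono) auto
      also have "\<dots> \<le> real (N i j) * (((cmod (z i))\<^sup>2 + (cmod (z j))\<^sup>2) / 2)"
        using sum_squares_bound[of "cmod (z i)" "cmod (z j)"] by (intro mult_left_mono) auto
      finally have S: "Re (cnj (z i) * (- S) * z j) \<le> real (N i j) * (((cmod (z i))\<^sup>2 + (cmod (z j))\<^sup>2) / 2)" .
      define c where "c = real (Defs.degree E (v (Suc i))) + Q (v (Suc i))"
      have "HF \<theta> $$ (i, j) = (if i = j then of_real c else 0) + (- S)"
        using ij v_eq_iff nu_le_nuN by (simp add: index_HF HF_entry_def S_def c_def)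
      then have "cnj (z i) * HF \<theta> $$ (i, j) * z j = cnj (z i) * ((if i = j then of_real c else 0) + (- S)) * z j"
        by (rule arg_cong)
      also have "\<dots> =
          (if i = j then of_real c * (z i * cnj (z i)) else 0) + cnj (z i) * (- S) * z j"
        by (auto simp: algebra_simps)
      also have "Re \<dots> = (if i = j then c * (cmod (z i))\<^sup>2 else 0) + Re (cnj (z i) * (- S) * z j)"
        by (simp flip: complex_norm_square of_real_mult of_real_power)
      finally have eq: "Re (cnj (z i) * HF \<theta> $$ (i, j) * z j) =
          (if i = j then c * (cmod (z i))\<^sup>2 else 0) + Re (cnj (z i) * (- S) * z j)" .
      show ?thesis unfolding eq c_def[symmetric] using S by (rule add_left_mono)
    qed
    have "Re (\<Sum>i<nu. \<Sum>j<nu. cnj (z i) * HF \<theta> $$ (i, j) * z j)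
      \<le> (\<Sum>i<nu. \<Sum>j<nu. (if i = j then (real (Defs.degree E (v (Suc i))) + Q (v (Suc i))) * (cmod (z i))\<^sup>2 else 0)
        + real (N i j) * (((cmod (z i))\<^sup>2 + (cmod (z j))\<^sup>2) / 2))"
      unfolding Re_sum by (intro sum_mono entry) auto
    also have "\<dots> = (\<Sum>i<nu. (real (Defs.degree E (v (Suc i))) + Q (v (Suc i))) * (cmod (z i))\<^sup>2)
        + ((\<Sum>i<nu. \<Sum>j<nu. real (N i j) * (cmod (z i))\<^sup>2) + (\<Sum>i<nu. \<Sum>j<nu. real (N i j) * (cmod (z j))\<^sup>2)) / 2"
      by (simp add: sum.distrib add_divide_distrib sum_divide_distrib distrib_left)
    \<comment> \<open>By the symmetry of \<open>N\<close> the two halves of the estimate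
      agree.\<close>
    also have "(\<Sum>i<nu. \<Sum>j<nu. real (N i j) * (cmod (z j))\<^sup>2) = (\<Sum>i<nu. \<Sum>j<nu. real (N i j) * (cmod (z i))\<^sup>2)"
      by (subst sum.swap) (simp add: N_commute)
    also have "(\<Sum>i<nu. \<Sum>j<nu. real (N i j) * (cmod (z i))\<^sup>2) = (\<Sum>i<nu. real (Defs.degree E (v (Suc i))) * (cmod (z i))\<^sup>2)"
      by (intro sum.cong refl) (simp add: sum_distrib_right[symmetric] N_sum flip: of_nat_sum)
    also have "(\<Sum>i<nu. (real (Defs.degree E (v (Suc i))) + Q (v (Suc i))) * (cmod (z i))\<^sup>2)
        + ((\<Sum>i<nu. real (Defs.degree E (v (Suc i))) * (cmod (z i))\<^sup>2) + (\<Sum>i<nu. real (Defs.degree E (v (Suc i))) * (cmod (z i))\<^sup>2)) / 2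
      = (\<Sum>i<nu. (Q (v (Suc i)) + 2 * real (Defs.degree E (v (Suc i)))) * (cmod (z i))\<^sup>2)"
    proof -
      have half: "(a + a) / 2 = a" for a :: real by simp
      show ?thesis
        unfolding half unfolding sum.distrib[symmetric] by (intro sum.cong refl) (simp add: algebra_simps)
    qed
    also have "\<dots> \<le> (\<Sum>i<nu. (Q (v (Suc i)) + 2 * ?K) * (cmod (z i))\<^sup>2)"
    proof (intro sum_mono mult_right_mono)
      fix i assume "i \<in> {..<nu}"
      then have "v (Suc i) \<in> V" using v_in_fund[of i] by (simp add: fund_verts_iff)
      then show "Q (v (Suc i)) + 2 * real (Defs.degree E (v (Suc i))) \<le> Q (v (Suc i)) + 2 * ?K"
        using degree_le_max by simp
    qed simp
    also have "\<dots> = Re (\<Sum>i<nu. \<Sum>j<nu. cnj (z i) * A $$ (i, j) * z j)"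
    proof -
      have "(\<Sum>j<nu. cnj (z i) * A $$ (i, j) * z j) = of_real ((Q (v (Suc i)) + 2 * ?K) * (cmod (z i))\<^sup>2)" if "i < nu" for i
      proof -
        have "(\<Sum>j<nu. cnj (z i) * A $$ (i, j) * z j)
          = (\<Sum>j<nu. if j = i then of_real (Q (v (Suc i)) + 2 * ?K) * (z i * cnj (z i)) else 0)"
          using that by (intro sum.cong refl) (auto simp: A_def)
        then show ?thesis using that by (simp add: complex_norm_square[symmetric])
      qed
      then show ?thesis by simp
    qed
    finally show ?thesis .
  qed
  have "eigval (HF \<theta>) n \<le> eigval A n"
    by (rule eigval_le_of_form_le_same_dim[OF A adjA carrier_HF adj_HF form n])
  also have "\<dots> = sort (map (\<lambda>i. Q (v (Suc i)) + 2 * ?K) [0..<nu]) ! (n - 1)"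
    unfolding A_def by (rule eigval_diagonal[OF n])
  \<comment> \<open>A constant shift preserves the order, so it can be pulled out of the sorted
    list; matrix indices start at 0, vertex numbers at 1.\<close>
  also have "sort (map (\<lambda>i. Q (v (Suc i)) + 2 * ?K) [0..<nu])
    = map (\<lambda>q. q + 2 * ?K) (sort (map (\<lambda>j. Q (v j)) [1..<nu + 1]))"
  proof (rule properties_for_sort)
    have "[1..<nu + 1] = map Suc [0..<nu]" by (simp add: map_Suc_upt)
    then show "mset (map (\<lambda>q. q + 2 * ?K) (sort (map (\<lambda>j. Q (v j)) [1..<nu + 1])))
      = mset (map (\<lambda>i. Q (v (Suc i)) + 2 * ?K) [0..<nu])"
      by (simp add: multiset.map_comp comp_def del: upt_Suc)
    show "sorted (map (\<lambda>q. q + 2 * ?K) (sort (map (\<lambda>j. Q (v j)) [1..<nu + 1])))"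
      by (simp add: sorted_map)
  qed
  also have "\<dots> ! (n - 1) = ordered_potential V Q v n + 2 * ?K"
    unfolding ordered_potential_def by (subst nth_map) (use n in auto)
  finally show ?thesis .
qed

text \<open>A separate enumeration, because in general the inner vertices need neither come first in
  \<open>v\<close> nor lie in the fundamental cell.\<close>

definition inner_enum :: "nat \<Rightarrow> real^'d" where
  "inner_enum = (SOME t. bij_betw t {..<nuD} (inner_verts V E B))"

lemma finite_inner_verts: "finite (inner_verts V E B)"
  by (rule finite_subset[OF inner_verts_subset finite_VN])

lemma bij_inner_enum: "bij_betw inner_enum {..<nuD} (inner_verts V E B)"
proof -
  have "\<exists>t. bij_betw t {..<nuD} (inner_verts V E B)"
    using ex_bij_betw_nat_finite[OF finite_inner_verts] by (simp add: lessThan_atLeast0)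
  then show ?thesis unfolding inner_enum_def by (rule someI_ex)
qed

text \<open>The Dirichlet operator: up to a gauge transformation it is the common compression of all
  Floquet matrices to the classes that contain an inner vertex.\<close>

definition HD :: "complex mat" where
  "HD = mat nuD nuD (\<lambda>(a, b). (if a = b then of_real (real (Defs.degree E (inner_enum a)) + Q (inner_enum a)) else 0)
     - of_nat (mult_EN (inner_enum a) (inner_enum b)))"

lemma carrier_HD: "HD \<in> carrier_mat nuD nuD"
  by (simp add: HD_def)

lemma adj_HD: "adj HD = HD"
  by (rule eq_matI) (auto simp: HD_def mult_EN_commute)

text \<open>Among all pairs of copies only the two inner vertices themselves can be joined in the
  finite graph, since the other copies are isolated. The double sum collapses to one term, and
  \<open>\<theta>\<close> survives only in one phase per vertex.\<close>

lemma HF_entry_inner: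
  assumes x: "x \<in> inner_verts V E B" and y: "y \<in> inner_verts V E B"
  shows "HF_entry \<theta> (cell_rep x) (cell_rep y) =
    (if x = y then of_real (real (Defs.degree E x) + Q x) else 0)
      - of_nat (mult_EN x y) * (cnj (phase \<theta> x) * phase \<theta> y)"
proof -
  have V: "x \<in> V" "y \<in> V" "x \<in> VN" "y \<in> VN" using x y inner_verts_subset VN_subset by auto
  have inj: "cell_rep x = cell_rep y \<longleftrightarrow> x = y"
    using inj_on_cell_rep_inner x y by (auto simp: inj_on_def)
  have idem: "cell_rep (cell_rep z) = cell_rep z" for z :: "real^'d" by (simp add: cell_rep_id)
  have unique: "mult_EN p q = 0" if "p \<in> cls x" "q \<in> cls y" "\<not> (p = x \<and> q = y)" for p q
  proof (rule ccontr)
    assume "mult_EN p q \<noteq> 0"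
    then have "incident EN p \<noteq> {}" "incident EN q \<noteq> {}"
      using mult_EN_eq_0 mult_EN_commute by metis+
    then show False using that inner_vert_unique[OF x, of p] inner_vert_unique[OF y, of q]
      by (auto simp: cls_def)
  qed
  have "(\<Sum>p\<in>cls x. \<Sum>q\<in>cls y. of_nat (mult_EN p q) * (cnj (phase \<theta> p) * phase \<theta> q))
    = (\<Sum>p\<in>cls x. \<Sum>q\<in>cls y. if q = y then (if p = x then of_nat (mult_EN x y) * (cnj (phase \<theta> x) * phase \<theta> y) else 0) else 0)"
    by (intro sum.cong refl) (use unique in force)
  also have "\<dots> = of_nat (mult_EN x y) * (cnj (phase \<theta> x) * phase \<theta> y)"
    using finite_cls V by (simp add: cls_def)
  finally have S: "(\<Sum>p\<in>cls x. \<Sum>q\<in>cls y. of_nat (mult_EN p q) * (cnj (phase \<theta> p) * phase \<theta> q))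
    = of_nat (mult_EN x y) * (cnj (phase \<theta> x) * phase \<theta> y)" .
  have cls: "cls (cell_rep z) = cls z" for z by (simp add: cls_def idem)
  have "Defs.degree E (cell_rep x) = Defs.degree E x" "Q (cell_rep x) = Q x"
    using V by (auto intro!: degree_cong Q_cong simp: idem)
  then show ?thesis unfolding HF_entry_def cls S inj by auto
qed

text \<open>The gauge transformation, combined with the embedding of the classes that contain an
  inner vertex; the conjugate is chosen to cancel the phases in
  \<open>HF_entry_inner\<close>.\<close>

definition JD :: "real^'d \<Rightarrow> real^'d \<Rightarrow> real^'d \<Rightarrow> complex" where
  "JD \<theta> x z = (if x = cell_rep z then cnj (phase \<theta> z) else 0)"

text \<open>The compression of \<open>HF \<theta>\<close> by \<open>JD\<close> is the same matrix
  for all \<open>\<theta>\<close>, so interlacing bounds whole bands and not only single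
  eigenvalues.\<close>

lemma
  assumes n: "0 < n" "n \<le> nuD"
  shows floquet_le_dirichlet: "eigval (HF \<theta>) n \<le> eigval HD n"
    and dirichlet_le_floquet: "eigval HD n \<le> eigval (HF \<theta>) (n + nu - nuD)"
proof -
  let ?t = inner_enum
  let ?J = "\<lambda>i a. JD \<theta> (v (Suc i)) (?t a)"
  have t: "?t a \<in> inner_verts V E B" if "a < nuD" for a
    using bij_inner_enum that by (auto dest: bij_betwE)
  have t_fund: "cell_rep (?t a) \<in> fund_verts V" if "a < nuD" for a
    using t[OF that] inner_verts_subset VN_subset cell_rep_in_fund by blast
  have t_inj: "?t a = ?t b \<longleftrightarrow> a = b" if "a < nuD" "b < nuD" for a b
    using bij_betw_imp_inj_on[OF bij_inner_enum] that by (auto simp: inj_on_def)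
  have tc_inj: "cell_rep (?t a) = cell_rep (?t b) \<longleftrightarrow> a = b" if "a < nuD" "b < nuD" for a b
    using inj_on_cell_rep_inner t t_inj that by (metis inj_on_def)
  have iso: "(\<Sum>i<nu. cnj (?J i a) * ?J i b) = (if a = b then 1 else 0)" if ab: "a < nuD" "b < nuD" for a b
  proof -
    have "(\<Sum>i<nu. cnj (?J i a) * ?J i b) = (\<Sum>x\<in>fund_verts V. cnj (JD \<theta> x (?t a)) * JD \<theta> x (?t b))"
      by (rule sum_fund)
    also have "\<dots> = (\<Sum>x\<in>fund_verts V. if x = cell_rep (?t a) then (if a = b then 1 else 0) else 0)"
      by (intro sum.cong refl) (use tc_inj ab in \<open>auto simp: JD_def\<close>)
    finally show ?thesis using t_fund ab finite_fund_verts by simp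
  qed
  have compr: "HD $$ (a, b) = (\<Sum>i<nu. \<Sum>j<nu. cnj (?J i a) * HF \<theta> $$ (i, j) * ?J j b)"
    if ab: "a < nuD" "b < nuD" for a b
  proof -
    have "(\<Sum>i<nu. \<Sum>j<nu. cnj (?J i a) * HF \<theta> $$ (i, j) * ?J j b)
      = (\<Sum>i<nu. \<Sum>j<nu. cnj (JD \<theta> (v (Suc i)) (?t a)) * HF_entry \<theta> (v (Suc i)) (v (Suc j)) * JD \<theta> (v (Suc j)) (?t b))"
      by (intro sum.cong refl) (simp add: index_HF)
    also have "\<dots> = (\<Sum>i<nu. \<Sum>y\<in>fund_verts V. cnj (JD \<theta> (v (Suc i)) (?t a)) * HF_entry \<theta> (v (Suc i)) y * JD \<theta> y (?t b))"
      by (intro sum.cong refl) (rule sum_fund)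
    also have "\<dots> = (\<Sum>x\<in>fund_verts V. \<Sum>y\<in>fund_verts V. cnj (JD \<theta> x (?t a)) * HF_entry \<theta> x y * JD \<theta> y (?t b))"
      by (rule sum_fund)
    also have "\<dots> = (\<Sum>x\<in>fund_verts V. \<Sum>y\<in>fund_verts V. if y = cell_rep (?t b) then (if x = cell_rep (?t a) then
        phase \<theta> (?t a) * HF_entry \<theta> (cell_rep (?t a)) (cell_rep (?t b)) * cnj (phase \<theta> (?t b)) else 0) else 0)"
      by (intro sum.cong refl) (auto simp: JD_def)
    also have "\<dots> = phase \<theta> (?t a) * HF_entry \<theta> (cell_rep (?t a)) (cell_rep (?t b)) * cnj (phase \<theta> (?t b))"
      using t_fund ab finite_fund_verts by simp
    \<comment> \<open>The phase of each vertex meets its conjugate; in the adjacency term this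
      happens once for either vertex.\<close>
    also have "\<dots> = (if a = b then of_real (real (Defs.degree E (?t a)) + Q (?t a)) * (phase \<theta> (?t a) * cnj (phase \<theta> (?t a))) else 0)
      - of_nat (mult_EN (?t a) (?t b)) * (phase \<theta> (?t a) * cnj (phase \<theta> (?t a))) * (phase \<theta> (?t b) * cnj (phase \<theta> (?t b)))"
      unfolding HF_entry_inner[OF t[OF ab(1)] t[OF ab(2)]] t_inj[OF ab]
      by (simp only: right_diff_distrib left_diff_distrib if_distrib[of "\<lambda>z. _ * z"] if_distrib[of "\<lambda>z. z * _"]
          mult_zero_left mult_zero_right mult_ac cong: if_cong)
    also have "\<dots> = HD $$ (a, b)" using ab by (simp add: HD_def)
    finally show ?thesis by simp
  qed
  have le: "nuD \<le> nu" using card_inner_verts_less by simp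
  show "eigval (HF \<theta>) n \<le> eigval HD n"
    by (rule interlacing_lower[OF carrier_HF adj_HF carrier_HD adj_HD iso compr n le])
  show "eigval HD n \<le> eigval (HF \<theta>) (n + nu - nuD)"
    by (rule interlacing_upper[OF carrier_HF adj_HF carrier_HD adj_HD iso compr n le])
qed

text \<open>An inner vertex in the fundamental cell is the only member of its class, so
  \<open>rho\<close> is 1 and the diagonal of \<open>HD\<close> consists of numbers
  \<open>h_n\<close>. This allows the traces of \<open>HD\<close> and \<open>HN\<close> to be
  subtracted term by term.\<close>

lemma sum_eigval_HD:
  assumes sub: "inner_verts V E B \<subseteq> fund_verts V"
  shows "(\<Sum>n=1..nuD. eigval HD n) = (\<Sum>x\<in>inner_verts V E B. h_number V E Q B x)"
proof -
  have "(\<Sum>n=1..nuD. eigval HD n) = Re (\<Sum>a<nuD. HD $$ (a, a))"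
    by (rule sum_eigval[OF carrier_HD adj_HD])
  also have "\<dots> = (\<Sum>a<nuD. real (Defs.degree E (inner_enum a)) + Q (inner_enum a) - real (mult_EN (inner_enum a) (inner_enum a)))"
    by (simp add: HD_def)
  also have "\<dots> = (\<Sum>x\<in>inner_verts V E B. real (Defs.degree E x) + Q x - real (mult_EN x x))"
    using sum.reindex_bij_betw[OF bij_inner_enum, of "\<lambda>x. real (Defs.degree E x) + Q x - real (mult_EN x x)"] by simp
  also have "\<dots> = (\<Sum>x\<in>inner_verts V E B. h_number V E Q B x)"
  proof (rule sum.cong[OF refl])
    fix x assume x: "x \<in> inner_verts V E B"
    then have xF: "x \<in> fund_verts V" using sub by auto
    have cls: "cls x = {x}" unfolding cls_def by (rule class_of_inner_fund_vert[OF x xF])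
    then have "rho V B x = 1" "loop_number E x = mult_EN x x"
      using card_cls[of x] sum_mult_EN_loops[OF xF] by auto
    then show "real (Defs.degree E x) + Q x - real (mult_EN x x) = h_number V E Q B x"
      by (simp add: h_number_def)
  qed
  finally show ?thesis .
qed

section \<open>Summation over the bands\<close>

lemma band_length_le:
  assumes "\<And>\<theta>. lo \<le> eigval (HF \<theta>) n" "\<And>\<theta>. eigval (HF \<theta>) n \<le> up"
  shows "band_length V E Q v n \<le> up - lo"
proof -
  have "Sup (band V E Q v n) \<le> up" unfolding band_def using assms(2) by (intro cSUP_least) auto
  moreover have "lo \<le> Inf (band V E Q v n)" unfolding band_def using assms(1) by (intro cINF_greatest) auto
  ultimately show ?thesis by (simp add: band_length_def)
qed

theorem band_sum_le_neumann:
  "(\<Sum>n=1..nu. band_length V E Q v n)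
    \<le> (\<Sum>n=1..nu-nuD. eigval HN (nuN - (nu - nuD) + n) - eigval HN n)"
proof -
  \<comment> \<open>The number of bands for which the Dirichlet matrix gives no bound on a given
    side.\<close>
  define k where "k = nu - nuD"
  have k: "nuD + k = nu" "k \<le> nu" "k \<le> nuN" "nuD \<le> nu"
    using card_inner_verts_less nu_le_nuN by (auto simp: k_def)
  \<comment> \<open>For \<open>n > k\<close>, interlacing places \<open>eigval HD (n - k)\<close>
    below the Floquet eigenvalue with index \<open>n - k + nu - nuD = n\<close>. Each Dirichlet
    eigenvalue thus occurs once in \<open>lo\<close>, at the last bands, and once in
    \<open>up\<close>, at the first ones.\<close>
  define lo where "lo n = (if n \<le> k then eigval HN n else eigval HD (n - k))" for n
  define up where "up n = (if n \<le> nuD then eigval HD n else eigval HN (n + nuN - nu))" for n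
  have "band_length V E Q v n \<le> up n - lo n" if "n \<in> {1..nu}" for n
  proof (rule band_length_le)
    fix \<theta>
    have "eigval HD (n - k) \<le> eigval (HF \<theta>) (n - k + nu - nuD)" if "k < n"
      by (rule dirichlet_le_floquet) (use that \<open>n \<in> _\<close> k in auto)
    moreover have "n - k + nu - nuD = n" if "k < n" using that k by simp
    ultimately show "lo n \<le> eigval (HF \<theta>) n"
      using that neumann_le_floquet[of n \<theta>] by (auto simp: lo_def)
    show "eigval (HF \<theta>) n \<le> up n"
      using that floquet_le_dirichlet[of n \<theta>] floquet_le_neumann[of n \<theta>] by (auto simp: up_def)
  qed
  then have "(\<Sum>n=1..nu. band_length V E Q v n) \<le> (\<Sum>n=1..nu. up n) - (\<Sum>n=1..nu. lo n)"
    unfolding sum_subtractf[symmetric] by (rule sum_mono)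
  also have "(\<Sum>n=1..nu. up n) = (\<Sum>n=1..nuD. eigval HD n) + (\<Sum>n=1..k. eigval HN (nuN - k + n))"
  proof -
    have "(\<Sum>n=1..nu. up n) = (\<Sum>n=1..nuD. up n) + (\<Sum>n=nuD+1..nuD+k. up n)"
      unfolding k(1)[symmetric] by (rule sum.ub_add_nat) simp
    \<comment> \<open>For \<open>n = nuD + j\<close> the Neumann index \<open>n + nuN - nu\<close>
      equals \<open>nuN - k + j\<close>.\<close>
    also have "(\<Sum>n=nuD+1..nuD+k. up n) = (\<Sum>n=1..k. eigval HN (nuN - k + n))"
      by (rule sum.reindex_bij_witness[of _ "\<lambda>n. n + nuD" "\<lambda>n. n - nuD"])
        (use k nu_le_nuN in \<open>auto simp: up_def intro!: arg_cong[of _ _ "eigval HN"]\<close>)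
    finally show ?thesis by (simp add: up_def)
  qed
  also have "(\<Sum>n=1..nu. lo n) = (\<Sum>n=1..k. eigval HN n) + (\<Sum>n=1..nuD. eigval HD n)"
  proof -
    have "(\<Sum>n=1..nu. lo n) = (\<Sum>n=1..k. lo n) + (\<Sum>n=k+1..k+nuD. lo n)"
      using k(1) sum.ub_add_nat[of 1 k lo nuD] by (simp add: add.commute)
    also have "(\<Sum>n=k+1..k+nuD. lo n) = (\<Sum>n=1..nuD. eigval HD n)"
      by (rule sum.reindex_bij_witness[of _ "\<lambda>n. n + k" "\<lambda>n. n - k"]) (auto simp: lo_def)
    finally show ?thesis by (simp add: lo_def)
  qed
  finally show ?thesis by (simp add: k_def sum_subtractf)
qed

text \<open>Here all lower bounds are Neumann eigenvalues, so their sum is a trace minus the top of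
  the spectrum. The Dirichlet upper bounds form a full trace as well, and the numbers
  \<open>h_n\<close> of the inner vertices occur in both traces and cancel.\<close>

theorem band_sum_le_potential:
  assumes inner: "v ` {1..nuD} = inner_verts V E B"
  shows "(\<Sum>n=1..nu. band_length V E Q v n)
    \<le> (\<Sum>n=nuD+1..nu. ordered_potential V Q v n + 2 * real (max_degree V E) - h_number V E Q B (v n))
      + (\<Sum>n=nu+1..nuN. eigval HN n)"
proof -
  have le: "nuD \<le> nu" using card_inner_verts_less by simp
  have vF: "v ` {1..nu} = fund_verts V" and inj: "inj_on v {1..nuN}"
    using numbering by (auto simp: vertex_numbering_def bij_betw_def)
  \<comment> \<open>The first \<open>nuD\<close> numbers are among the first \<open>nu\<close>,
    which belong to the fundamental cell.\<close>
  have sub: "inner_verts V E B \<subseteq> fund_verts V"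
  proof -
    have "v ` {1..nuD} \<subseteq> v ` {1..nu}" using le by (intro image_mono) auto
    then show ?thesis by (simp only: inner vF)
  qed
  have split: "(\<Sum>n=1..a. g n) = (\<Sum>n=1..b. g n) + (\<Sum>n=b+1..a. g n)" if "b \<le> a" for a b and g :: "nat \<Rightarrow> real"
    using sum.ub_add_nat[of 1 b g "a - b"] that by simp
  have h: "(\<Sum>x\<in>v ` {1..m}. h_number V E Q B x) = (\<Sum>n=1..m. h_number V E Q B (v n))" if "m \<le> nuN" for m
    by (rule sum.reindex_cong[OF _ refl refl]) (rule inj_on_subset[OF inj], use that in auto)
  define up where "up n = (if n \<le> nuD then eigval HD n else ordered_potential V Q v n + 2 * real (max_degree V E))" for n
  have "band_length V E Q v n \<le> up n - eigval HN n" if "n \<in> {1..nu}" for n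
  proof (rule band_length_le)
    fix \<theta>
    show "eigval HN n \<le> eigval (HF \<theta>) n" using that neumann_le_floquet[of n \<theta>] by auto
    show "eigval (HF \<theta>) n \<le> up n"
      using that floquet_le_dirichlet[of n \<theta>] floquet_le_potential[of n \<theta>] by (auto simp: up_def)
  qed
  then have "(\<Sum>n=1..nu. band_length V E Q v n) \<le> (\<Sum>n=1..nu. up n) - (\<Sum>n=1..nu. eigval HN n)"
    unfolding sum_subtractf[symmetric] by (rule sum_mono)
  also have "(\<Sum>n=1..nu. up n) = (\<Sum>n=1..nuD. h_number V E Q B (v n))
      + (\<Sum>n=nuD+1..nu. ordered_potential V Q v n + 2 * real (max_degree V E))"
    using split[OF le, of up] sum_eigval_HD[OF sub] h[OF order.trans[OF le nu_le_nuN], unfolded inner]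
    by (simp add: up_def)
  also have "(\<Sum>n=1..nu. eigval HN n) = (\<Sum>n=1..nu. h_number V E Q B (v n)) - (\<Sum>n=nu+1..nuN. eigval HN n)"
    using split[OF nu_le_nuN, of "eigval HN"] sum_eigval_HN h[OF nu_le_nuN, unfolded vF] by simp
  also have "(\<Sum>n=1..nu. h_number V E Q B (v n)) = (\<Sum>n=1..nuD. h_number V E Q B (v n)) + (\<Sum>n=nuD+1..nu. h_number V E Q B (v n))"
    by (rule split[OF le])
  finally show ?thesis by (simp add: sum_subtractf)
qed

end

section \<open>The cubic lattice\<close>

text \<open>Each edge is stored in its positive direction; there are no parallel edges, so the label
  is always 0.\<close>

definition cubic_edges :: "'d::finite edge set" where
  "cubic_edges = {(Upair x (x + axis s 1), 0) | x s. x \<in> int_lattice}"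

text \<open>From each pair of bridges at the origin, the one that leaves in the positive
  direction.\<close>

definition cubic_bridges :: "'d::finite edge set" where
  "cubic_bridges = range (\<lambda>s. (Upair 0 (axis s 1), 0))"

lemma axis_in_int_lattice [simp]: "axis s 1 \<in> int_lattice"
  by (simp add: int_lattice_def axis_def)

text \<open>The coordinates are changed one at a time. Paths along an axis are built in both
  directions, so that a decrease is the reverse of an increase from the end point.\<close>

lemma int_lattice_connected:
  fixes x y :: "real^'d"
  assumes x: "x \<in> int_lattice" and y: "y \<in> int_lattice"
  shows "(x, y) \<in> {(x, y). \<exists>e\<in>cubic_edges. fst e = Upair x y}\<^sup>*"
proof -
  define R where "R = {(x :: real^'d, y). \<exists>e\<in>cubic_edges. fst e = Upair x y}"
  have step: "(z, z + axis s 1) \<in> R" "(z + axis s 1, z) \<in> R" if "z \<in> int_lattice" for z s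
    using that by (auto simp: R_def cubic_edges_def)
  have up: "(z, z + real k *\<^sub>R axis s 1) \<in> R\<^sup>*" "(z + real k *\<^sub>R axis s 1, z) \<in> R\<^sup>*"
    if z: "z \<in> int_lattice" for z s k
  proof (induction k)
    case (Suc k)
    have "z + real k *\<^sub>R axis s 1 \<in> int_lattice"
      using z by (auto simp: int_lattice_def axis_def)
    from step[OF this, of s] Suc
    show "(z, z + real (Suc k) *\<^sub>R axis s 1) \<in> R\<^sup>*" "(z + real (Suc k) *\<^sub>R axis s 1, z) \<in> R\<^sup>*"
      by (auto simp: algebra_simps intro: rtrancl_into_rtrancl converse_rtrancl_into_rtrancl)
  qed auto
  have line: "(z, z + c *\<^sub>R axis s 1) \<in> R\<^sup>*" if z: "z \<in> int_lattice" and c: "c \<in> \<int>" for z c s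
  proof -
    obtain k where k: "c = of_int k" using c by (auto elim: Ints_cases)
    show ?thesis
    proof (cases "k \<ge> 0")
      case True
      then show ?thesis using up(1)[OF z, of "nat k" s] k by simp
    next
      case False
      have "z + c *\<^sub>R axis s 1 \<in> int_lattice"
        using z c by (auto simp: int_lattice_def axis_def)
      from up(2)[OF this, of "nat (- k)" s] show ?thesis
        using False k by (simp add: algebra_simps)
    qed
  qed
  have path: "(x, x + (\<Sum>s\<in>S. (y $ s - x $ s) *\<^sub>R axis s 1)) \<in> R\<^sup>*" if "finite S" for S
    using that
  proof (induction S)
    case (insert s S)
    have "x + (\<Sum>s\<in>S. (y $ s - x $ s) *\<^sub>R axis s 1) \<in> int_lattice"
      using x y by (auto simp: int_lattice_def axis_def intro!: Ints_sum)
    from line[OF this, of "y $ s - x $ s" s] insert x y show ?case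
      by (auto simp: int_lattice_def algebra_simps intro: rtrancl_trans)
  qed simp
  have "x + (\<Sum>s\<in>UNIV. (y $ s - x $ s) *\<^sub>R axis s 1) = y"
    using basis_expansion[of "y - x"] by (simp add: scalar_mult_eq_scaleR)
  with path[OF finite_class.finite_UNIV] show ?thesis by (simp add: R_def)
qed

lemma cubic_incident:
  "incident cubic_edges v \<subseteq> range (\<lambda>s. (Upair v (v + axis s 1), 0)) \<union> range (\<lambda>s. (Upair (v - axis s 1) v, 0))"
  by (auto simp: incident_def cubic_edges_def)

lemma periodic_graph_cubic: "periodic_graph (int_lattice :: (real^'d) set) cubic_edges"
proof
  show "(int_lattice :: (real^'d) set) \<noteq> {}" using int_lattice_0 by blast
  show "set_uprod (fst e) \<subseteq> int_lattice" if "e \<in> cubic_edges" for e :: "'d edge"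
    using that by (auto simp: cubic_edges_def int_lattice_add)
  show "(u, v) \<in> {(x, y). \<exists>e\<in>cubic_edges. fst e = Upair x y}\<^sup>*"
    if "u \<in> int_lattice" "v \<in> int_lattice" for u v :: "real^'d"
    by (rule int_lattice_connected[OF that])
  show "finite (int_lattice \<inter> S)" if S: "bounded S" for S :: "(real^'d) set"
  proof -
    obtain b where b: "\<And>x. x \<in> S \<Longrightarrow> norm x \<le> b" using S unfolding bounded_iff by blast
    \<comment> \<open>Each coordinate is one of finitely many bounded integers, so a finite product
      contains all these vectors.\<close>
    have "int_lattice \<inter> S \<subseteq> vec_lambda ` (\<Pi>\<^sub>E s\<in>UNIV. {r \<in> \<int>. \<bar>r\<bar> \<le> b})"
    proof
      fix x assume x: "x \<in> int_lattice \<inter> S"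
      then have "($) x \<in> (\<Pi>\<^sub>E s\<in>UNIV. {r \<in> \<int>. \<bar>r\<bar> \<le> b})"
        using b[of x] component_le_norm_cart[of x] by (auto simp: int_lattice_def intro: order.trans)
      then show "x \<in> vec_lambda ` (\<Pi>\<^sub>E s\<in>UNIV. {r \<in> \<int>. \<bar>r\<bar> \<le> b})"
        by (rule rev_image_eqI) simp
    qed
    moreover have "finite (vec_lambda ` (\<Pi>\<^sub>E s\<in>(UNIV :: 'd set). {r \<in> \<int>. \<bar>r\<bar> \<le> b}))"
      by (intro finite_imageI finite_PiE finite_abs_int_segment) simp
    ultimately show ?thesis by (rule finite_subset)
  qed
  show "finite (incident cubic_edges v)" for v :: "real^'d"
    by (rule finite_subset[OF cubic_incident]) auto
  fix m :: "real^'d" assume m: "m \<in> int_lattice"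
  show "(\<lambda>x. x + m) ` int_lattice = int_lattice"
  proof (intro equalityI subsetI)
    fix x :: "real^'d" assume "x \<in> int_lattice"
    then have "x - m \<in> int_lattice" using m by (simp add: int_lattice_diff)
    then show "x \<in> (\<lambda>x. x + m) ` int_lattice" by (rule rev_image_eqI) simp
  qed (use m int_lattice_add in auto)
  have sub: "shift_edge n ` cubic_edges \<subseteq> cubic_edges" if "n \<in> int_lattice" for n :: "real^'d"
  proof
    fix e assume "e \<in> shift_edge n ` cubic_edges"
    then obtain x s where "x \<in> int_lattice" "e = (Upair (x + n) ((x + n) + axis s 1), 0)"
      by (auto simp: cubic_edges_def add_ac)
    then show "e \<in> cubic_edges" using int_lattice_add[OF _ that] unfolding cubic_edges_def by blast
  qed
  \<comment> \<open>The inclusion for \<open>- m\<close> yields the converse inclusion for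
    \<open>m\<close>.\<close>
  show "shift_edge m ` cubic_edges = cubic_edges"
  proof (intro equalityI subsetI)
    fix e :: "'d edge" assume "e \<in> cubic_edges"
    then have "shift_edge (- m) e \<in> cubic_edges" using sub[of "- m"] m by auto
    then show "e \<in> shift_edge m ` cubic_edges" by (rule rev_image_eqI) simp
  qed (use sub[OF m] in auto)
qed

interpretation cubic: periodic_graph int_lattice cubic_edges
  by (rule periodic_graph_cubic)

lemma cubic_fund_verts: "fund_verts int_lattice = {0 :: real^'d}"
  by (auto simp: cubic.fund_verts_iff floor_vec_lattice)

lemma axis_1_neq_0 [simp]: "axis s (1::real) \<noteq> 0"
  by (simp add: axis_eq_0_iff)

lemma cubic_bridges_char:
  "bridges int_lattice cubic_edges =
    cubic_bridges \<union> range (\<lambda>s. (Upair (- axis s 1) (0 :: real^'d), 0))" (is "_ = ?R")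
proof (intro equalityI subsetI)
  fix e :: "'d edge" assume e: "e \<in> bridges int_lattice cubic_edges"
  then have "e \<in> cubic_edges" by (simp add: bridges_def)
  then obtain x s where x: "x \<in> int_lattice" "e = (Upair x (x + axis s 1), 0)"
    by (auto simp: cubic_edges_def)
  then have "(floor_vec x = 0) \<noteq> (floor_vec (x + axis s 1) = 0)"
    using e cubic.bridge_iff[of e x "x + axis s 1"] by simp
  then have "x = 0 \<or> x + axis s 1 = 0"
    using x int_lattice_add by (auto simp: floor_vec_lattice)
  then show "e \<in> ?R"
    using x by (auto simp: cubic_bridges_def eq_neg_iff_add_eq_0)
next
  fix e :: "'d edge" assume "e \<in> ?R"
  then obtain s where "e = (Upair 0 (0 + axis s 1), 0) \<or> e = (Upair (- axis s 1) (- axis s 1 + axis s 1), 0)"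
    by (auto simp: cubic_bridges_def)
  then obtain x where x: "x \<in> int_lattice" "e = (Upair x (x + axis s 1), 0)" "x = 0 \<or> x = - axis s 1"
    by force
  then have "e \<in> cubic_edges" by (auto simp: cubic_edges_def)
  then show "e \<in> bridges int_lattice cubic_edges"
    using x cubic.bridge_iff[of e x "x + axis s 1"]
    by (auto simp: floor_vec_lattice)
qed

lemma cubic_bridge_choice:
  "bridge_choice int_lattice cubic_edges (cubic_bridges :: 'd::finite edge set)"
  unfolding bridge_choice_def
proof (intro conjI ballI)
  show "cubic_bridges \<subseteq> bridges int_lattice (cubic_edges :: 'd edge set)"
    by (auto simp: cubic_bridges_char)
  fix e :: "'d edge" assume "e \<in> bridges int_lattice cubic_edges"
  then obtain s and n :: "real^'d" where n: "n \<in> int_lattice" and e: "e = (Upair n (n + axis s 1), 0)"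
    by (auto simp: cubic_bridges_char cubic_bridges_def)
       (metis add.left_neutral int_lattice_0, metis ab_left_minus int_lattice_minus axis_in_int_lattice)
  show "\<exists>!e'. e' \<in> cubic_bridges \<and> equivalent_edges e e'"
  proof (rule ex1I)
    show "(Upair 0 (axis s 1), 0) \<in> cubic_bridges \<and> equivalent_edges e (Upair 0 (axis s 1), 0)"
      using n by (auto simp: cubic_bridges_def equivalent_edges_def e intro!: bexI[of _ "- n"])
    fix e' assume e': "e' \<in> cubic_bridges \<and> equivalent_edges e e'"
    then obtain t where t1: "e' = (Upair 0 (axis t 1), 0)" by (auto simp: cubic_bridges_def)
    obtain m where t2: "e' = shift_edge m e" using e' by (auto simp: equivalent_edges_def)
    note t = t1 t2
    \<comment> \<open>The translated edge agrees with a chosen one either end by end or with its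
      ends exchanged; the latter would give \<open>axis t 1 + axis s 1 = 0\<close>.\<close>
    then have "n + m = 0 \<and> n + axis s 1 + m = axis t 1 \<or> n + m = axis t 1 \<and> n + axis s 1 + m = 0"
      by (auto simp: e)
    moreover have "n + axis s 1 + m = (n + m) + axis s 1" by simp
    ultimately have "axis s (1::real) = axis t 1 \<or> axis t (1::real) + axis s 1 = 0"
      by auto
    moreover have "axis t (1::real) + axis s 1 \<noteq> 0"
    proof
      assume "axis t (1::real) + axis s 1 = 0"
      then have "(axis t (1::real) + axis s 1) $ s = 0" by simp
      then show False by (auto simp: axis_def split: if_splits)
    qed
    ultimately show "e' = (Upair 0 (axis s 1), 0)" using t by simp
  qed
qed

lemma card_cubic_bridges: "card (bridges int_lattice (cubic_edges :: 'd::finite edge set)) \<le> 2 * CARD('d)"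
proof -
  have "card (bridges int_lattice (cubic_edges :: 'd edge set)) \<le>
    card (cubic_bridges :: 'd edge set) + card (range (\<lambda>s. (Upair (- axis s 1) (0 :: real^'d), 0 :: nat)))"
    unfolding cubic_bridges_char by (rule card_Un_le)
  also have "\<dots> \<le> CARD('d) + CARD('d)"
    unfolding cubic_bridges_def by (intro add_mono card_image_le finite)
  finally show ?thesis by simp
qed

text \<open>The general bounds determine everything once \<open>\<nu> = 1\<close>: there are fewer
  inner vertices than one, and \<open>1 + d \<le> \<nu>\<^sub>N \<le> 1 + #B\<close> with
  \<open>2 #B \<le> \<beta> \<le> 2 d\<close> leaves only equalities.\<close>

lemma cubic_extremal:
  shows "card (fund_verts (int_lattice :: (real^'d) set)) = 1"
    and "card (inner_verts (int_lattice :: (real^'d) set) cubic_edges cubic_bridges) = 0"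
    and "card (verts_N (int_lattice :: (real^'d) set) cubic_bridges) = 1 + CARD('d)"
    and "card (bridges int_lattice (cubic_edges :: 'd edge set)) = 2 * CARD('d)"
proof -
  interpret cut: cut_graph "int_lattice :: (real^'d) set" cubic_edges cubic_bridges
    by unfold_locales (rule cubic_bridge_choice)
  show F: "card (fund_verts (int_lattice :: (real^'d) set)) = 1" by (simp add: cubic_fund_verts)
  then show "card (inner_verts (int_lattice :: (real^'d) set) cubic_edges cubic_bridges) = 0"
    using cut.card_inner_verts_less by simp
  show "card (verts_N (int_lattice :: (real^'d) set) cubic_bridges) = 1 + CARD('d)"
    "card (bridges int_lattice (cubic_edges :: 'd edge set)) = 2 * CARD('d)"
    using F cut.card_VN_lower cut.card_VN_upper cut.card_bridges card_cubic_bridges[where 'd = 'd]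
    by simp_all
qed

section \<open>The total length of the spectral bands\<close>

text \<open>The condition that the inner vertices come first in the numbering guards the first bound
  alone, hence the implication. The bounds \<open>\<nu> - 1\<close> and \<open>\<beta> / 2\<close>
  are taken over the reals, where neither subtraction nor halving is truncated.\<close>

theorem theorem1p2:
  fixes V :: "(real^'d) set" and E B :: "'d edge set"
    and Q :: "real^'d \<Rightarrow> real" and v :: "nat \<Rightarrow> real^'d"
    and \<nu> \<nu>\<^sub>N \<nu>\<^sub>D \<beta> :: nat and lam :: "nat \<Rightarrow> real"
  assumes dim: "CARD('d) \<ge> 2"
    and graph: "periodic_graph V E"
    and potential: "periodic_potential V Q"
    and choice: "bridge_choice V E B"
    and numbering: "vertex_numbering V B v"
    and nu: "\<nu> = card (fund_verts V)"
    and nu_N: "\<nu>\<^sub>N = card (verts_N V B)"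
    and nu_D: "\<nu>\<^sub>D = card (inner_verts V E B)"
    and beta: "\<beta> = card (bridges V E)"
    and lam: "lam = eigval (neumann_matrix V E Q B v)"
  shows
    "(v ` {1..\<nu>\<^sub>D} = inner_verts V E B \<longrightarrow>
        (\<Sum>n=1..\<nu>. band_length V E Q v n)
          \<le> (\<Sum>n=\<nu>\<^sub>D+1..\<nu>. ordered_potential V Q v n + 2 * real (max_degree V E)
                              - h_number V E Q B (v n))
            + (\<Sum>n=\<nu>+1..\<nu>\<^sub>N. lam n))
     \<and> (\<Sum>n=1..\<nu>. band_length V E Q v n)
          \<le> (\<Sum>n=1..\<nu>-\<nu>\<^sub>D. lam (\<nu>\<^sub>N - (\<nu> - \<nu>\<^sub>D) + n) - lam n)
     \<and> 0 \<le> \<nu>\<^sub>D \<and> real \<nu>\<^sub>D \<le> real \<nu> - 1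
     \<and> \<nu> + CARD('d) \<le> \<nu>\<^sub>N \<and> real \<nu>\<^sub>N \<le> real \<nu> + real \<beta> / 2
     \<and> (\<exists>(V' :: (real^'d) set) E' B'. periodic_graph V' E' \<and> bridge_choice V' E' B' \<and>
          card (inner_verts V' E' B') = 0)
     \<and> (\<exists>(V' :: (real^'d) set) E' B'. periodic_graph V' E' \<and> bridge_choice V' E' B' \<and>
          real (card (inner_verts V' E' B')) = real (card (fund_verts V')) - 1)
     \<and> (\<exists>(V' :: (real^'d) set) E' B'. periodic_graph V' E' \<and> bridge_choice V' E' B' \<and>
          card (verts_N V' B') = card (fund_verts V') + CARD('d))
     \<and> (\<exists>(V' :: (real^'d) set) E' B'. periodic_graph V' E' \<and> bridge_choice V' E' B' \<and>
          real (card (verts_N V' B')) = real (card (fund_verts V')) + real (card (bridges V' E')) / 2)"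
proof -
  interpret periodic_graph V E by (rule graph)
  interpret cut_graph V E B by unfold_locales (rule choice)
  interpret numbered_graph V E B Q v by unfold_locales (rule potential, rule numbering)
  \<comment> \<open>One witness serves all four parts: the cubic lattice has
    \<open>\<nu> = 1\<close>, so the lower and the upper bound for \<open>\<nu>\<^sub>D\<close>
    coincide.\<close>
  have attained: "\<exists>(V' :: (real^'d) set) E' B'. periodic_graph V' E' \<and> bridge_choice V' E' B' \<and> P V' E' B'"
    if "P int_lattice cubic_edges cubic_bridges" for P
    using that periodic_graph_cubic cubic_bridge_choice by blast
  show ?thesis
  proof (intro conjI impI)
    assume "v ` {1..\<nu>\<^sub>D} = inner_verts V E B"
    then show "(\<Sum>n=1..\<nu>. band_length V E Q v n)
          \<le> (\<Sum>n=\<nu>\<^sub>D+1..\<nu>. ordered_potential V Q v n + 2 * real (max_degree V E)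
                              - h_number V E Q B (v n))
            + (\<Sum>n=\<nu>+1..\<nu>\<^sub>N. lam n)"
      unfolding nu nu_N nu_D lam by (rule band_sum_le_potential)
  next
    show "(\<Sum>n=1..\<nu>. band_length V E Q v n)
          \<le> (\<Sum>n=1..\<nu>-\<nu>\<^sub>D. lam (\<nu>\<^sub>N - (\<nu> - \<nu>\<^sub>D) + n) - lam n)"
      unfolding nu nu_N nu_D lam by (rule band_sum_le_neumann)
    show "0 \<le> \<nu>\<^sub>D" by simp
    show "real \<nu>\<^sub>D \<le> real \<nu> - 1"
      unfolding nu nu_D using card_inner_verts_less by linarith
    show "\<nu> + CARD('d) \<le> \<nu>\<^sub>N"
      unfolding nu nu_N by (rule card_VN_lower)
    show "real \<nu>\<^sub>N \<le> real \<nu> + real \<beta> / 2"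
      unfolding nu nu_N beta using card_VN_upper card_bridges by linarith
  qed (rule attained, simp add: cubic_extremal)+
qed

end
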